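(* Let $\mathsf{G}$ be an orbifold groupoid (smooth, étale and proper). Let $\mathsf{L}\mathsf{G}$ be its loop groupoid, and let $\mathsf{L}\mathsf{G}^{\mathbb R}$ be the subgroupoid of $\mathsf{L}\mathsf{G}$ fixed under the natural action of $\mathbb{R}$ (rotation of loops). Then $\mathsf{L}\mathsf{G}^{\mathbb R}$ is Morita equivalent to the inertia groupoid $\wedge\mathsf{G}$.
   Context: **Groupoids.** A groupoid $\mathsf{G}$ has objects $\mathsf{G}_0$, arrows $\mathsf{G}_1$, source and target $s,t:\mathsf{G}_1\to\mathsf{G}_0$, composition $m$, inverse $i$, identities $e:\mathsf{G}_0\to\mathsf{G}_1$. Composition is written in diagrammatic order: $a\cdot b$ is defined when $t(a)=s(b)$. It is topological (smooth) if everything is in topological spaces (smooth manifolds, with $s,t$ submersions), étale if $s,t$ are local homeomorphisms (local diffeomorphisms), proper if $(s,t):\mathsf{G}_1\to\mathsf{G}_0\times\mathsf{G}_0$ is proper. A morphism $\Psi:\mathsf{H}\to\mathsf{G}$ is a pair of continuous maps $\Psi_0,\Psi_1$ commuting with the structure maps. It is Morita if the square formed by $\Psi_1$, $\Psi_0\times\Psi_0$ and the two maps $(s,t)$ is cartesian and $s\pi_2:\mathsf{H}_0\,{}_{\Psi_0}\!\times_t\mathsf{G}_1\to\mathsf{G}_0$ is an open surjection. $\mathsf{G},\mathsf{H}$ are Morita equivalent if there are a topological groupoid $\mathsf{K}$ and Morita morphisms $\mathsf{G}\leftarrow\mathsf{K}\to\mathsf{H}$. **Circle groupoids.** For a finite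 set $q_1<\dots<q_n<q_0$ in $(0,1]$ (identified with points $e^{2\pi i q_k}$ of $S^1$) and $\epsilon>0$, consider the cover of $S^1$ by the (images of the) intervals $V_i=(q_i-\epsilon,q_{i+1}+\epsilon)$, indices cyclic (so $V_0=(q_0-\epsilon,q_1+1+\epsilon)$). It is admissible if all triple intersections of distinct members are empty; $\mathcal{W}$ is the set of admissible covers. A cover given by $(\{p_k\},\epsilon)$ refines one given by $(\{q_k\},\epsilon')$ if $\epsilon\le\epsilon'$ and $\{q_k\}\subset\{p_k\}$; each set of the finer cover then lies canonically in a set of the coarser. $\mathcal{W}$ is directed under refinement. For $W\in\mathcal{W}$ let $\{W_\beta\}$ be the intervals $V_i+k$ ($k\in\mathbb{Z}$) of $\mathbb{R}$, and $W_\beta^l:=W_\beta+l$. Put $\underline{\mathbb{R}^W}_0=\bigsqcup_\beta W_\beta$, $\underline{\mathbb{R}^W}_1=\bigsqcup_{(\beta,\gamma)}W_\beta\cap W_\gamma$. The groupoid $\mathsf{S}^1_W$ has objects $\underline{\mathbb{R}^W}_0$, arrows $\underline{\mathbb{R}^W}_1\times\mathbb{Z}$, $s((x,W_{\beta\gamma}),l)=(x,W_\beta)$, $t((x,W_{\beta\gamma}),l)=(x+l,W_\gamma^l)$, $e(x,W_\beta)=((x,W_{\beta\beta}),0)$, $((x,W_{\beta\gamma}),l)\cdot((x+l,W^l_{\gamma\sigma}),k)=((x,W_{\beta\sigma}),l+k)$. If $W'$ refines $W$ there is a natural morphism $\rho^{W'}_W:\mathsf{S}^1_{W'}\to\mathsf{S}^1_W$.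 **Loop groupoid.** $\mathsf{L}\mathsf{G}(W)$ has as objects the morphisms $\mathsf{S}^1_W\to\mathsf{G}$; an arrow from $\Psi$ to $\Phi$ is a continuous $\Lambda:\underline{\mathbb{R}^W}_1\times\mathbb{Z}\to\mathsf{G}_1$ with $s\Lambda(r)=\Psi_0(s(r))$, $t\Lambda(r)=\Phi_0(t(r))$ and $\Lambda(r)=\Psi_1(r)\cdot\Lambda(et(r))=\Lambda(es(r))\cdot\Phi_1(r)$ for all $r$. Arrows $\Lambda:\Psi\to\Phi$, $\Omega:\Phi\to\Gamma$ compose by $(\Omega\circ\Lambda)(es(r))=\Lambda(es(r))\cdot\Omega(es(r))$, $(\Omega\circ\Lambda)(r)=(\Omega\circ\Lambda)(es(r))\cdot\Gamma_1(r)$. Objects carry the compact-open topology, and arrows the compact-open topology via $\Lambda\mapsto(\Psi_1,\Lambda\circ e)$. Precomposition with $\rho^{W'}_W$ gives monomorphisms $\mathsf{L}\mathsf{G}(W)\hookrightarrow\mathsf{L}\mathsf{G}(W')$, and $\mathsf{L}\mathsf{G}:=\varinjlim_{W\in\mathcal{W}}\mathsf{L}\mathsf{G}(W)$. **$\mathbb{R}$-action.** For $z\in\mathbb{R}$ let $W^z=\{V+z\}$ be the shifted cover; $z$ sends $\Psi:\mathsf{S}^1_W\to\mathsf{G}$ to $\Psi^z:\mathsf{S}^1_{W^z}\to\mathsf{G}$, $\Psi^z_1((x,V^z_{\alpha\beta}),l)=\Psi_1((x-z,V_{\alpha\beta}),l)$, $\Psi_0^z(x,V_\alpha^z)=\Psi_0(x-z,V_\alpha)$,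 and acts on arrows in the same way. **Inertia groupoid.** $\wedge\mathsf{G}$ has objects $\{v\in\mathsf{G}_1: s(v)=t(v)\}$; an arrow $v\to w$ is $\alpha\in\mathsf{G}_1$ with $v\cdot\alpha=\alpha\cdot w$ (topologies induced from $\mathsf{G}_1$ and $\mathsf{G}_1\,{}_t\!\times_s\mathsf{G}_1$). *)

theory Defs
  imports "HOL-Analysis.Analysis"
begin

section \<open>Topological preliminaries\<close>

definition fiber_product ::
  "'a topology \<Rightarrow> ('a \<Rightarrow> 'c) \<Rightarrow> 'b topology \<Rightarrow> ('b \<Rightarrow> 'c) \<Rightarrow> ('a \<times> 'b) topology" where
  "fiber_product X f Y g = subtopology (prod_topology X Y) {(x, y). f x = g y}"

text \<open>The square with upper left corner \<open>P\<close>, projections \<open>p : P \<rightarrow> X\<close> and \<open>q : P \<rightarrow> Y\<close>, and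
  maps \<open>f\<close>, \<open>g\<close> from \<open>X\<close>, \<open>Y\<close> to a common space commutes and is cartesian.\<close>

definition cartesian_square ::
  "'p topology \<Rightarrow> ('p \<Rightarrow> 'a) \<Rightarrow> ('p \<Rightarrow> 'b) \<Rightarrow> 'a topology \<Rightarrow> ('a \<Rightarrow> 'c) \<Rightarrow> 'b topology \<Rightarrow> ('b \<Rightarrow> 'c) \<Rightarrow> bool"
  where
  "cartesian_square P p q X f Y g \<longleftrightarrow>
     (\<forall>u\<in>topspace P. f (p u) = g (q u)) \<and>
     homeomorphic_map P (fiber_product X f Y g) (\<lambda>u. (p u, q u))"

definition quotient_topology :: "'a topology \<Rightarrow> ('a \<Rightarrow> 'b) \<Rightarrow> 'b topology" where
  "quotient_topology X f =
     topology (\<lambda>U. U \<subseteq> f ` topspace X \<and> openin X {x \<in> topspace X. f x \<in> U})"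

lemma openin_quotient_topology:
  "openin (quotient_topology X f) U \<longleftrightarrow>
     U \<subseteq> f ` topspace X \<and> openin X {x \<in> topspace X. f x \<in> U}"
proof -
  have "istopology (\<lambda>U. U \<subseteq> f ` topspace X \<and> openin X {x \<in> topspace X. f x \<in> U})"
    unfolding istopology_def
  proof (intro conjI allI impI)
    fix S T assume "S \<subseteq> f ` topspace X \<and> openin X {x \<in> topspace X. f x \<in> S}"
      and "T \<subseteq> f ` topspace X \<and> openin X {x \<in> topspace X. f x \<in> T}"
    moreover have "{x \<in> topspace X. f x \<in> S \<inter> T} =
        {x \<in> topspace X. f x \<in> S} \<inter> {x \<in> topspace X. f x \<in> T}" by auto
    ultimately show "S \<inter> T \<subseteq> f ` topspace X" "openin X {x \<in> topspace X. f x \<in> S \<inter> T}"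
      by auto
  next
    fix K assume K: "\<forall>U\<in>K. U \<subseteq> f ` topspace X \<and> openin X {x \<in> topspace X. f x \<in> U}"
    then show "\<Union>K \<subseteq> f ` topspace X" by auto
    have "{x \<in> topspace X. f x \<in> \<Union>K} = (\<Union>U\<in>K. {x \<in> topspace X. f x \<in> U})" by auto
    with K show "openin X {x \<in> topspace X. f x \<in> \<Union>K}" by auto
  qed
  then show ?thesis
    by (simp add: quotient_topology_def)
qed

text \<open>The space of continuous maps with the compact-open topology.  Points of the mapping space
  are extensional functions, so that equality of points is equality of maps on \<open>X\<close>.\<close>

definition continuous_maps :: "'a topology \<Rightarrow> 'b topology \<Rightarrow> ('a \<Rightarrow> 'b) set" where
  "continuous_maps X Y = {f \<in> extensional (topspace X). continuous_map X Y f}"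

definition compact_open_topology :: "'a topology \<Rightarrow> 'b topology \<Rightarrow> ('a \<Rightarrow> 'b) topology" where
  "compact_open_topology X Y =
     topology_generated_by
       {{f \<in> continuous_maps X Y. f ` K \<subseteq> U} | K U. compactin X K \<and> openin Y U}"

definition second_countable_space :: "'a topology \<Rightarrow> bool" where
  "second_countable_space X \<longleftrightarrow>
     (\<exists>\<B>. countable \<B> \<and> (\<forall>V\<in>\<B>. openin X V) \<and>
          (\<forall>U x. openin X U \<and> x \<in> U \<longrightarrow> (\<exists>V\<in>\<B>. x \<in> V \<and> V \<subseteq> U)))"

section \<open>Smooth manifolds\<close>

text \<open>\<open>\<real>\<^sup>d\<close> is \<^const>\<open>Euclidean_space\<close> \<open>d\<close>: the sequences of reals vanishing from index \<open>d\<close> on.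
  In this way the dimension is a number, and it may be zero.\<close>

definition partial_deriv :: "nat \<Rightarrow> ((nat \<Rightarrow> real) \<Rightarrow> real) \<Rightarrow> (nat \<Rightarrow> real) \<Rightarrow> real" where
  "partial_deriv j f x = deriv (\<lambda>t. f (x(j := t))) (x j)"

primrec C_k_on :: "nat \<Rightarrow> nat \<Rightarrow> (nat \<Rightarrow> real) set \<Rightarrow> ((nat \<Rightarrow> real) \<Rightarrow> real) \<Rightarrow> bool" where
  "C_k_on 0 d U f \<longleftrightarrow> continuous_map (subtopology (Euclidean_space d) U) euclideanreal f"
| "C_k_on (Suc k) d U f \<longleftrightarrow>
     continuous_map (subtopology (Euclidean_space d) U) euclideanreal f \<and>
     (\<forall>j<d. (\<forall>x\<in>U. (\<lambda>t. f (x(j := t))) differentiable (at (x j))) \<and>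
            C_k_on k d U (partial_deriv j f))"

definition smooth_euclidean ::
  "nat \<Rightarrow> (nat \<Rightarrow> real) set \<Rightarrow> nat \<Rightarrow> ((nat \<Rightarrow> real) \<Rightarrow> (nat \<Rightarrow> real)) \<Rightarrow> bool" where
  "smooth_euclidean d U e f \<longleftrightarrow> (\<forall>i<e. \<forall>k. C_k_on k d U (\<lambda>x. f x i))"

text \<open>A chart consists of its dimension, its domain and its coordinate map; different components
  of a manifold are allowed to have different dimensions.\<close>

type_synonym 'x chart = "nat \<times> 'x set \<times> ('x \<Rightarrow> nat \<Rightarrow> real)"

definition is_chart :: "'x topology \<Rightarrow> 'x chart \<Rightarrow> bool" where
  "is_chart X c = (case c of (d, U, \<phi>) \<Rightarrow>
     openin X U \<and> openin (Euclidean_space d) (\<phi> ` U) \<and>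
     homeomorphic_map (subtopology X U) (subtopology (Euclidean_space d) (\<phi> ` U)) \<phi>)"

definition smooth_in_charts :: "'x chart \<Rightarrow> 'y chart \<Rightarrow> ('x \<Rightarrow> 'y) \<Rightarrow> bool" where
  "smooth_in_charts c c' f = (case (c, c') of ((d, U, \<phi>), (e, V, \<psi>)) \<Rightarrow>
     smooth_euclidean d (\<phi> ` {x \<in> U. f x \<in> V}) e (\<lambda>y. \<psi> (f (inv_into U \<phi> y))))"

definition smooth_manifold :: "'x topology \<Rightarrow> 'x chart set \<Rightarrow> bool" where
  "smooth_manifold X A \<longleftrightarrow>
     Hausdorff_space X \<and> second_countable_space X \<and>
     (\<forall>c\<in>A. is_chart X c) \<and> (\<Union>(d, U, \<phi>)\<in>A. U) = topspace X \<and>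
     (\<forall>c\<in>A. \<forall>c'\<in>A. smooth_in_charts c c' (\<lambda>x. x))"

definition smooth_map ::
  "'x topology \<Rightarrow> 'x chart set \<Rightarrow> 'y topology \<Rightarrow> 'y chart set \<Rightarrow> ('x \<Rightarrow> 'y) \<Rightarrow> bool" where
  "smooth_map X A Y B f \<longleftrightarrow>
     continuous_map X Y f \<and> (\<forall>c\<in>A. \<forall>c'\<in>B. smooth_in_charts c c' f)"

definition restrict_atlas :: "'x set \<Rightarrow> 'x chart set \<Rightarrow> 'x chart set" where
  "restrict_atlas S A = (\<lambda>(d, U, \<phi>). (d, U \<inter> S, \<phi>)) ` A"

definition prod_atlas :: "'x chart set \<Rightarrow> 'y chart set \<Rightarrow> ('x \<times> 'y) chart set" where
  "prod_atlas A B =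
     {(d + e, U \<times> V, \<lambda>(x, y) i. if i < d then \<phi> x i else \<psi> y (i - d)) | d U \<phi> e V \<psi>.
        (d, U, \<phi>) \<in> A \<and> (e, V, \<psi>) \<in> B}"

text \<open>Smoothness of a map defined on a subset \<open>S\<close> of a manifold: it locally extends to a smooth map
  on an open subset of the manifold.  For an embedded submanifold \<open>S\<close> this is smoothness with
  respect to the induced smooth structure.\<close>

definition smooth_map_on_subset ::
  "'x topology \<Rightarrow> 'x chart set \<Rightarrow> 'x set \<Rightarrow> 'y topology \<Rightarrow> 'y chart set \<Rightarrow> ('x \<Rightarrow> 'y) \<Rightarrow> bool" where
  "smooth_map_on_subset X A S Y B f \<longleftrightarrow>
     (\<forall>x\<in>S. \<exists>U h. openin X U \<and> x \<in> U \<and>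
        smooth_map (subtopology X U) (restrict_atlas U A) Y B h \<and> (\<forall>y\<in>U \<inter> S. h y = f y))"

definition submersion ::
  "'x topology \<Rightarrow> 'x chart set \<Rightarrow> 'y topology \<Rightarrow> 'y chart set \<Rightarrow> ('x \<Rightarrow> 'y) \<Rightarrow> bool" where
  "submersion X A Y B f \<longleftrightarrow>
     smooth_map X A Y B f \<and>
     (\<forall>(d, U, \<phi>)\<in>A. \<forall>(e, V, \<psi>)\<in>B. \<forall>x\<in>U. f x \<in> V \<longrightarrow>
        (\<forall>w. \<exists>v. \<forall>i<e.
           (\<Sum>j<d. partial_deriv j (\<lambda>y. \<psi> (f (inv_into U \<phi> y)) i) (\<phi> x) * v j) = w i))"

definition diffeomorphism ::
  "'x topology \<Rightarrow> 'x chart set \<Rightarrow> 'y topology \<Rightarrow> 'y chart set \<Rightarrow> ('x \<Rightarrow> 'y) \<Rightarrow> bool" where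
  "diffeomorphism X A Y B f \<longleftrightarrow>
     (\<exists>g. homeomorphic_maps X Y f g \<and> smooth_map X A Y B f \<and> smooth_map Y B X A g)"

definition local_diffeomorphism ::
  "'x topology \<Rightarrow> 'x chart set \<Rightarrow> 'y topology \<Rightarrow> 'y chart set \<Rightarrow> ('x \<Rightarrow> 'y) \<Rightarrow> bool" where
  "local_diffeomorphism X A Y B f \<longleftrightarrow>
     (\<forall>x\<in>topspace X. \<exists>U V. openin X U \<and> x \<in> U \<and> openin Y V \<and>
        diffeomorphism (subtopology X U) (restrict_atlas U A)
                       (subtopology Y V) (restrict_atlas V B) f)"

section \<open>Groupoids\<close>

text \<open>\<open>mult\<close> is composition in diagrammatic order: \<open>mult G a b\<close> is meaningful when
  \<open>tgt G a = src G b\<close>.\<close>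

record ('o, 'a) groupoid =
  Obj :: "'o topology"
  Arr :: "'a topology"
  src :: "'a \<Rightarrow> 'o"
  tgt :: "'a \<Rightarrow> 'o"
  mult :: "'a \<Rightarrow> 'a \<Rightarrow> 'a"
  ginv :: "'a \<Rightarrow> 'a"
  ident :: "'o \<Rightarrow> 'a"

locale topological_groupoid =
  fixes G :: "('o, 'a) groupoid"
  assumes continuous_src: "continuous_map (Arr G) (Obj G) (src G)"
    and continuous_tgt: "continuous_map (Arr G) (Obj G) (tgt G)"
    and continuous_ident: "continuous_map (Obj G) (Arr G) (ident G)"
    and continuous_ginv: "continuous_map (Arr G) (Arr G) (ginv G)"
    and continuous_mult:
      "continuous_map (fiber_product (Arr G) (tgt G) (Arr G) (src G)) (Arr G)
         (\<lambda>(a, b). mult G a b)"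
    and src_mult: "\<lbrakk>a \<in> topspace (Arr G); b \<in> topspace (Arr G); tgt G a = src G b\<rbrakk>
      \<Longrightarrow> src G (mult G a b) = src G a"
    and tgt_mult: "\<lbrakk>a \<in> topspace (Arr G); b \<in> topspace (Arr G); tgt G a = src G b\<rbrakk>
      \<Longrightarrow> tgt G (mult G a b) = tgt G b"
    and mult_assoc: "\<lbrakk>a \<in> topspace (Arr G); b \<in> topspace (Arr G); c \<in> topspace (Arr G);
        tgt G a = src G b; tgt G b = src G c\<rbrakk>
      \<Longrightarrow> mult G (mult G a b) c = mult G a (mult G b c)"
    and src_ident: "x \<in> topspace (Obj G) \<Longrightarrow> src G (ident G x) = x"
    and tgt_ident: "x \<in> topspace (Obj G) \<Longrightarrow> tgt G (ident G x) = x"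
    and mult_ident_left: "a \<in> topspace (Arr G) \<Longrightarrow> mult G (ident G (src G a)) a = a"
    and mult_ident_right: "a \<in> topspace (Arr G) \<Longrightarrow> mult G a (ident G (tgt G a)) = a"
    and src_ginv: "a \<in> topspace (Arr G) \<Longrightarrow> src G (ginv G a) = tgt G a"
    and tgt_ginv: "a \<in> topspace (Arr G) \<Longrightarrow> tgt G (ginv G a) = src G a"
    and mult_ginv_right: "a \<in> topspace (Arr G) \<Longrightarrow> mult G a (ginv G a) = ident G (src G a)"
    and mult_ginv_left: "a \<in> topspace (Arr G) \<Longrightarrow> mult G (ginv G a) a = ident G (tgt G a)"

definition groupoid_morphism ::
  "('o1, 'a1) groupoid \<Rightarrow> ('o2, 'a2) groupoid \<Rightarrow> ('o1 \<Rightarrow> 'o2) \<times> ('a1 \<Rightarrow> 'a2) \<Rightarrow> bool" where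
  "groupoid_morphism H G \<Psi> = (case \<Psi> of (\<Psi>0, \<Psi>1) \<Rightarrow>
     continuous_map (Obj H) (Obj G) \<Psi>0 \<and> continuous_map (Arr H) (Arr G) \<Psi>1 \<and>
     (\<forall>a\<in>topspace (Arr H). src G (\<Psi>1 a) = \<Psi>0 (src H a)) \<and>
     (\<forall>a\<in>topspace (Arr H). tgt G (\<Psi>1 a) = \<Psi>0 (tgt H a)) \<and>
     (\<forall>a\<in>topspace (Arr H). \<forall>b\<in>topspace (Arr H). tgt H a = src H b \<longrightarrow>
        \<Psi>1 (mult H a b) = mult G (\<Psi>1 a) (\<Psi>1 b)) \<and>
     (\<forall>a\<in>topspace (Arr H). \<Psi>1 (ginv H a) = ginv G (\<Psi>1 a)) \<and>
     (\<forall>x\<in>topspace (Obj H). \<Psi>1 (ident H x) = ident G (\<Psi>0 x)))"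

definition morita_morphism ::
  "('o1, 'a1) groupoid \<Rightarrow> ('o2, 'a2) groupoid \<Rightarrow> ('o1 \<Rightarrow> 'o2) \<times> ('a1 \<Rightarrow> 'a2) \<Rightarrow> bool" where
  "morita_morphism H G \<Psi> \<longleftrightarrow>
     groupoid_morphism H G \<Psi> \<and>
     cartesian_square (Arr H)
       (\<lambda>a. (src H a, tgt H a)) (snd \<Psi>)
       (prod_topology (Obj H) (Obj H)) (\<lambda>(x, y). (fst \<Psi> x, fst \<Psi> y))
       (Arr G) (\<lambda>g. (src G g, tgt G g)) \<and>
     (let P = fiber_product (Obj H) (fst \<Psi>) (Arr G) (tgt G); f = (\<lambda>(x, g). src G g)
      in open_map P (Obj G) f \<and> f ` topspace P = topspace (Obj G))"

text \<open>The middle groupoid \<open>K\<close> has to range over a fixed type.  Nothing is lost: a span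
  \<open>G \<leftarrow> K \<rightarrow> H\<close> of Morita morphisms yields the bibundle \<open>P = (G\<^sub>1 \<times> K\<^sub>0 \<times> H\<^sub>1) / K\<^sub>1\<close> (fibre products
  over \<open>G\<^sub>0\<close> and \<open>H\<^sub>0\<close>), whose fibres over \<open>G\<^sub>0\<close> are \<open>H\<close>-torsors and hence inject into \<open>H\<^sub>1\<close>.  So \<open>P\<close>
  can be encoded in \<open>'o1 \<times> 'a2\<close>, and \<open>K\<close> can be replaced by the action groupoid of \<open>G \<times> H\<close> on \<open>P\<close>.\<close>

definition morita_equivalent :: "('o1, 'a1) groupoid \<Rightarrow> ('o2, 'a2) groupoid \<Rightarrow> bool" where
  "morita_equivalent G H \<longleftrightarrow>
     topological_groupoid G \<and> topological_groupoid H \<and>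
     (\<exists>(K :: ('o1 \<times> 'a2, 'a1 \<times> ('o1 \<times> 'a2) \<times> 'a2) groupoid) \<phi> \<psi>.
        topological_groupoid K \<and> morita_morphism K G \<phi> \<and> morita_morphism K H \<psi>)"

definition smooth_groupoid :: "('o, 'a) groupoid \<Rightarrow> 'o chart set \<Rightarrow> 'a chart set \<Rightarrow> bool" where
  "smooth_groupoid G A0 A1 \<longleftrightarrow>
     topological_groupoid G \<and>
     smooth_manifold (Obj G) A0 \<and> smooth_manifold (Arr G) A1 \<and>
     submersion (Arr G) A1 (Obj G) A0 (src G) \<and> submersion (Arr G) A1 (Obj G) A0 (tgt G) \<and>
     smooth_map_on_subset (prod_topology (Arr G) (Arr G)) (prod_atlas A1 A1)
       (topspace (fiber_product (Arr G) (tgt G) (Arr G) (src G))) (Arr G) A1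
       (\<lambda>(a, b). mult G a b) \<and>
     smooth_map (Arr G) A1 (Arr G) A1 (ginv G) \<and>
     smooth_map (Obj G) A0 (Arr G) A1 (ident G)"

definition etale_groupoid :: "('o, 'a) groupoid \<Rightarrow> 'o chart set \<Rightarrow> 'a chart set \<Rightarrow> bool" where
  "etale_groupoid G A0 A1 \<longleftrightarrow>
     local_diffeomorphism (Arr G) A1 (Obj G) A0 (src G) \<and>
     local_diffeomorphism (Arr G) A1 (Obj G) A0 (tgt G)"

definition proper_groupoid :: "('o, 'a) groupoid \<Rightarrow> bool" where
  "proper_groupoid G \<longleftrightarrow>
     proper_map (Arr G) (prod_topology (Obj G) (Obj G)) (\<lambda>a. (src G a, tgt G a))"

definition orbifold_groupoid :: "('o, 'a) groupoid \<Rightarrow> 'o chart set \<Rightarrow> 'a chart set \<Rightarrow> bool" where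
  "orbifold_groupoid G A0 A1 \<longleftrightarrow>
     smooth_groupoid G A0 A1 \<and> etale_groupoid G A0 A1 \<and> proper_groupoid G"

section \<open>Directed colimits\<close>

text \<open>Colimits of a system \<open>X\<close> of spaces over a directed index set \<open>(I, le)\<close> with transition maps
  \<open>\<tau> i k : X i \<rightarrow> X k\<close> for \<open>le i k\<close>: points are equivalence classes of pairs \<open>(i, x)\<close>, \<open>x \<in> X i\<close>.\<close>

definition colim_rel ::
  "'i set \<Rightarrow> ('i \<Rightarrow> 'i \<Rightarrow> bool) \<Rightarrow> ('i \<Rightarrow> 'x topology) \<Rightarrow> ('i \<Rightarrow> 'i \<Rightarrow> 'x \<Rightarrow> 'x) \<Rightarrow> (('i \<times> 'x) \<times> ('i \<times> 'x)) set"
  where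
  "colim_rel I le X \<tau> =
     {((i, x), (j, y)). i \<in> I \<and> j \<in> I \<and> x \<in> topspace (X i) \<and> y \<in> topspace (X j) \<and>
        (\<exists>k\<in>I. le i k \<and> le j k \<and> \<tau> i k x = \<tau> j k y)}"

definition colim_class ::
  "'i set \<Rightarrow> ('i \<Rightarrow> 'i \<Rightarrow> bool) \<Rightarrow> ('i \<Rightarrow> 'x topology) \<Rightarrow> ('i \<Rightarrow> 'i \<Rightarrow> 'x \<Rightarrow> 'x) \<Rightarrow> 'i \<times> 'x \<Rightarrow> ('i \<times> 'x) set"
  where
  "colim_class I le X \<tau> p = colim_rel I le X \<tau> `` {p}"

definition colim_topology ::
  "'i set \<Rightarrow> ('i \<Rightarrow> 'i \<Rightarrow> bool) \<Rightarrow> ('i \<Rightarrow> 'x topology) \<Rightarrow> ('i \<Rightarrow> 'i \<Rightarrow> 'x \<Rightarrow> 'x) \<Rightarrow> ('i \<times> 'x) set topology"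
  where
  "colim_topology I le X \<tau> = quotient_topology (sum_topology X I) (colim_class I le X \<tau>)"

text \<open>The colimit of a directed system of groupoids is formed on objects and on arrows; the structure
  maps are those induced on equivalence classes, two arrows being composed at a common stage.\<close>

definition colim_groupoid ::
  "'i set \<Rightarrow> ('i \<Rightarrow> 'i \<Rightarrow> bool) \<Rightarrow> ('i \<Rightarrow> ('o, 'a) groupoid) \<Rightarrow> ('i \<Rightarrow> 'i \<Rightarrow> 'o \<Rightarrow> 'o) \<Rightarrow> ('i \<Rightarrow> 'i \<Rightarrow> 'a \<Rightarrow> 'a) \<Rightarrow>
     (('i \<times> 'o) set, ('i \<times> 'a) set) groupoid" where
  "colim_groupoid I le D \<tau>0 \<tau>1 =
     (let cls0 = colim_class I le (\<lambda>i. Obj (D i)) \<tau>0;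
          cls1 = colim_class I le (\<lambda>i. Arr (D i)) \<tau>1
      in \<lparr>Obj = colim_topology I le (\<lambda>i. Obj (D i)) \<tau>0,
          Arr = colim_topology I le (\<lambda>i. Arr (D i)) \<tau>1,
          src = (\<lambda>A. THE c. \<exists>(i, a)\<in>A. c = cls0 (i, src (D i) a)),
          tgt = (\<lambda>A. THE c. \<exists>(i, a)\<in>A. c = cls0 (i, tgt (D i) a)),
          mult = (\<lambda>A B. THE c. \<exists>i a b. (i, a) \<in> A \<and> (i, b) \<in> B \<and> tgt (D i) a = src (D i) b \<and>
                                c = cls1 (i, mult (D i) a b)),
          ginv = (\<lambda>A. THE c. \<exists>(i, a)\<in>A. c = cls1 (i, ginv (D i) a)),
          ident = (\<lambda>X. THE c. \<exists>(i, x)\<in>X. c = cls1 (i, ident (D i) x))\<rparr>)"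

section \<open>Covers of the circle and the circle groupoids\<close>

text \<open>A cover is given by its finite set \<open>{q\<^sub>1 < \<dots> < q\<^sub>n < q\<^sub>0}\<close> of points of \<open>(0,1]\<close> and by \<open>\<epsilon>\<close>.
  The intervals \<open>V\<^sub>i + k\<close> are indexed by their base points \<open>b = q\<^sub>i + k\<close>: with the points extended
  periodically to \<open>\<real>\<close> and \<open>b'\<close> denoting the successor of \<open>b\<close>, the interval \<open>W\<^sub>b\<close> is \<open>(b - \<epsilon>, b' + \<epsilon>)\<close>.
  In particular \<open>W\<^sub>b + l\<close> is \<open>W\<close> at \<open>b + l\<close>, and the \<open>V\<^sub>i\<close> are the \<open>W\<^sub>b\<close> with \<open>b \<in> (0,1]\<close>.\<close>

type_synonym circle_cover = "real set \<times> real"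

definition base_points :: "circle_cover \<Rightarrow> real set" where
  "base_points W = {q + of_int k | q k. q \<in> fst W}"

definition next_point :: "circle_cover \<Rightarrow> real \<Rightarrow> real" where
  "next_point W b = (LEAST c. c \<in> base_points W \<and> b < c)"

definition cover_interval :: "circle_cover \<Rightarrow> real \<Rightarrow> real set" where
  "cover_interval W b = {b - snd W <..< next_point W b + snd W}"

definition cover_arc :: "circle_cover \<Rightarrow> real \<Rightarrow> complex set" where
  "cover_arc W q = (\<lambda>x. cis (2 * pi * x)) ` cover_interval W q"

definition admissible_covers :: "circle_cover set" where
  "admissible_covers =
     {W. finite (fst W) \<and> fst W \<noteq> {} \<and> fst W \<subseteq> {0<..1} \<and> 0 < snd W \<and>
         (\<forall>p\<in>fst W. \<forall>q\<in>fst W. \<forall>r\<in>fst W. p \<noteq> q \<and> q \<noteq> r \<and> p \<noteq> r \<longrightarrow>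
            cover_arc W p \<inter> cover_arc W q \<inter> cover_arc W r = {})}"

definition refines :: "circle_cover \<Rightarrow> circle_cover \<Rightarrow> bool" where
  "refines W' W \<longleftrightarrow> snd W' \<le> snd W \<and> fst W \<subseteq> fst W'"

text \<open>If \<open>W'\<close> refines \<open>W\<close>, the interval of \<open>W'\<close> at \<open>p\<close> lies canonically in the interval of \<open>W\<close> at the
  base point \<open>b\<close> with \<open>b \<le> p < b'\<close>.\<close>

definition canonical_index :: "circle_cover \<Rightarrow> real \<Rightarrow> real" where
  "canonical_index W p = (THE b. b \<in> base_points W \<and> b \<le> p \<and> p < next_point W b)"

text \<open>Objects of the circle groupoid are \<open>(b, x)\<close> with \<open>x \<in> W\<^sub>b\<close>, arrows are \<open>(((b, c), x), l)\<close> with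
  \<open>x \<in> W\<^sub>b \<inter> W\<^sub>c\<close>.\<close>

type_synonym s1_obj = "real \<times> real"
type_synonym s1_arr = "((real \<times> real) \<times> real) \<times> int"

definition circle_groupoid :: "circle_cover \<Rightarrow> (s1_obj, s1_arr) groupoid" where
  "circle_groupoid W =
     \<lparr>Obj = sum_topology (\<lambda>b. top_of_set (cover_interval W b)) (base_points W),
      Arr = prod_topology
              (sum_topology (\<lambda>(b, c). top_of_set (cover_interval W b \<inter> cover_interval W c))
                 (base_points W \<times> base_points W))
              (discrete_topology UNIV),
      src = (\<lambda>(((b, c), x), l). (b, x)),
      tgt = (\<lambda>(((b, c), x), l). (c + of_int l, x + of_int l)),
      mult = (\<lambda>(((b, c), x), l) (((c', d), y), k). (((b, d - of_int l), x), l + k)),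
      ginv = (\<lambda>(((b, c), x), l). (((c + of_int l, b + of_int l), x + of_int l), - l)),
      ident = (\<lambda>(b, x). (((b, b), x), 0))\<rparr>"

definition refinement_obj :: "circle_cover \<Rightarrow> s1_obj \<Rightarrow> s1_obj" where
  "refinement_obj W = (\<lambda>(p, x). (canonical_index W p, x))"

definition refinement_arr :: "circle_cover \<Rightarrow> s1_arr \<Rightarrow> s1_arr" where
  "refinement_arr W = (\<lambda>(((p, p'), x), l). (((canonical_index W p, canonical_index W p'), x), l))"

section \<open>The loop groupoid\<close>

type_synonym ('o, 'a) loop = "(s1_obj \<Rightarrow> 'o) \<times> (s1_arr \<Rightarrow> 'a)"
type_synonym ('o, 'a) loop_arrow = "('o, 'a) loop \<times> ('o, 'a) loop \<times> (s1_arr \<Rightarrow> 'a)"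

definition loop_space :: "('o, 'a) groupoid \<Rightarrow> circle_cover \<Rightarrow> ('o, 'a) loop topology" where
  "loop_space G W =
     (let S = circle_groupoid W
      in subtopology
           (prod_topology (compact_open_topology (Obj S) (Obj G))
                          (compact_open_topology (Arr S) (Arr G)))
           {\<Psi>. groupoid_morphism S G \<Psi>})"

definition loop_arrows :: "('o, 'a) groupoid \<Rightarrow> circle_cover \<Rightarrow> ('o, 'a) loop_arrow set" where
  "loop_arrows G W =
     (let S = circle_groupoid W
      in {(\<Psi>, \<Phi>, \<Lambda>). \<Psi> \<in> topspace (loop_space G W) \<and> \<Phi> \<in> topspace (loop_space G W) \<and>
           \<Lambda> \<in> continuous_maps (Arr S) (Arr G) \<and>
           (\<forall>r\<in>topspace (Arr S).
              src G (\<Lambda> r) = fst \<Psi> (src S r) \<and> tgt G (\<Lambda> r) = fst \<Phi> (tgt S r) \<and>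
              \<Lambda> r = mult G (snd \<Psi> r) (\<Lambda> (ident S (tgt S r))) \<and>
              \<Lambda> r = mult G (\<Lambda> (ident S (src S r))) (snd \<Phi> r))})"

definition loop_arrow_space :: "('o, 'a) groupoid \<Rightarrow> circle_cover \<Rightarrow> ('o, 'a) loop_arrow topology"
  where
  "loop_arrow_space G W =
     (let S = circle_groupoid W
      in pullback_topology (loop_arrows G W)
           (\<lambda>(\<Psi>, \<Phi>, \<Lambda>). (snd \<Psi>, restrict (\<lambda>x. \<Lambda> (ident S x)) (topspace (Obj S))))
           (prod_topology (compact_open_topology (Arr S) (Arr G))
                          (compact_open_topology (Obj S) (Arr G))))"

text \<open>The identity arrow of \<open>\<Psi>\<close> is \<open>\<Psi>\<^sub>1\<close>, and the inverse of \<open>\<Lambda> : \<Psi> \<rightarrow> \<Phi>\<close> is determined by its value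
  \<open>\<Lambda>(es(r))\<^sup>-\<^sup>1\<close> at \<open>es(r)\<close>.\<close>

definition loop_groupoid_at ::
  "('o, 'a) groupoid \<Rightarrow> circle_cover \<Rightarrow> (('o, 'a) loop, ('o, 'a) loop_arrow) groupoid" where
  "loop_groupoid_at G W =
     (let S = circle_groupoid W; es = (\<lambda>r. ident S (src S r))
      in \<lparr>Obj = loop_space G W,
          Arr = loop_arrow_space G W,
          src = (\<lambda>(\<Psi>, \<Phi>, \<Lambda>). \<Psi>),
          tgt = (\<lambda>(\<Psi>, \<Phi>, \<Lambda>). \<Phi>),
          mult = (\<lambda>(\<Psi>, \<Phi>, \<Lambda>) (\<Phi>', \<Gamma>, \<Omega>).
            (\<Psi>, \<Gamma>, restrict (\<lambda>r. mult G (mult G (\<Lambda> (es r)) (\<Omega> (es r))) (snd \<Gamma> r))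
                      (topspace (Arr S)))),
          ginv = (\<lambda>(\<Psi>, \<Phi>, \<Lambda>).
            (\<Phi>, \<Psi>, restrict (\<lambda>r. mult G (ginv G (\<Lambda> (es r))) (snd \<Psi> r)) (topspace (Arr S)))),
          ident = (\<lambda>\<Psi>. (\<Psi>, \<Psi>, snd \<Psi>))\<rparr>)"

text \<open>Precomposition with the natural morphism of circle groupoids, for \<open>W'\<close> refining \<open>W\<close>; the morphism
  depends on \<open>W'\<close> only through its domain.\<close>

definition loop_restrict :: "circle_cover \<Rightarrow> circle_cover \<Rightarrow> ('o, 'a) loop \<Rightarrow> ('o, 'a) loop" where
  "loop_restrict W W' \<Psi> =
     (restrict (fst \<Psi> \<circ> refinement_obj W) (topspace (Obj (circle_groupoid W'))),
      restrict (snd \<Psi> \<circ> refinement_arr W) (topspace (Arr (circle_groupoid W'))))"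

definition loop_arrow_restrict ::
  "circle_cover \<Rightarrow> circle_cover \<Rightarrow> ('o, 'a) loop_arrow \<Rightarrow> ('o, 'a) loop_arrow" where
  "loop_arrow_restrict W W' = (\<lambda>(\<Psi>, \<Phi>, \<Lambda>).
     (loop_restrict W W' \<Psi>, loop_restrict W W' \<Phi>,
      restrict (\<Lambda> \<circ> refinement_arr W) (topspace (Arr (circle_groupoid W')))))"

type_synonym ('o, 'a) colim_loop = "(circle_cover \<times> ('o, 'a) loop) set"
type_synonym ('o, 'a) colim_loop_arrow = "(circle_cover \<times> ('o, 'a) loop_arrow) set"

definition loop_groupoid ::
  "('o, 'a) groupoid \<Rightarrow> (('o, 'a) colim_loop, ('o, 'a) colim_loop_arrow) groupoid" where
  "loop_groupoid G =
     colim_groupoid admissible_covers (\<lambda>W W'. refines W' W) (loop_groupoid_at G)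
       loop_restrict loop_arrow_restrict"

section \<open>Rotation of loops\<close>

text \<open>The points \<open>q + z\<close> of the shifted cover are taken modulo \<open>1\<close>, with representatives in \<open>(0,1]\<close>;
  the set of base points in \<open>\<real>\<close> is then shifted by \<open>z\<close>.\<close>

definition shift_cover :: "real \<Rightarrow> circle_cover \<Rightarrow> circle_cover" where
  "shift_cover z W = ({x \<in> {0<..1}. x - z \<in> base_points W}, snd W)"

definition rotate_loop :: "real \<Rightarrow> circle_cover \<Rightarrow> ('o, 'a) loop \<Rightarrow> ('o, 'a) loop" where
  "rotate_loop z W \<Psi> =
     (restrict (\<lambda>(b, x). fst \<Psi> (b - z, x - z)) (topspace (Obj (circle_groupoid (shift_cover z W)))),
      restrict (\<lambda>(((b, c), x), l). snd \<Psi> (((b - z, c - z), x - z), l))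
        (topspace (Arr (circle_groupoid (shift_cover z W)))))"

definition rotate_loop_arrow ::
  "real \<Rightarrow> circle_cover \<Rightarrow> ('o, 'a) loop_arrow \<Rightarrow> ('o, 'a) loop_arrow" where
  "rotate_loop_arrow z W = (\<lambda>(\<Psi>, \<Phi>, \<Lambda>).
     (rotate_loop z W \<Psi>, rotate_loop z W \<Phi>,
      restrict (\<lambda>(((b, c), x), l). \<Lambda> (((b - z, c - z), x - z), l))
        (topspace (Arr (circle_groupoid (shift_cover z W))))))"

definition rotation_obj :: "real \<Rightarrow> ('o, 'a) colim_loop \<Rightarrow> ('o, 'a) colim_loop" where
  "rotation_obj z c = (\<lambda>(W, \<Psi>). (shift_cover z W, rotate_loop z W \<Psi>)) ` c"

definition rotation_arr :: "real \<Rightarrow> ('o, 'a) colim_loop_arrow \<Rightarrow> ('o, 'a) colim_loop_arrow" where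
  "rotation_arr z c = (\<lambda>(W, \<Lambda>). (shift_cover z W, rotate_loop_arrow z W \<Lambda>)) ` c"

definition rotation_fixed_loop_groupoid ::
  "('o, 'a) groupoid \<Rightarrow> (('o, 'a) colim_loop, ('o, 'a) colim_loop_arrow) groupoid" where
  "rotation_fixed_loop_groupoid G =
     (loop_groupoid G)
       \<lparr>Obj := subtopology (Obj (loop_groupoid G)) {c. \<forall>z. rotation_obj z c = c},
        Arr := subtopology (Arr (loop_groupoid G)) {c. \<forall>z. rotation_arr z c = c}\<rparr>"

section \<open>The inertia groupoid\<close>

text \<open>An arrow \<open>\<alpha>\<close> from \<open>v\<close> to \<open>w\<close> is encoded as the pair \<open>(v, \<alpha>)\<close>; its target \<open>w\<close> is determined by
  \<open>v \<cdot> \<alpha> = \<alpha> \<cdot> w\<close>.\<close>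

definition inertia_groupoid :: "('o, 'a) groupoid \<Rightarrow> ('a, 'a \<times> 'a) groupoid" where
  "inertia_groupoid G =
     \<lparr>Obj = subtopology (Arr G) {v. src G v = tgt G v},
      Arr = subtopology (fiber_product (Arr G) (tgt G) (Arr G) (src G)) {(v, \<alpha>). src G v = tgt G v},
      src = (\<lambda>(v, \<alpha>). v),
      tgt = (\<lambda>(v, \<alpha>). mult G (ginv G \<alpha>) (mult G v \<alpha>)),
      mult = (\<lambda>(v, \<alpha>) (w, \<beta>). (v, mult G \<alpha> \<beta>)),
      ginv = (\<lambda>(v, \<alpha>). (mult G (ginv G \<alpha>) (mult G v \<alpha>), ginv G \<alpha>)),
      ident = (\<lambda>v. (v, ident G (src G v)))\<rparr>"

end

theory Submission
  imports Defs
begin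

text \<open>A loop whose class is fixed under all rotations becomes constant on a refinement of its cover: it
  takes a single value \<open>u\<close> on objects, is the identity on overlaps, and translation by \<open>l\<close> acts as \<open>v\<^sup>l\<close> for an
  arrow \<open>v : u \<rightarrow> u\<close>.  Likewise a fixed arrow of loops is given by a single arrow \<open>\<alpha>\<close> with
  \<open>v \<cdot> \<alpha> = \<alpha> \<cdot> w\<close>.  Evaluating at the point \<open>0\<close> is continuous on the whole loop groupoid and inverts
  \<open>v \<mapsto> [v\<^sup>l]\<close>, so the fixed subgroupoid is even isomorphic to the inertia groupoid.  Isomorphic groupoids
  are Morita equivalent once the source map is open, which is where the groupoid being etale enters.\<close>

section \<open>Topological preliminaries\<close>


text \<open>Being fixed in the colimit is a weak hypothesis: for each rotation \<open>z\<close>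
  separately, the loop and its rotate agree on a refinement that depends on \<open>z\<close>, so no
  single cover serves all rotations. Two kinds of shift are enough. On the half-open intervals
  between neighbouring break points the values form one function on the real line, unchanged by
  every translation; the shift by \<open>x\<close> itself compares \<open>x\<close> with 0, so
  constancy takes no continuity or connectedness argument. Values on overlaps escape this. They are
  reached by one more shift, chosen so that no break point of the cover is one of the rotated cover:
  near a break point of the first, everything lies in one interval of the second. As this shift is
  chosen once, its refinement yields a uniform bound for \<epsilon>.

  The other obstacle is topological: the fixed part is a subspace of a quotient, where open sets
  have no direct description. A map defined on the whole colimit is continuous by the quotient
  property, which is why the inverse must extend beyond the fixed classes. In the opposite
  direction, a constant loop sees only the integer \<open>l\<close> of an arrow, and a compact set
  of arrows has finitely many \<open>l\<close>.\<close>

lemma topspace_fiber_product: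
  "topspace (fiber_product X f Y g) = {(x, y). x \<in> topspace X \<and> y \<in> topspace Y \<and> f x = g y}"
  by (auto simp: fiber_product_def)

lemma continuous_map_into_fiber_product:
  "continuous_map Z (fiber_product X f Y g) h \<longleftrightarrow>
     continuous_map Z X (fst \<circ> h) \<and> continuous_map Z Y (snd \<circ> h) \<and>
     (\<forall>z\<in>topspace Z. f (fst (h z)) = g (snd (h z)))"
  by (auto simp: fiber_product_def continuous_map_in_subtopology continuous_map_pairwise Pi_iff split_beta)

lemma continuous_map_fiber_product_fst: "continuous_map (fiber_product X f Y g) X fst"
  and continuous_map_fiber_product_snd: "continuous_map (fiber_product X f Y g) Y snd"
  by (simp_all add: fiber_product_def continuous_map_from_subtopology continuous_map_fst continuous_map_snd)

lemma topspace_quotient_topology: "topspace (quotient_topology X f) = f ` topspace X"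
proof -
  have "{x \<in> topspace X. f x \<in> f ` topspace X} = topspace X" by auto
  then have "openin (quotient_topology X f) (f ` topspace X)"
    by (simp add: openin_quotient_topology)
  moreover have "topspace (quotient_topology X f) \<subseteq> f ` topspace X"
    using openin_topspace[of "quotient_topology X f"] unfolding openin_quotient_topology by blast
  ultimately show ?thesis
    by (intro subset_antisym openin_subset)
qed

lemma quotient_map_quotient_topology: "quotient_map X (quotient_topology X f) f"
  by (simp add: quotient_map_def openin_quotient_topology topspace_quotient_topology)

lemma continuous_map_from_prod_discrete:
  assumes "\<And>l. continuous_map X Y (\<lambda>x. f (x, l))"
  shows "continuous_map (prod_topology X (discrete_topology UNIV)) Y f"
  unfolding continuous_map
proof (intro conjI allI impI)
  show "f ` topspace (prod_topology X (discrete_topology UNIV)) \<subseteq> topspace Y"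
    using assms by (auto simp: continuous_map)
  fix U assume U: "openin Y U"
  let ?V = "{p \<in> topspace (prod_topology X (discrete_topology UNIV)). f p \<in> U}"
  have "?V = (\<Union>l. {x \<in> topspace X. f (x, l) \<in> U} \<times> {l})" by auto
  moreover have "openin X {x \<in> topspace X. f (x, l) \<in> U}" for l
    using assms[of l] U by (simp add: continuous_map)
  ultimately show "openin (prod_topology X (discrete_topology UNIV)) ?V"
    by (auto simp: openin_prod_Times_iff intro!: openin_Union)
qed

lemma continuous_map_from_sum:
  assumes "\<And>i. i \<in> I \<Longrightarrow> continuous_map (X i) Y (\<lambda>x. f (i, x))"
  shows "continuous_map (sum_topology X I) Y f"
  unfolding continuous_map
proof (intro conjI allI impI)
  show "f ` topspace (sum_topology X I) \<subseteq> topspace Y"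
    using assms by (fastforce simp: continuous_map)
  fix U assume U: "openin Y U"
  have "{x. (i, x) \<in> {p \<in> topspace (sum_topology X I). f p \<in> U}} = {x \<in> topspace (X i). f (i, x) \<in> U}"
    if "i \<in> I" for i using that by auto
  then show "openin (sum_topology X I) {p \<in> topspace (sum_topology X I). f p \<in> U}"
    using assms U by (auto simp: openin_sum_topology continuous_map)
qed

lemma topspace_compact_open_topology: "topspace (compact_open_topology X Y) = continuous_maps X Y"
proof -
  have "continuous_maps X Y \<in> {{f \<in> continuous_maps X Y. f ` K \<subseteq> U} | K U. compactin X K \<and> openin Y U}"
    by (auto intro!: exI[of _ "{}"])
  then show ?thesis
    unfolding compact_open_topology_def topology_generated_by_topspace by blast
qed

lemma continuous_map_compact_open_eval:
  assumes "x \<in> topspace X"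
  shows "continuous_map (compact_open_topology X Y) Y (\<lambda>f. f x)"
  unfolding continuous_map topspace_compact_open_topology
proof (intro conjI allI impI)
  show "(\<lambda>f. f x) ` continuous_maps X Y \<subseteq> topspace Y"
    using assms by (auto simp: continuous_maps_def continuous_map)
  fix U assume "openin Y U"
  moreover have "compactin X {x}" using assms by simp
  ultimately have "openin (compact_open_topology X Y) {f \<in> continuous_maps X Y. f ` {x} \<subseteq> U}"
    unfolding compact_open_topology_def by (intro topology_generated_by_Basis) blast
  then show "openin (compact_open_topology X Y) {f \<in> continuous_maps X Y. f x \<in> U}" by simp
qed

text \<open>If \<open>f t x\<close> depends on \<open>x\<close> only through a label
  \<open>d x\<close>, and a compact \<open>K\<close> carries finitely many labels, then the preimage
  of a subbasic set is a finite intersection of preimages under the maps \<open>h k\<close>. For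
  constant loops the label of an arrow is its integer \<open>l\<close>.\<close>

lemma continuous_map_into_compact_open:
  assumes maps: "\<And>t. t \<in> topspace T \<Longrightarrow> f t \<in> continuous_maps X Y"
    and f: "\<And>t x. x \<in> topspace X \<Longrightarrow> f t x = h (d x) t"
    and h: "\<And>x. x \<in> topspace X \<Longrightarrow> continuous_map T Y (h (d x))"
    and fin: "\<And>K. compactin X K \<Longrightarrow> finite (d ` K)"
  shows "continuous_map T (compact_open_topology X Y) f"
  unfolding compact_open_topology_def
proof (rule continuous_on_generated_topo)
  fix V assume "V \<in> {{f \<in> continuous_maps X Y. f ` K \<subseteq> U} | K U. compactin X K \<and> openin Y U}"
  then obtain K U where V: "V = {f \<in> continuous_maps X Y. f ` K \<subseteq> U}"
    and K: "compactin X K" and U: "openin Y U" by blast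
  from K have KX: "K \<subseteq> topspace X" by (rule compactin_subset_topspace)
  have "f -` V \<inter> topspace T = topspace T \<inter> (\<Inter>k\<in>d ` K. {t \<in> topspace T. h k t \<in> U})"
    using maps f KX by (auto simp: V subset_iff image_subset_iff)
  moreover have "openin T \<dots>"
  proof (cases "K = {}")
    case False
    have "openin T (\<Inter>k\<in>d ` K. {t \<in> topspace T. h k t \<in> U})"
      using h KX U fin[OF K] False by (intro openin_INT2) (auto simp: continuous_map)
    then show ?thesis by blast
  qed simp
  ultimately show "openin T (f -` V \<inter> topspace T)" by simp
next
  have "continuous_maps X Y \<in> {{f \<in> continuous_maps X Y. f ` K \<subseteq> U} | K U. compactin X K \<and> openin Y U}"
    by (auto intro!: exI[of _ "{}"])
  with maps show "f ` topspace T \<subseteq> \<Union>{{f \<in> continuous_maps X Y. f ` K \<subseteq> U} | K U. compactin X K \<and> openin Y U}"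
    by blast
qed

section \<open>Topological groupoids\<close>

context topological_groupoid
begin

lemma src_in [simp, intro]: "a \<in> topspace (Arr G) \<Longrightarrow> src G a \<in> topspace (Obj G)"
  using continuous_src by (auto simp: continuous_map)

lemma tgt_in [simp, intro]: "a \<in> topspace (Arr G) \<Longrightarrow> tgt G a \<in> topspace (Obj G)"
  using continuous_tgt by (auto simp: continuous_map)

lemma ident_in [simp, intro]: "x \<in> topspace (Obj G) \<Longrightarrow> ident G x \<in> topspace (Arr G)"
  using continuous_ident by (auto simp: continuous_map)

lemma ginv_in [simp, intro]: "a \<in> topspace (Arr G) \<Longrightarrow> ginv G a \<in> topspace (Arr G)"
  using continuous_ginv by (auto simp: continuous_map)

lemma mult_in [simp, intro]:
  assumes "a \<in> topspace (Arr G)" "b \<in> topspace (Arr G)" "tgt G a = src G b"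
  shows "mult G a b \<in> topspace (Arr G)"
proof -
  have "(a, b) \<in> topspace (fiber_product (Arr G) (tgt G) (Arr G) (src G))"
    using assms by (simp add: topspace_fiber_product)
  then show ?thesis using continuous_mult by (fastforce simp: continuous_map)
qed

lemmas groupoid_simps = src_mult tgt_mult src_ident tgt_ident mult_ident_left mult_ident_right
  src_ginv tgt_ginv mult_ginv_left mult_ginv_right

lemma continuous_map_mult:
  assumes "continuous_map X (Arr G) f" "continuous_map X (Arr G) g"
    and "\<And>x. x \<in> topspace X \<Longrightarrow> tgt G (f x) = src G (g x)"
  shows "continuous_map X (Arr G) (\<lambda>x. mult G (f x) (g x))"
proof -
  have "continuous_map X (fiber_product (Arr G) (tgt G) (Arr G) (src G)) (\<lambda>x. (f x, g x))"
    using assms by (simp add: continuous_map_into_fiber_product o_def)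
  from continuous_map_compose[OF this continuous_mult] show ?thesis by (simp add: o_def)
qed

lemma continuous_map_src: "continuous_map X (Arr G) f \<Longrightarrow> continuous_map X (Obj G) (\<lambda>x. src G (f x))"
  and continuous_map_tgt: "continuous_map X (Arr G) f \<Longrightarrow> continuous_map X (Obj G) (\<lambda>x. tgt G (f x))"
  and continuous_map_ginv: "continuous_map X (Arr G) f \<Longrightarrow> continuous_map X (Arr G) (\<lambda>x. ginv G (f x))"
  and continuous_map_ident: "continuous_map X (Obj G) g \<Longrightarrow> continuous_map X (Arr G) (\<lambda>x. ident G (g x))"
  using continuous_map_compose[OF _ continuous_src] continuous_map_compose[OF _ continuous_tgt]
    continuous_map_compose[OF _ continuous_ginv] continuous_map_compose[OF _ continuous_ident]
  by (simp_all add: o_def)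

lemma mult_ginv_cancel_left:
  assumes "a \<in> topspace (Arr G)" "b \<in> topspace (Arr G)" "src G a = src G b"
  shows "mult G a (mult G (ginv G a) b) = b"
  using assms mult_assoc[of a "ginv G a" b] by (simp add: groupoid_simps)

lemma ginv_mult_cancel_left:
  assumes "a \<in> topspace (Arr G)" "b \<in> topspace (Arr G)" "tgt G a = src G b"
  shows "mult G (ginv G a) (mult G a b) = b"
  using assms mult_assoc[of "ginv G a" a b] by (simp add: groupoid_simps)

lemma mult_eq_imp_eq_ginv_mult:
  assumes "a \<in> topspace (Arr G)" "b \<in> topspace (Arr G)" "tgt G a = src G b" "mult G a b = c"
  shows "b = mult G (ginv G a) c"
  using assms ginv_mult_cancel_left by force

lemma ginv_unique:
  assumes "a \<in> topspace (Arr G)" "b \<in> topspace (Arr G)" "tgt G a = src G b"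
    "mult G a b = ident G (src G a)"
  shows "b = ginv G a"
  using mult_eq_imp_eq_ginv_mult[OF assms] assms mult_ident_right[of "ginv G a"]
  by (simp add: groupoid_simps)

lemma ginv_ginv: "a \<in> topspace (Arr G) \<Longrightarrow> ginv G (ginv G a) = a"
  using ginv_unique[of "ginv G a" a] by (simp add: groupoid_simps)

lemma ginv_ident: "x \<in> topspace (Obj G) \<Longrightarrow> ginv G (ident G x) = ident G x"
  using ginv_unique[of "ident G x" "ident G x"] mult_ident_left[of "ident G x"]
  by (simp add: groupoid_simps)

lemma ginv_mult:
  assumes "a \<in> topspace (Arr G)" "b \<in> topspace (Arr G)" "tgt G a = src G b"
  shows "ginv G (mult G a b) = mult G (ginv G b) (ginv G a)"
proof -
  have "mult G (mult G a b) (mult G (ginv G b) (ginv G a)) = ident G (src G a)"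
    using assms by (simp add: groupoid_simps mult_assoc mult_ginv_cancel_left)
  then show ?thesis
    using assms ginv_unique[of "mult G a b" "mult G (ginv G b) (ginv G a)"] by (simp add: groupoid_simps)
qed

end

section \<open>Isomorphic groupoids are Morita equivalent\<close>

definition groupoid_isomorphism ::
  "('o1, 'a1) groupoid \<Rightarrow> ('o2, 'a2) groupoid \<Rightarrow> ('o1 \<Rightarrow> 'o2) \<times> ('a1 \<Rightarrow> 'a2) \<Rightarrow> bool" where
  "groupoid_isomorphism H G \<phi> \<longleftrightarrow> groupoid_morphism H G \<phi> \<and>
     homeomorphic_map (Obj H) (Obj G) (fst \<phi>) \<and> homeomorphic_map (Arr H) (Arr G) (snd \<phi>)"

lemma groupoid_morphism_compose:
  assumes "groupoid_morphism H G \<phi>" "groupoid_morphism G L \<psi>"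
  shows "groupoid_morphism H L (fst \<psi> \<circ> fst \<phi>, snd \<psi> \<circ> snd \<phi>)"
proof -
  have "snd \<phi> a \<in> topspace (Arr G)" if "a \<in> topspace (Arr H)" for a
    using assms(1) that by (auto simp: groupoid_morphism_def continuous_map split: prod.splits)
  moreover have "fst \<phi> x \<in> topspace (Obj G)" if "x \<in> topspace (Obj H)" for x
    using assms(1) that by (auto simp: groupoid_morphism_def continuous_map split: prod.splits)
  ultimately show ?thesis
    using assms by (auto simp: groupoid_morphism_def continuous_map_compose split: prod.splits)
qed

text \<open>Reads the structure of \<open>G\<close> as that of \<open>H\<close> conjugated by the
  homeomorphisms. The product rule has its premise in \<open>H\<close>: carrying composability over
  from \<open>G\<close> takes injectivity of \<open>f0\<close> at sources and targets, which are
  known to be objects only once \<open>H\<close> is a groupoid.\<close>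

lemma groupoid_isomorphismE:
  assumes "groupoid_isomorphism H G (f0, f1)"
  obtains (inverse) g0 g1 where
    "continuous_map (Obj H) (Obj G) f0" "continuous_map (Obj G) (Obj H) g0"
    "\<And>x. x \<in> topspace (Obj H) \<Longrightarrow> f0 x \<in> topspace (Obj G) \<and> g0 (f0 x) = x"
    "\<And>y. y \<in> topspace (Obj G) \<Longrightarrow> g0 y \<in> topspace (Obj H) \<and> f0 (g0 y) = y"
    "continuous_map (Arr H) (Arr G) f1" "continuous_map (Arr G) (Arr H) g1"
    "\<And>a. a \<in> topspace (Arr H) \<Longrightarrow> f1 a \<in> topspace (Arr G) \<and> g1 (f1 a) = a"
    "\<And>b. b \<in> topspace (Arr G) \<Longrightarrow> g1 b \<in> topspace (Arr H) \<and> f1 (g1 b) = b"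
    "\<And>b. b \<in> topspace (Arr G) \<Longrightarrow>
      src G b = f0 (src H (g1 b)) \<and> tgt G b = f0 (tgt H (g1 b)) \<and> ginv G b = f1 (ginv H (g1 b))"
    "\<And>a b. a \<in> topspace (Arr G) \<Longrightarrow> b \<in> topspace (Arr G) \<Longrightarrow> tgt H (g1 a) = src H (g1 b) \<Longrightarrow>
      mult G a b = f1 (mult H (g1 a) (g1 b))"
    "\<And>y. y \<in> topspace (Obj G) \<Longrightarrow> ident G y = f1 (ident H (g0 y))"
proof -
  note m = assms[unfolded groupoid_isomorphism_def groupoid_morphism_def]
  obtain g0 where g0: "homeomorphic_maps (Obj H) (Obj G) f0 g0"
    using m by (auto simp: homeomorphic_map_maps)
  obtain g1 where g1: "homeomorphic_maps (Arr H) (Arr G) f1 g1"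
    using m by (auto simp: homeomorphic_map_maps)
  have 0: "g0 y \<in> topspace (Obj H)" "f0 (g0 y) = y" if "y \<in> topspace (Obj G)" for y
    using g0 that by (auto simp: homeomorphic_maps_def continuous_map)
  have 1: "g1 b \<in> topspace (Arr H)" "f1 (g1 b) = b" if "b \<in> topspace (Arr G)" for b
    using g1 that by (auto simp: homeomorphic_maps_def continuous_map)
  show thesis
  proof (rule inverse[of g0 g1])
    fix a b assume ab: "a \<in> topspace (Arr G)" "b \<in> topspace (Arr G)" "tgt H (g1 a) = src H (g1 b)"
    then show "mult G a b = f1 (mult H (g1 a) (g1 b))"
      using m 1[OF ab(1)] 1[OF ab(2)] by auto
  next
    fix b assume "b \<in> topspace (Arr G)"
    then show "src G b = f0 (src H (g1 b)) \<and> tgt G b = f0 (tgt H (g1 b)) \<and> ginv G b = f1 (ginv H (g1 b))"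
      using m 1[of b] by auto
  next
    fix y assume "y \<in> topspace (Obj G)"
    then show "ident G y = f1 (ident H (g0 y))" using m 0[of y] by auto
  qed (use g0 g1 in \<open>auto simp: homeomorphic_maps_def continuous_map\<close>)
qed

text \<open>Transport of structure: \<open>L\<close> is a mere record whose operations are conjugate
  to those of \<open>G\<close>. In this way the fixed loop groupoid, whose operations are definite
  descriptions on classes, and the middle groupoid of the span inherit all axioms.\<close>

lemma (in topological_groupoid) topological_groupoid_isomorphic:
  assumes iso: "groupoid_isomorphism G L (f0, f1)"
  shows "topological_groupoid L"
  using iso
proof (cases rule: groupoid_isomorphismE)
  case (inverse g0 g1)
  note cf0 = inverse(1) and cg0 = inverse(2) and f0 = inverse(3) and g0 = inverse(4)
    and cf1 = inverse(5) and cg1 = inverse(6) and f1 = inverse(7) and g1 = inverse(8)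
    and st = inverse(9) and mult' = inverse(10) and ident = inverse(11)
  note src = st[THEN conjunct1] and tgt = st[THEN conjunct2, THEN conjunct1]
    and ginv = st[THEN conjunct2, THEN conjunct2]
  note f0' = f0[THEN conjunct1] and g0f = f0[THEN conjunct2] and f1' = f1[THEN conjunct1] and g1f = f1[THEN conjunct2]
    and g0' = g0[THEN conjunct1] g0[THEN conjunct2] and g1' = g1[THEN conjunct1] g1[THEN conjunct2]
  \<comment> \<open>\<open>f0\<close> is injective on objects, so composability is reflected from
    \<open>L\<close> to \<open>G\<close>.\<close>
  have comp: "tgt G (g1 a) = src G (g1 b)"
    if "a \<in> topspace (Arr L)" "b \<in> topspace (Arr L)" "tgt L a = src L b" for a b
    using that tgt[OF that(1)] src[OF that(2)] g1'(1) g0f by (metis src_in tgt_in)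
  have mult: "mult L a b = f1 (mult G (g1 a) (g1 b))"
    if "a \<in> topspace (Arr L)" "b \<in> topspace (Arr L)" "tgt L a = src L b" for a b
    by (rule mult'[OF that(1,2) comp[OF that]])
  show ?thesis
  proof
    show "continuous_map (Arr L) (Obj L) (src L)"
      by (rule continuous_map_eq[OF continuous_map_compose[OF continuous_map_src[OF cg1] cf0]]) (simp add: src)
    show "continuous_map (Arr L) (Obj L) (tgt L)"
      by (rule continuous_map_eq[OF continuous_map_compose[OF continuous_map_tgt[OF cg1] cf0]]) (simp add: tgt)
    show "continuous_map (Obj L) (Arr L) (ident L)"
      by (rule continuous_map_eq[OF continuous_map_compose[OF continuous_map_ident[OF cg0] cf1]]) (simp add: ident)
    show "continuous_map (Arr L) (Arr L) (ginv L)"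
      by (rule continuous_map_eq[OF continuous_map_compose[OF continuous_map_ginv[OF cg1] cf1]]) (simp add: ginv)
    let ?P = "fiber_product (Arr L) (tgt L) (Arr L) (src L)"
    have "continuous_map ?P (Arr G) (\<lambda>p. mult G (g1 (fst p)) (g1 (snd p)))"
      using continuous_map_compose[OF continuous_map_fiber_product_fst cg1]
        continuous_map_compose[OF continuous_map_fiber_product_snd cg1]
      by (intro continuous_map_mult) (auto simp: o_def topspace_fiber_product comp)
    from continuous_map_compose[OF this cf1]
    show "continuous_map ?P (Arr L) (\<lambda>(a, b). mult L a b)"
      by (rule continuous_map_eq) (auto simp: topspace_fiber_product mult)
  next
    fix a b assume ab: "a \<in> topspace (Arr L)" "b \<in> topspace (Arr L)" "tgt L a = src L b"
    let ?c = "mult G (g1 a) (g1 b)"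
    have c: "?c \<in> topspace (Arr G)" "src G ?c = src G (g1 a)" "tgt G ?c = tgt G (g1 b)"
      using ab by (simp_all add: comp g1' groupoid_simps)
    then have c': "mult L a b \<in> topspace (Arr L)" "g1 (mult L a b) = ?c"
      using mult[OF ab] by (simp_all add: f1' g1f)
    then show "src L (mult L a b) = src L a" and t: "tgt L (mult L a b) = tgt L b"
      using src tgt c ab by simp_all
    fix d assume d: "d \<in> topspace (Arr L)" "tgt L b = src L d"
    have "tgt G (g1 b) = src G (g1 d)" using ab d by (simp add: comp)
    then have bd: "mult L b d \<in> topspace (Arr L)" "g1 (mult L b d) = mult G (g1 b) (g1 d)"
      using mult[OF ab(2) d] g1' ab d by (simp_all add: f1' g1f)
    have "mult L (mult L a b) d = f1 (mult G ?c (g1 d))"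
      using mult[OF c'(1) d(1)] t d(2) c'(2) by simp
    also have "\<dots> = f1 (mult G (g1 a) (mult G (g1 b) (g1 d)))"
      using mult_assoc[of "g1 a" "g1 b" "g1 d"] ab d g1' comp by simp
    also have "src L (mult L b d) = src L b"
      using src[OF bd(1)] src[OF ab(2)] bd(2) src_mult[of "g1 b" "g1 d"] g1' ab d comp by simp
    then have "f1 (mult G (g1 a) (mult G (g1 b) (g1 d))) = mult L a (mult L b d)"
      using mult[OF ab(1) bd(1)] ab(3) bd(2) by simp
    finally show "mult L (mult L a b) d = mult L a (mult L b d)" .
  next
    fix y assume y: "y \<in> topspace (Obj L)"
    have e: "ident L y \<in> topspace (Arr L)" "g1 (ident L y) = ident G (g0 y)"
      using ident[OF y] g0'[OF y] by (simp_all add: f1' g1f)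
    then show "src L (ident L y) = y" "tgt L (ident L y) = y"
      using src[OF e(1)] tgt[OF e(1)] g0'[OF y] by (simp_all add: groupoid_simps)
  next
    fix a assume a: "a \<in> topspace (Arr L)"
    note g = g1'[OF a]
    have s: "src L a \<in> topspace (Obj L)" "g0 (src L a) = src G (g1 a)"
      and t: "tgt L a \<in> topspace (Obj L)" "g0 (tgt L a) = tgt G (g1 a)"
      using src[OF a] tgt[OF a] g by (simp_all add: f0' g0f)
    have i: "ginv L a \<in> topspace (Arr L)" "g1 (ginv L a) = ginv G (g1 a)"
      using ginv[OF a] g by (simp_all add: f1' g1f)
    show si: "src L (ginv L a) = tgt L a" and ti: "tgt L (ginv L a) = src L a"
      using src[OF i(1)] tgt[OF i(1)] src[OF a] tgt[OF a] i(2) g by (simp_all add: groupoid_simps)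
    show "mult L a (ginv L a) = ident L (src L a)" "mult L (ginv L a) a = ident L (tgt L a)"
      using mult[OF a i(1)] mult[OF i(1) a] si ti i(2) g s t
      by (simp_all add: ident groupoid_simps)
    have es: "ident L (src L a) \<in> topspace (Arr L)" "g1 (ident L (src L a)) = ident G (src G (g1 a))"
      and et: "ident L (tgt L a) \<in> topspace (Arr L)" "g1 (ident L (tgt L a)) = ident G (tgt G (g1 a))"
      using ident[OF s(1)] ident[OF t(1)] s(2) t(2) g by (simp_all add: f1' g1f)
    have "tgt L (ident L (src L a)) = src L a" "src L (ident L (tgt L a)) = tgt L a"
      using tgt[OF es(1)] src[OF et(1)] es(2) et(2) src[OF a] tgt[OF a] g by (simp_all add: groupoid_simps)
    then show "mult L (ident L (src L a)) a = a" "mult L a (ident L (tgt L a)) = a"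
      using mult[OF es(1) a] mult[OF a et(1)] es(2) et(2) g by (simp_all add: groupoid_simps)
  qed
qed

text \<open>Since \<open>f0\<close> is injective, an element of the pullback is determined by its
  arrow in \<open>L\<close>, and \<open>g1 \<circ> snd\<close> inverts the comparison map. The space
  in the second condition is likewise a copy of \<open>Arr L\<close>, on which the map becomes
  \<open>src L\<close>: surjective because of identities, open by \<open>op\<close>.\<close>

lemma (in topological_groupoid) morita_morphism_isomorphism:
  assumes iso: "groupoid_isomorphism G L (f0, f1)" and op: "open_map (Arr L) (Obj L) (src L)"
  shows "morita_morphism G L (f0, f1)"
  using iso
proof (cases rule: groupoid_isomorphismE)
  case (inverse g0 g1)
  note cg0 = inverse(2) and f0 = inverse(3) and cf1 = inverse(5) and cg1 = inverse(6) and f1 = inverse(7)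
    and g0 = inverse(4) and g1 = inverse(8) and st = inverse(9)
  interpret L: topological_groupoid L by (rule topological_groupoid_isomorphic[OF iso])
  have comm: "(f0 (src G a), f0 (tgt G a)) = (src L (f1 a), tgt L (f1 a))" if "a \<in> topspace (Arr G)" for a
    using st[of "f1 a"] f1[OF that] by simp
  have "cartesian_square (Arr G) (\<lambda>a. (src G a, tgt G a)) f1 (prod_topology (Obj G) (Obj G))
      (\<lambda>(x, y). (f0 x, f0 y)) (Arr L) (\<lambda>g. (src L g, tgt L g))"
    unfolding cartesian_square_def
  proof (intro conjI ballI)
    let ?P = "fiber_product (prod_topology (Obj G) (Obj G)) (\<lambda>(x, y). (f0 x, f0 y)) (Arr L)
        (\<lambda>g. (src L g, tgt L g))"
    have "homeomorphic_maps (Arr G) ?P (\<lambda>u. ((src G u, tgt G u), f1 u)) (g1 \<circ> snd)"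
      unfolding homeomorphic_maps_def
    proof (intro conjI ballI)
      show "continuous_map (Arr G) ?P (\<lambda>u. ((src G u, tgt G u), f1 u))"
        using cf1 comm
        by (simp add: continuous_map_into_fiber_product o_def continuous_map_paired continuous_src continuous_tgt)
      show "continuous_map ?P (Arr G) (g1 \<circ> snd)"
        by (rule continuous_map_compose[OF continuous_map_fiber_product_snd cg1])
    next
      fix p assume "p \<in> topspace ?P"
      then obtain x y b where p: "p = ((x, y), b)" "x \<in> topspace (Obj G)" "y \<in> topspace (Obj G)"
        "b \<in> topspace (Arr L)" "f0 x = src L b" "f0 y = tgt L b"
        by (auto simp: topspace_fiber_product)
      with st[of b] have "g0 (f0 (src G (g1 b))) = g0 (f0 x)" "g0 (f0 (tgt G (g1 b))) = g0 (f0 y)" by simp_all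
      then have "src G (g1 b) = x" "tgt G (g1 b) = y"
        using p(2,3) g1[OF p(4)] by (simp_all add: f0)
      with p show "((src G ((g1 \<circ> snd) p), tgt G ((g1 \<circ> snd) p)), f1 ((g1 \<circ> snd) p)) = p"
        by (simp add: g1)
    qed (simp add: f1)
    then show "homeomorphic_map (Arr G) ?P (\<lambda>u. ((src G u, tgt G u), f1 u))"
      by (auto simp: homeomorphic_map_maps)
  qed (simp add: comm)
  moreover
  let ?Q = "fiber_product (Obj G) f0 (Arr L) (tgt L)"
  have "homeomorphic_maps ?Q (Arr L) snd (\<lambda>b. (g0 (tgt L b), b))"
    unfolding homeomorphic_maps_def
  proof (intro conjI ballI)
    have "continuous_map (Arr L) (Obj G) (\<lambda>b. g0 (tgt L b))"
      using continuous_map_compose[OF L.continuous_tgt cg0] by (simp only: o_def)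
    then show "continuous_map (Arr L) ?Q (\<lambda>b. (g0 (tgt L b), b))"
      by (simp add: continuous_map_into_fiber_product o_def g0)
  next
    fix p assume "p \<in> topspace ?Q"
    then have "fst p \<in> topspace (Obj G)" "tgt L (snd p) = f0 (fst p)"
      by (auto simp: topspace_fiber_product)
    then show "(g0 (tgt L (snd p)), snd p) = p" by (simp add: f0)
  qed (simp_all add: continuous_map_fiber_product_snd)
  then have snd: "homeomorphic_map ?Q (Arr L) snd" by (auto simp: homeomorphic_map_maps)
  have "open_map ?Q (Obj L) (src L \<circ> snd)"
    using open_map_compose[OF homeomorphic_imp_open_map[OF snd] op] .
  then have "open_map ?Q (Obj L) (\<lambda>(x, g). src L g)"
    by (simp only: o_def case_prod_unfold)
  moreover have "(\<lambda>(x, g). src L g) ` topspace ?Q = src L ` topspace (Arr L)"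
    using homeomorphic_imp_surjective_map[OF snd] by (force simp: image_iff split_beta)
  moreover have "src L ` topspace (Arr L) = topspace (Obj L)"
    using L.src_ident L.ident_in L.src_in by (auto intro: rev_image_eqI)
  ultimately show ?thesis
    using iso by (simp add: morita_morphism_def groupoid_isomorphism_def Let_def)
qed

text \<open>An injective quotient map is a homeomorphism. This moves a space to another type by
  giving the image the quotient topology.\<close>

lemma homeomorphic_maps_quotient_topology:
  assumes "\<And>x. x \<in> topspace X \<Longrightarrow> g (f x) = x"
  shows "homeomorphic_maps X (quotient_topology X f) f g"
proof -
  have f: "homeomorphic_map X (quotient_topology X f) f"
    using inj_on_inverseI[of "topspace X" g f] assms
    by (simp add: homeomorphic_map_def quotient_map_quotient_topology)
  then obtain h where h: "homeomorphic_maps X (quotient_topology X f) f h"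
    by (auto simp: homeomorphic_map_maps)
  then show ?thesis
    by (rule homeomorphic_maps_eq)
      (use assms h in \<open>auto simp: topspace_quotient_topology homeomorphic_maps_def\<close>)
qed

text \<open>The middle groupoid of the span is a copy of \<open>G\<close>, moved to the prescribed type along the
  injections \<open>x \<mapsto> (f\<^sub>0 x, e x)\<close> and \<open>a \<mapsto> (f\<^sub>1 a, (f\<^sub>0 (s a), e (s a)), a)\<close>.\<close>

lemma (in topological_groupoid) morita_equivalent_isomorphic:
  fixes L :: "('p, 'b) groupoid"
  assumes iso: "groupoid_isomorphism G L (f0, f1)" and op: "open_map (Arr G) (Obj G) (src G)"
  shows "morita_equivalent L G"
proof -
  interpret L: topological_groupoid L by (rule topological_groupoid_isomorphic[OF iso])
  define k0 where "k0 x = (f0 x, ident G x)" for x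
  define k1 where "k1 a = (f1 a, k0 (src G a), a)" for a
  define r0 where "r0 p = src G (snd p)" for p :: "'p \<times> 'a"
  define r1 where "r1 q = snd (snd q)" for q :: "'b \<times> ('p \<times> 'a) \<times> 'a"
  \<comment> \<open>Each operation decodes its arguments with \<open>r0\<close> or
    \<open>r1\<close>, computes in \<open>G\<close> and encodes the result, so \<open>k0\<close> and
    \<open>k1\<close> are morphisms by construction.\<close>
  define K where "K = \<lparr>Obj = quotient_topology (Obj G) k0, Arr = quotient_topology (Arr G) k1,
     src = k0 \<circ> src G \<circ> r1, tgt = k0 \<circ> tgt G \<circ> r1,
     mult = (\<lambda>p q. k1 (mult G (r1 p) (r1 q))), ginv = k1 \<circ> ginv G \<circ> r1,
     ident = k1 \<circ> ident G \<circ> r0\<rparr>"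
  have r0k0: "r0 (k0 x) = x" if "x \<in> topspace (Obj G)" for x
    using that by (simp add: r0_def k0_def src_ident)
  have r1k1: "r1 (k1 a) = a" for a by (simp add: r1_def k1_def)
  have h0: "homeomorphic_maps (Obj G) (Obj K) k0 r0"
    using homeomorphic_maps_quotient_topology[of "Obj G" r0 k0] r0k0 by (simp add: K_def)
  have h1: "homeomorphic_maps (Arr G) (Arr K) k1 r1"
    using homeomorphic_maps_quotient_topology[of "Arr G" r1 k1] r1k1 by (simp add: K_def)
  have isoK: "groupoid_isomorphism G K (k0, k1)"
    unfolding groupoid_isomorphism_def groupoid_morphism_def
    using h0 h1 by (auto simp: homeomorphic_maps_map homeomorphic_imp_continuous_map)
      (auto simp: K_def r0k0 r1k1)
  interpret K: topological_groupoid K by (rule topological_groupoid_isomorphic[OF isoK])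
  have top: "topspace (Obj K) = k0 ` topspace (Obj G)" "topspace (Arr K) = k1 ` topspace (Arr G)"
    by (simp_all add: K_def topspace_quotient_topology)
  have "groupoid_morphism K G (r0, r1)"
    unfolding groupoid_morphism_def
    using h0 h1 by (auto simp: homeomorphic_maps_def top) (auto simp: K_def r0k0 r1k1 dest: arg_cong[of _ _ r0])
  then have isoG: "groupoid_isomorphism K G (r0, r1)"
    using h0 h1 by (simp add: groupoid_isomorphism_def homeomorphic_maps_map)
  then have isoL: "groupoid_isomorphism K L (f0 \<circ> r0, f1 \<circ> r1)"
    using iso groupoid_morphism_compose[of K G "(r0, r1)" L "(f0, f1)"]
    by (auto simp: groupoid_isomorphism_def homeomorphic_map_compose)
  have f0_hom: "homeomorphic_map (Obj G) (Obj L) f0" and f1_hom: "homeomorphic_map (Arr G) (Arr L) f1"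
    and src: "\<And>a. a \<in> topspace (Arr G) \<Longrightarrow> src L (f1 a) = f0 (src G a)"
    using iso by (simp_all add: groupoid_isomorphism_def groupoid_morphism_def)
  \<comment> \<open>On arrows of \<open>G\<close>, \<open>src L \<circ> f1\<close> equals
    \<open>f0 \<circ> src G\<close>, a composite of open maps; the continuous surjection
    \<open>f1\<close> can be cancelled.\<close>
  have opL: "open_map (Arr L) (Obj L) (src L)"
  proof -
    have "open_map (Arr G) (Obj L) (f0 \<circ> src G)"
      using op homeomorphic_imp_open_map[OF f0_hom] by (rule open_map_compose)
    then have "open_map (Arr G) (Obj L) (src L \<circ> f1)"
      by (rule open_map_eq) (simp add: src)
    then show ?thesis
      by (rule open_map_from_composition_left[OF _ homeomorphic_imp_continuous_map[OF f1_hom]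
            homeomorphic_imp_surjective_map[OF f1_hom]])
  qed
  have "morita_morphism K L (f0 \<circ> r0, f1 \<circ> r1)" "morita_morphism K G (r0, r1)"
    using K.morita_morphism_isomorphism isoL isoG op opL by blast+
  with K.topological_groupoid_axioms
  have span: "topological_groupoid K \<and> morita_morphism K L (f0 \<circ> r0, f1 \<circ> r1) \<and> morita_morphism K G (r0, r1)"
    by (intro conjI)
  show ?thesis
    unfolding morita_equivalent_def
    by (intro conjI topological_groupoid_axioms L.topological_groupoid_axioms)
      (rule exI, rule exI, rule exI, rule span)
qed

section \<open>The inertia groupoid\<close>

lemma topspace_inertia_groupoid:
  "topspace (Obj (inertia_groupoid G)) = {v \<in> topspace (Arr G). src G v = tgt G v}"
  "topspace (Arr (inertia_groupoid G)) =
     {(v, \<alpha>). v \<in> topspace (Arr G) \<and> \<alpha> \<in> topspace (Arr G) \<and> src G v = tgt G v \<and> tgt G v = src G \<alpha>}"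
  by (auto simp: inertia_groupoid_def topspace_fiber_product)

lemma inertia_groupoid_projections [simp]:
  "src (inertia_groupoid G) = fst"
  "tgt (inertia_groupoid G) = (\<lambda>p. mult G (ginv G (snd p)) (mult G (fst p) (snd p)))"
  "mult (inertia_groupoid G) = (\<lambda>p q. (fst p, mult G (snd p) (snd q)))"
  "ginv (inertia_groupoid G) = (\<lambda>p. (mult G (ginv G (snd p)) (mult G (fst p) (snd p)), ginv G (snd p)))"
  "ident (inertia_groupoid G) = (\<lambda>v. (v, ident G (src G v)))"
  by (auto simp: inertia_groupoid_def fun_eq_iff)

lemma continuous_map_into_inertia_obj:
  "continuous_map X (Obj (inertia_groupoid G)) f \<longleftrightarrow>
     continuous_map X (Arr G) f \<and> (\<forall>x\<in>topspace X. src G (f x) = tgt G (f x))"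
  by (simp add: inertia_groupoid_def continuous_map_in_subtopology Pi_iff)

lemma continuous_map_into_inertia_arr:
  "continuous_map X (Arr (inertia_groupoid G)) f \<longleftrightarrow>
     continuous_map X (Arr G) (\<lambda>x. fst (f x)) \<and> continuous_map X (Arr G) (\<lambda>x. snd (f x)) \<and>
     (\<forall>x\<in>topspace X. src G (fst (f x)) = tgt G (fst (f x)) \<and> tgt G (fst (f x)) = src G (snd (f x)))"
  by (simp add: inertia_groupoid_def continuous_map_in_subtopology Pi_iff
      continuous_map_into_fiber_product o_def split_beta) blast

lemma continuous_map_inertia_arr_fst: "continuous_map (Arr (inertia_groupoid G)) (Arr G) fst"
  and continuous_map_inertia_arr_snd: "continuous_map (Arr (inertia_groupoid G)) (Arr G) snd"
  by (simp_all add: inertia_groupoid_def continuous_map_from_subtopology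
      continuous_map_fiber_product_fst continuous_map_fiber_product_snd)

text \<open>This is the action groupoid of \<open>G\<close> acting on its loops by conjugation.
  Composition happens in the second component, and the work lies in the behaviour of the conjugate
  under products and inverses.\<close>

lemma (in topological_groupoid) topological_groupoid_inertia:
  "topological_groupoid (inertia_groupoid G)"
proof -
  let ?H = "inertia_groupoid G"
  have id0: "continuous_map (Obj ?H) (Arr G) (\<lambda>v. v)"
    by (simp add: inertia_groupoid_def continuous_map_from_subtopology)
  have fst: "continuous_map (Arr ?H) (Arr G) (\<lambda>p. fst p)"
    and snd: "continuous_map (Arr ?H) (Arr G) (\<lambda>p. snd p)"
    using continuous_map_inertia_arr_fst continuous_map_inertia_arr_snd by auto
  have arrD: "fst p \<in> topspace (Arr G)" "snd p \<in> topspace (Arr G)" "src G (fst p) = src G (snd p)"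
    "tgt G (fst p) = src G (snd p)" if "p \<in> topspace (Arr ?H)" for p
    using that by (auto simp: topspace_inertia_groupoid)
  have objD: "v \<in> topspace (Arr G)" "tgt G v = src G v" if "v \<in> topspace (Obj ?H)" for v
    using that by (auto simp: topspace_inertia_groupoid)
  have tgtH: "continuous_map (Arr ?H) (Arr G) (\<lambda>p. mult G (ginv G (snd p)) (mult G (fst p) (snd p)))"
    by (intro continuous_map_mult continuous_map_ginv fst snd) (simp_all add: arrD groupoid_simps)
  \<comment> \<open>Composability here is an equality of loops; comparing their base points shows
    that the second components compose in \<open>G\<close>.\<close>
  have comp: "src G (snd q) = tgt G (snd p)"
    if "p \<in> topspace (Arr ?H)" "q \<in> topspace (Arr ?H)" "tgt ?H p = src ?H q" for p q
  proof -
    have "src G (snd q) = src G (tgt ?H p)"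
      using arrD[OF that(2)] that(3) by simp
    then show ?thesis using arrD[OF that(1)] by (simp add: groupoid_simps)
  qed
  show ?thesis
  proof
    show "continuous_map (Arr ?H) (Obj ?H) (src ?H)"
      unfolding continuous_map_into_inertia_obj using fst by (simp add: arrD)
    show "continuous_map (Arr ?H) (Obj ?H) (tgt ?H)"
      unfolding continuous_map_into_inertia_obj using tgtH by (simp add: arrD groupoid_simps)
    show "continuous_map (Obj ?H) (Arr ?H) (ident ?H)"
      unfolding continuous_map_into_inertia_arr
      using id0 continuous_map_ident[OF continuous_map_src[OF id0]] by (simp add: objD groupoid_simps)
    show "continuous_map (Arr ?H) (Arr ?H) (ginv ?H)"
      unfolding continuous_map_into_inertia_arr
      using tgtH continuous_map_ginv[OF snd] by (simp add: arrD groupoid_simps)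
    let ?P = "fiber_product (Arr ?H) (tgt ?H) (Arr ?H) (src ?H)"
    have P: "continuous_map ?P (Arr ?H) (\<lambda>p. fst p)" "continuous_map ?P (Arr ?H) (\<lambda>p. snd p)"
      using continuous_map_fiber_product_fst continuous_map_fiber_product_snd by auto
    have PD: "fst p \<in> topspace (Arr ?H)" "snd p \<in> topspace (Arr ?H)"
      "src G (snd (snd p)) = tgt G (snd (fst p))" if "p \<in> topspace ?P" for p
      using that comp[of "fst p" "snd p"] by (auto simp: topspace_fiber_product)
    have "continuous_map ?P (Arr G) (\<lambda>p. mult G (snd (fst p)) (snd (snd p)))"
      using continuous_map_compose[OF P(1) snd] continuous_map_compose[OF P(2) snd]
      by (intro continuous_map_mult) (simp_all add: o_def PD)
    then show "continuous_map ?P (Arr ?H) (\<lambda>(a, b). mult ?H a b)"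
      unfolding continuous_map_into_inertia_arr
      using continuous_map_compose[OF P(1) fst] PD arrD
      by (simp add: o_def split_beta groupoid_simps)
  next
    fix a b assume ab: "a \<in> topspace (Arr ?H)" "b \<in> topspace (Arr ?H)" "tgt ?H a = src ?H b"
    note * = arrD[OF ab(1)] arrD[OF ab(2)] comp[OF ab]
    have "fst b = mult G (ginv G (snd a)) (mult G (fst a) (snd a))" using ab(3) by simp
    with * show "tgt ?H (mult ?H a b) = tgt ?H b"
      by (simp add: groupoid_simps mult_assoc ginv_mult)
    fix c assume c: "c \<in> topspace (Arr ?H)" "tgt ?H b = src ?H c"
    show "mult ?H (mult ?H a b) c = mult ?H a (mult ?H b c)"
      using * arrD[OF c(1)] comp[OF ab(2) c] by (simp add: mult_assoc)
  next
    fix a assume a: "a \<in> topspace (Arr ?H)"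
    note * = arrD[OF a]
    show "mult ?H a (ident ?H (tgt ?H a)) = a"
      using * mult_ident_right[of "snd a"] by (simp add: groupoid_simps prod_eq_iff)
    show "mult ?H (ident ?H (src ?H a)) a = a"
      using * mult_ident_left[of "snd a"] by (simp add: prod_eq_iff)
    show "tgt ?H (ginv ?H a) = src ?H a"
      using * mult_ident_right[of "fst a"]
      by (simp add: groupoid_simps ginv_ginv mult_assoc mult_ginv_cancel_left)
    show "mult ?H a (ginv ?H a) = ident ?H (src ?H a)"
      using * by (simp add: groupoid_simps)
    show "mult ?H (ginv ?H a) a = ident ?H (tgt ?H a)"
      using * by (simp add: groupoid_simps)
  next
    fix v assume v: "v \<in> topspace (Obj ?H)"
    show "tgt ?H (ident ?H v) = v"
      using objD[OF v] mult_ident_right[of v] mult_ident_left[of v] by (simp add: groupoid_simps ginv_ident)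
  qed (simp_all add: arrD objD groupoid_simps)
qed

text \<open>Open maps are stable under base change, and this source map is the base change of
  \<open>src G\<close> along the map that sends a loop to its base point.\<close>

lemma open_map_src_inertia_groupoid:
  assumes "topological_groupoid G" and op: "open_map (Arr G) (Obj G) (src G)"
  shows "open_map (Arr (inertia_groupoid G)) (Obj (inertia_groupoid G)) (src (inertia_groupoid G))"
proof -
  interpret topological_groupoid G by fact
  let ?H = "inertia_groupoid G"
  have arr: "Arr ?H = subtopology (prod_topology (Arr G) (Arr G)) {(v, \<alpha>). src G v = tgt G v \<and> tgt G v = src G \<alpha>}"
    by (simp add: inertia_groupoid_def fiber_product_def subtopology_subtopology)
       (rule arg_cong[where f = "subtopology _"], auto)
  have src: "src ?H = fst" by auto
  show ?thesis
    unfolding open_map_def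
  proof (intro allI impI)
    fix U assume "openin (Arr ?H) U"
    then obtain T where T: "openin (prod_topology (Arr G) (Arr G)) T"
      and U: "U = T \<inter> {(v, \<alpha>). src G v = tgt G v \<and> tgt G v = src G \<alpha>}"
      unfolding arr openin_subtopology by blast
    show "openin (Obj ?H) (src ?H ` U)"
    proof (subst openin_subopen, intro ballI)
      fix v assume "v \<in> src ?H ` U"
      then obtain \<alpha> where v\<alpha>: "(v, \<alpha>) \<in> T" "src G v = tgt G v" "tgt G v = src G \<alpha>"
        by (auto simp: U src)
      then obtain A B where AB: "openin (Arr G) A" "openin (Arr G) B" "v \<in> A" "\<alpha> \<in> B" "A \<times> B \<subseteq> T"
        using T[unfolded openin_prod_topology_alt, rule_format, OF v\<alpha>(1)] by blast
      let ?V = "{w \<in> topspace (Arr G). tgt G w \<in> src G ` B} \<inter> A"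
      have "openin (Arr G) ?V"
        using op AB continuous_tgt by (auto simp: open_map_def continuous_map)
      then have "openin (Obj ?H) (?V \<inter> {v. src G v = tgt G v})"
        by (auto simp: inertia_groupoid_def openin_subtopology)
      moreover have "v \<in> ?V \<inter> {v. src G v = tgt G v}"
        using AB v\<alpha> openin_subset by fastforce
      moreover have "?V \<inter> {v. src G v = tgt G v} \<subseteq> src ?H ` U"
        using AB by (force simp: U src image_iff)
      ultimately show "\<exists>S. openin (Obj ?H) S \<and> v \<in> S \<and> S \<subseteq> src ?H ` U" by blast
    qed
  qed
qed

lemma open_map_local_diffeomorphism:
  assumes "local_diffeomorphism X A Y B f"
  shows "open_map X Y f"
  unfolding open_map_def
proof (intro allI impI, subst openin_subopen, intro ballI)
  fix S y assume S: "openin X S" and "y \<in> f ` S"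
  then obtain x where x: "x \<in> S" "y = f x" by blast
  then have "x \<in> topspace X" using S openin_subset by blast
  then obtain U V where UV: "openin X U" "x \<in> U" "openin Y V"
    "diffeomorphism (subtopology X U) (restrict_atlas U A) (subtopology Y V) (restrict_atlas V B) f"
    using assms[unfolded local_diffeomorphism_def, rule_format, of x] by blast
  then have "homeomorphic_map (subtopology X U) (subtopology Y V) f"
    by (auto simp: diffeomorphism_def homeomorphic_map_maps)
  moreover have "openin (subtopology X U) (S \<inter> U)"
    using S by (auto simp: openin_subtopology)
  ultimately have "openin (subtopology Y V) (f ` (S \<inter> U))"
    using homeomorphic_imp_open_map open_map_def by blast
  then have "openin Y (f ` (S \<inter> U))"
    using UV(3) openin_trans_full by blast
  then show "\<exists>T. openin Y T \<and> y \<in> T \<and> T \<subseteq> f ` S"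
    using x UV(2) by blast
qed

section \<open>Covers of the circle\<close>

text \<open>The part of admissibility that does not mention \<epsilon>. Successors and canonical
  indices are governed by it alone, and it persists when \<epsilon> is changed or two point sets are
  united.\<close>

definition circle_points :: "circle_cover \<Rightarrow> bool" where
  "circle_points W \<longleftrightarrow> finite (fst W) \<and> fst W \<noteq> {} \<and> fst W \<subseteq> {0<..1}"

lemma base_points_add_int [simp]: "b + of_int k \<in> base_points W \<longleftrightarrow> b \<in> base_points W"
proof
  assume "b + of_int k \<in> base_points W"
  then obtain q j where "b + of_int k = q + of_int j" "q \<in> fst W" by (auto simp: base_points_def)
  then have "b = q + of_int (j - k)" by simp
  with \<open>q \<in> fst W\<close> show "b \<in> base_points W" unfolding base_points_def by blast
next
  assume "b \<in> base_points W"
  then obtain q j where "b = q + of_int j" "q \<in> fst W" by (auto simp: base_points_def)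
  then have "b + of_int k = q + of_int (j + k)" by simp
  with \<open>q \<in> fst W\<close> show "b + of_int k \<in> base_points W" unfolding base_points_def by blast
qed

lemma base_points_diff_int [simp]: "b - of_int k \<in> base_points W \<longleftrightarrow> b \<in> base_points W"
  using base_points_add_int[of b "- k" W] by simp

lemma fst_subset_base_points: "q \<in> fst W \<Longrightarrow> q \<in> base_points W"
  by (force simp: base_points_def intro: exI[of _ "0 :: int"])

lemma base_points_mono: "fst W \<subseteq> fst W' \<Longrightarrow> base_points W \<subseteq> base_points W'"
  by (auto simp: base_points_def)

lemma base_points_in_unit:
  assumes "fst W \<subseteq> {0<..1}" "b \<in> base_points W" "0 < b" "b \<le> 1"
  shows "b \<in> fst W"
proof -
  obtain q k where q: "b = q + of_int k" "q \<in> fst W" using assms(2) by (auto simp: base_points_def)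
  then have "0 < q" "q \<le> 1" using assms(1) by auto
  with q assms have "real_of_int k < 1" "real_of_int k > -1" by linarith+
  then have "k = 0" by linarith
  with q show ?thesis by simp
qed

lemma ex_int_translate_unit: "\<exists>k. 0 < (x::real) - of_int k \<and> x - of_int k \<le> 1"
  by (intro exI[of _ "\<lceil>x\<rceil> - 1"]) (simp, linarith)

lemma countable_base_points: "circle_points W \<Longrightarrow> countable (base_points W)"
proof -
  assume W: "circle_points W"
  have "base_points W = (\<lambda>(q, k). q + of_int k) ` (fst W \<times> UNIV)"
    by (auto simp: base_points_def)
  then show ?thesis using W by (simp add: circle_points_def countable_finite)
qed

text \<open>Local finiteness on the real line guarantees the minima and maxima of base points
  through which successors and canonical indices are computed.\<close>

lemma finite_base_points_Int:
  assumes "circle_points W"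
  shows "finite (base_points W \<inter> {a..b})"
proof (rule finite_subset)
  \<comment> \<open>As \<open>0 < q \<le> 1\<close>, a point \<open>q + k\<close> between
    \<open>a\<close> and \<open>b\<close> has \<open>a - 1 \<le> k < b\<close>.\<close>
  show "base_points W \<inter> {a..b} \<subseteq> (\<lambda>(q, k). q + of_int k) ` (fst W \<times> {\<lfloor>a\<rfloor> - 1..\<lceil>b\<rceil>})"
  proof
    fix x assume "x \<in> base_points W \<inter> {a..b}"
    then obtain q k where q: "x = q + of_int k" "q \<in> fst W" "a \<le> x" "x \<le> b"
      by (auto simp: base_points_def)
    then have "0 < q" "q \<le> 1" using assms by (auto simp: circle_points_def)
    with q have "of_int k < b" "a - 1 \<le> of_int k" by linarith+
    then have "\<lfloor>a\<rfloor> - 1 \<le> k" "k \<le> \<lceil>b\<rceil>" by linarith+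
    with q show "x \<in> (\<lambda>(q, k). q + of_int k) ` (fst W \<times> {\<lfloor>a\<rfloor> - 1..\<lceil>b\<rceil>})" by force
  qed
  show "finite ((\<lambda>(q, k). q + of_int k) ` (fst W \<times> {\<lfloor>a\<rfloor> - 1..\<lceil>b\<rceil>}))"
    using assms by (simp add: circle_points_def)
qed

lemma ex_base_point_between:
  assumes "circle_points W"
  shows "\<exists>c\<in>base_points W. x < c \<and> c \<le> x + 1"
proof -
  obtain q where q: "q \<in> fst W" using assms by (auto simp: circle_points_def)
  let ?k = "\<lfloor>x - q\<rfloor> + 1"
  have "q + of_int ?k \<in> base_points W" using fst_subset_base_points[OF q] base_points_add_int by blast
  moreover have "x < q + of_int ?k" "q + of_int ?k \<le> x + 1" by simp_all linarith+
  ultimately show ?thesis by blast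
qed

text \<open>\<open>LEAST\<close> over the reals says nothing until a minimum is known to exist. The
  window from \<open>x\<close> to some base point \<open>d\<close> at distance at most 1 is finite
  and contains \<open>d\<close>, and points beyond \<open>d\<close> cannot compete.\<close>

lemma
  assumes W: "circle_points W"
  shows next_point_in: "next_point W x \<in> base_points W"
    and next_point_gt: "x < next_point W x"
    and next_point_le: "c \<in> base_points W \<Longrightarrow> x < c \<Longrightarrow> next_point W x \<le> c"
proof -
  obtain d where d: "d \<in> base_points W" "x < d" "d \<le> x + 1" using ex_base_point_between[OF W] by blast
  let ?S = "{c \<in> base_points W \<inter> {x..d}. x < c}"
  have S: "finite ?S" "?S \<noteq> {}" 
    using d by (auto intro: finite_subset[OF _ finite_base_points_Int[OF W, of x d]])
  note M = Min_in[OF S] Min_le[OF S(1)]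
  have least: "Min ?S \<le> c" if "c \<in> base_points W" "x < c" for c
  proof (cases "c \<le> d")
    case True
    with that show ?thesis by (intro M(2)) auto
  next
    case False
    with M(1) show ?thesis by auto
  qed
  have "next_point W x = Min ?S"
    unfolding next_point_def by (rule Least_equality) (use M(1) least in auto)
  with M(1) least show "next_point W x \<in> base_points W" "x < next_point W x"
    "c \<in> base_points W \<Longrightarrow> x < c \<Longrightarrow> next_point W x \<le> c"
    by auto
qed

lemma next_point_eqI:
  assumes "circle_points W" "c \<in> base_points W" "x < c"
    and "\<And>d. d \<in> base_points W \<Longrightarrow> x < d \<Longrightarrow> c \<le> d"
  shows "next_point W x = c"
  using next_point_in[OF assms(1)] next_point_gt[OF assms(1)] next_point_le[OF assms(1-3)] assms(4)
  by (meson order_antisym)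

lemma canonical_index_eqI:
  assumes W: "circle_points W" and b: "b \<in> base_points W" "b \<le> x" "x < next_point W b"
  shows "canonical_index W x = b"
  unfolding canonical_index_def
proof (rule the_equality)
  fix c assume c: "c \<in> base_points W \<and> c \<le> x \<and> x < next_point W c"
  show "c = b"
  proof (rule ccontr)
    assume "c \<noteq> b"
    then consider "c < b" | "b < c" by linarith
    then show False
      using next_point_le[OF W, of b c] next_point_le[OF W, of c b] b c by cases auto
  qed
qed (use b in auto)

text \<open>\<open>canonical_index W\<close> is the floor function of the set of base points; it is
  computed as a maximum over the window of length 1 that ends at \<open>x\<close>.\<close>

lemma
  assumes W: "circle_points W"
  shows canonical_index_in: "canonical_index W x \<in> base_points W"
    and canonical_index_le: "canonical_index W x \<le> x"
    and canonical_index_next: "x < next_point W (canonical_index W x)"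
    and canonical_index_ge: "b \<in> base_points W \<Longrightarrow> b \<le> x \<Longrightarrow> b \<le> canonical_index W x"
proof -
  let ?S = "base_points W \<inter> {x - 1..x}"
  obtain d where "d \<in> base_points W" "x - 1 < d" "d \<le> x"
    using ex_base_point_between[OF W, of "x - 1"] by auto
  then have S: "finite ?S" "?S \<noteq> {}" using finite_base_points_Int[OF W] by auto
  note M = Max_in[OF S] Max_ge[OF S(1)]
  have "x < next_point W (Max ?S)"
  proof (rule ccontr)
    assume "\<not> x < next_point W (Max ?S)"
    moreover have "Max ?S < next_point W (Max ?S)" by (rule next_point_gt[OF W])
    ultimately have "next_point W (Max ?S) \<le> Max ?S"
      using M(1) next_point_in[OF W] by (intro M(2)) auto
    with next_point_gt[OF W, of "Max ?S"] show False by simp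
  qed
  moreover from this have "canonical_index W x = Max ?S"
    using M(1) by (intro canonical_index_eqI[OF W]) auto
  ultimately show 1: "canonical_index W x \<in> base_points W" "canonical_index W x \<le> x"
    "x < next_point W (canonical_index W x)"
    using M(1) by auto
  show "b \<le> canonical_index W x" if "b \<in> base_points W" "b \<le> x"
    using next_point_le[OF W, of b "canonical_index W x"] 1(3) that by linarith
qed

lemma canonical_index_base_point:
  "circle_points W \<Longrightarrow> b \<in> base_points W \<Longrightarrow> canonical_index W b = b"
  by (simp add: canonical_index_eqI next_point_gt)

lemma next_point_canonical_index:
  assumes "circle_points W"
  shows "next_point W (canonical_index W x) = next_point W x"
  by (rule sym, rule next_point_eqI)
    (use assms next_point_in canonical_index_next next_point_le canonical_index_le in
      \<open>auto intro: next_point_le order.strict_trans1[OF canonical_index_le]\<close>)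

text \<open>Stated for two covers whose base points differ by a translation, so that it covers both
  periodicity (\<open>W' = W\<close> with an integer shift) and rotation.\<close>

lemma next_point_translate:
  assumes "circle_points W" "circle_points W'"
    and "\<And>b. b \<in> base_points W' \<longleftrightarrow> b - z \<in> base_points W"
  shows "next_point W' x = next_point W (x - z) + z"
proof (rule next_point_eqI[OF assms(2)])
  show "next_point W (x - z) + z \<in> base_points W'"
    using assms next_point_in by simp
  show "x < next_point W (x - z) + z"
    using next_point_gt[OF assms(1), of "x - z"] by linarith
  show "next_point W (x - z) + z \<le> d" if "d \<in> base_points W'" "x < d" for d
    using next_point_le[OF assms(1), of "d - z" "x - z"] that assms(3) by auto
qed

lemma canonical_index_translate:
  assumes "circle_points W" "circle_points W'"
    and "\<And>b. b \<in> base_points W' \<longleftrightarrow> b - z \<in> base_points W"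
  shows "canonical_index W' x = canonical_index W (x - z) + z"
  by (rule canonical_index_eqI)
    (use assms canonical_index_in canonical_index_le[OF assms(1), of "x - z"]
      canonical_index_next[OF assms(1), of "x - z"] next_point_translate[OF assms] in auto)

lemma next_point_add_int: "circle_points W \<Longrightarrow> next_point W (x + of_int k) = next_point W x + of_int k"
  using next_point_translate[of W W "of_int k" "x + of_int k"] by simp

lemma mem_cover_interval: "x \<in> cover_interval W b \<longleftrightarrow> b - snd W < x \<and> x < next_point W b + snd W"
  by (auto simp: cover_interval_def)

lemma cover_interval_add_int [simp]:
  "circle_points W \<Longrightarrow> x + of_int k \<in> cover_interval W (b + of_int k) \<longleftrightarrow> x \<in> cover_interval W b"
  by (auto simp: mem_cover_interval next_point_add_int)

text \<open>Up to integer translation there are finitely many gaps, so the smallest over one period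
  is a uniform positive bound. The choices of \<epsilon> and \<delta> below are at most half of such
  a gap.\<close>

lemma base_points_gap:
  assumes W: "circle_points W"
  obtains g where "0 < g" "\<And>b c. b \<in> base_points W \<Longrightarrow> c \<in> base_points W \<Longrightarrow> b < c \<Longrightarrow> b + g \<le> c"
proof
  let ?S = "(\<lambda>q. next_point W q - q) ` fst W"
  have S: "finite ?S" "?S \<noteq> {}" using W by (auto simp: circle_points_def)
  show "0 < Min ?S" using S next_point_gt[OF W] by auto
  fix b c assume b: "b \<in> base_points W" and c: "c \<in> base_points W" "b < c"
  obtain q k where q: "q \<in> fst W" "b = q + of_int k" using b by (auto simp: base_points_def)
  have "Min ?S \<le> next_point W q - q" using S(1) q(1) by (intro Min_le) auto
  also have "\<dots> = next_point W b - b" by (simp add: q(2) next_point_add_int[OF W])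
  also have "\<dots> \<le> c - b" using next_point_le[OF W c] by simp
  finally show "b + Min ?S \<le> c" by simp
qed

section \<open>Admissible covers\<close>

lemma cis_2pi_eq_iff: "cis (2 * pi * x) = cis (2 * pi * y) \<longleftrightarrow> (\<exists>k. y = x + of_int k)"
proof -
  have "cis (2 * pi * x) = cis (2 * pi * y) \<longleftrightarrow> cis (2 * pi * (y - x)) = 1"
    by (auto simp: right_diff_distrib simp flip: cis_divide)
  also have "\<dots> \<longleftrightarrow> cos (2 * pi * (y - x)) = 1"
    by (auto simp: complex_eq_iff cos_one_sin_zero)
  also have "\<dots> \<longleftrightarrow> (\<exists>k::int. 2 * pi * (y - x) = of_int k * 2 * pi)"
    by (simp add: cos_one_2pi_int)
  also have "\<dots> \<longleftrightarrow> (\<exists>k. y = x + of_int k)"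
  proof -
    have "2 * pi * (y - x) = of_int k * 2 * pi \<longleftrightarrow> y - x = of_int k" for k
      using mult_cancel_left[of "2 * pi" "y - x" "of_int k"] by (simp add: mult_ac)
    then show ?thesis by (simp add: diff_eq_eq add.commute)
  qed
  finally show ?thesis .
qed

text \<open>Lifted to the real line, three members of a cover are distinct when their base points are
  pairwise incongruent modulo 1.\<close>

lemma admissible_covers_iff:
  "W \<in> admissible_covers \<longleftrightarrow> circle_points W \<and> 0 < snd W \<and>
     (\<forall>b\<in>base_points W. \<forall>c\<in>base_points W. \<forall>d\<in>base_points W.
        b - c \<notin> \<int> \<longrightarrow> c - d \<notin> \<int> \<longrightarrow> b - d \<notin> \<int> \<longrightarrow>
        cover_interval W b \<inter> cover_interval W c \<inter> cover_interval W d = {})"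
    (is "_ \<longleftrightarrow> _ \<and> _ \<and> ?triple")
proof (cases "circle_points W")
  case W: True
  \<comment> \<open>Points of the half-open unit interval that differ by an integer coincide, so
    distinct members of the cover have incongruent base points.\<close>
  have eq: "p = q" if "p \<in> fst W" "q \<in> fst W" "p - q \<in> \<int>" for p q
  proof -
    obtain k where k: "p - q = of_int k" using \<open>p - q \<in> \<int>\<close> by (auto elim: Ints_cases)
    have "0 < p" "p \<le> 1" "0 < q" "q \<le> 1" using W that by (auto simp: circle_points_def)
    with k have "real_of_int k < 1" "-1 < real_of_int k" by linarith+
    then have "k = 0" by linarith
    with k show ?thesis by simp
  qed
  have rep: "\<exists>q\<in>fst W. \<exists>k. b = q + of_int k" if "b \<in> base_points W" for b
    using that by (auto simp: base_points_def)
  have ints: "p + of_int i - (q + of_int j) \<in> \<int> \<longleftrightarrow> p - q \<in> \<int>" for p q :: real and i j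
  proof -
    have "p + of_int i - (q + of_int j) = (p - q) + of_int (i - j)" by simp
    then show ?thesis by (metis Ints_add Ints_diff Ints_of_int add_diff_cancel_right')
  qed
  have arc: "cis (2 * pi * x) \<in> cover_arc W q \<longleftrightarrow> (\<exists>k. x \<in> cover_interval W (q + of_int k))" for x q
  proof
    assume "cis (2 * pi * x) \<in> cover_arc W q"
    then obtain y where y: "y \<in> cover_interval W q" "cis (2 * pi * y) = cis (2 * pi * x)"
      by (auto simp: cover_arc_def)
    then obtain k where "x = y + of_int k" by (auto simp: cis_2pi_eq_iff)
    then have "x \<in> cover_interval W (q + of_int k)" using y W by simp
    then show "\<exists>k. x \<in> cover_interval W (q + of_int k)" by blast
  next
    assume "\<exists>k. x \<in> cover_interval W (q + of_int k)"
    then obtain k where "x - of_int k \<in> cover_interval W q"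
      using cover_interval_add_int[OF W, of "x - of_int k" k q for k] by auto
    moreover have "cis (2 * pi * x) = cis (2 * pi * (x - of_int k))"
      unfolding cis_2pi_eq_iff by (rule exI[of _ "- k"]) simp
    ultimately show "cis (2 * pi * x) \<in> cover_arc W q" by (auto simp: cover_arc_def)
  qed
  have arc_cis: "\<exists>x. u = cis (2 * pi * x)" if "u \<in> cover_arc W q" for u q
    using that by (auto simp: cover_arc_def)
  have "(\<forall>p\<in>fst W. \<forall>q\<in>fst W. \<forall>r\<in>fst W. p \<noteq> q \<and> q \<noteq> r \<and> p \<noteq> r \<longrightarrow>
      cover_arc W p \<inter> cover_arc W q \<inter> cover_arc W r = {}) \<longleftrightarrow> ?triple" (is "?arcs \<longleftrightarrow> _")
  proof
    assume A: ?arcs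
    show ?triple
    proof (intro ballI impI equals0I)
      fix b c d x assume b: "b \<in> base_points W" and c: "c \<in> base_points W" and d: "d \<in> base_points W"
        and n: "b - c \<notin> \<int>" "c - d \<notin> \<int>" "b - d \<notin> \<int>"
        and x: "x \<in> cover_interval W b \<inter> cover_interval W c \<inter> cover_interval W d"
      obtain p i where p: "p \<in> fst W" "b = p + of_int i" using rep[OF b] by blast
      obtain q j where q: "q \<in> fst W" "c = q + of_int j" using rep[OF c] by blast
      obtain r k where r: "r \<in> fst W" "d = r + of_int k" using rep[OF d] by blast
      have "p \<noteq> q" "q \<noteq> r" "p \<noteq> r" using n p q r by (auto simp: ints)
      moreover have "cis (2 * pi * x) \<in> cover_arc W p \<inter> cover_arc W q \<inter> cover_arc W r"
        using x p q r by (auto simp: arc)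
      ultimately show False using A p q r by blast
    qed
  next
    assume T: ?triple
    show ?arcs
    proof (intro ballI impI equals0I)
      fix p q r u assume pqr: "p \<in> fst W" "q \<in> fst W" "r \<in> fst W" "p \<noteq> q \<and> q \<noteq> r \<and> p \<noteq> r"
        and u: "u \<in> cover_arc W p \<inter> cover_arc W q \<inter> cover_arc W r"
      then obtain x where x: "u = cis (2 * pi * x)" using arc_cis by blast
      then obtain i j k where "x \<in> cover_interval W (p + of_int i)"
        "x \<in> cover_interval W (q + of_int j)" "x \<in> cover_interval W (r + of_int k)"
        using u by (auto simp: arc)
      moreover have "p + of_int i - (q + of_int j) \<notin> \<int>" "q + of_int j - (r + of_int k) \<notin> \<int>"
        "p + of_int i - (r + of_int k) \<notin> \<int>"
        using pqr eq by (auto simp: ints)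
      moreover have "p + of_int i \<in> base_points W" "q + of_int j \<in> base_points W" "r + of_int k \<in> base_points W"
        using pqr fst_subset_base_points by auto
      ultimately show False using T by blast
    qed
  qed
  with W show ?thesis by (simp add: admissible_covers_def circle_points_def)
qed (auto simp: admissible_covers_def circle_points_def)

lemma admissible_circle_points: "W \<in> admissible_covers \<Longrightarrow> circle_points W"
  and admissible_pos: "W \<in> admissible_covers \<Longrightarrow> 0 < snd W"
  by (simp_all add: admissible_covers_iff)

text \<open>Of three base points, the middle one separates the outer two: the left interval ends at
  most \<epsilon> beyond it, while the right one begins at least \<open>g\<close> minus \<epsilon>
  beyond it.\<close>

lemma admissible_covers_small:
  assumes W: "circle_points W" "0 < snd W"
    and g: "\<And>b c. b \<in> base_points W \<Longrightarrow> c \<in> base_points W \<Longrightarrow> b < c \<Longrightarrow> b + g \<le> c" "2 * snd W \<le> g"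
  shows "W \<in> admissible_covers"
  unfolding admissible_covers_iff
proof (intro conjI ballI impI equals0I)
  have sorted: False if "b \<in> base_points W" "c \<in> base_points W" "d \<in> base_points W" "b < c" "c < d"
    "x \<in> cover_interval W b" "x \<in> cover_interval W d" for b c d x
  proof -
    have "next_point W b \<le> c" using next_point_le[OF W(1)] that by auto
    moreover have "c + g \<le> d" using g that by auto
    ultimately show False using that g(2) by (auto simp: mem_cover_interval)
  qed
  fix b c d x assume *: "b \<in> base_points W" "c \<in> base_points W" "d \<in> base_points W"
    "b - c \<notin> \<int>" "c - d \<notin> \<int>" "b - d \<notin> \<int>"
    "x \<in> cover_interval W b \<inter> cover_interval W c \<inter> cover_interval W d"
  then have ne: "b \<noteq> c" "c \<noteq> d" "b \<noteq> d" by auto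
  then consider "b < c" "c < d" | "b < d" "d < c" | "c < b" "b < d" | "c < d" "d < b"
    | "d < b" "b < c" | "d < c" "c < b" by linarith
  then show False using sorted * by cases blast+
qed (use W in auto)

lemma admissible_refinement:
  assumes W: "circle_points W" and "0 < \<delta>"
  obtains \<epsilon> where "0 < \<epsilon>" "\<epsilon> \<le> \<delta>" "(fst W, \<epsilon>) \<in> admissible_covers"
proof -
  obtain g where g: "0 < g" "\<And>b c. b \<in> base_points W \<Longrightarrow> c \<in> base_points W \<Longrightarrow> b < c \<Longrightarrow> b + g \<le> c"
    using base_points_gap[OF W] by blast
  define \<epsilon> where "\<epsilon> = min \<delta> (g / 2)"
  have "(fst W, \<epsilon>) \<in> admissible_covers"
  proof (rule admissible_covers_small)
    show "circle_points (fst W, \<epsilon>)" using W by (simp add: circle_points_def)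
    show "b + g \<le> c" if "b \<in> base_points (fst W, \<epsilon>)" "c \<in> base_points (fst W, \<epsilon>)" "b < c" for b c
      using g that by (auto simp: base_points_def)
  qed (use g assms in \<open>auto simp: \<epsilon>_def\<close>)
  with that[of \<epsilon>] show thesis using g assms by (auto simp: \<epsilon>_def)
qed

lemma refines_trans: "refines W'' W' \<Longrightarrow> refines W' W \<Longrightarrow> refines W'' W"
  by (auto simp: refines_def)

text \<open>Uniting the point sets may create triple overlaps, so \<epsilon> is shrunk as well,
  below both given widths and below half the new gap.\<close>

lemma common_refinement:
  assumes "W \<in> admissible_covers" "W' \<in> admissible_covers"
  obtains W'' where "W'' \<in> admissible_covers" "refines W'' W" "refines W'' W'"
proof -
  have "circle_points (fst W \<union> fst W', min (snd W) (snd W'))"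
    using assms[THEN admissible_circle_points] by (auto simp: circle_points_def)
  then obtain \<epsilon> where "0 < \<epsilon>" "\<epsilon> \<le> min (snd W) (snd W')" "(fst W \<union> fst W', \<epsilon>) \<in> admissible_covers"
    using admissible_refinement[of _ "min (snd W) (snd W')"] assms[THEN admissible_pos]
    by (metis fst_conv min_less_iff_conj)
  then show thesis by (intro that[of "(fst W \<union> fst W', \<epsilon>)"]) (auto simp: refines_def)
qed

text \<open>For nested sets of base points the floor functions compose. This is what makes
  refinement functorial on circle groupoids.\<close>

lemma
  assumes W: "circle_points W" "circle_points W'" and ref: "refines W' W"
  shows canonical_index_canonical_index: "canonical_index W (canonical_index W' x) = canonical_index W x"
    and next_point_refines: "next_point W' x \<le> next_point W x"
proof -
  have sub: "base_points W \<subseteq> base_points W'"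
    using ref by (intro base_points_mono) (auto simp: refines_def)
  show "next_point W' x \<le> next_point W x"
    using sub next_point_le[OF W(2)] next_point_in[OF W(1)] next_point_gt[OF W(1)] by blast
  show "canonical_index W (canonical_index W' x) = canonical_index W x"
  proof (rule canonical_index_eqI[OF W(1)])
    show "canonical_index W x \<in> base_points W" by (rule canonical_index_in[OF W(1)])
    show "canonical_index W x \<le> canonical_index W' x"
      using canonical_index_ge[OF W(2)] sub canonical_index_in[OF W(1)] canonical_index_le[OF W(1)] by blast
    show "canonical_index W' x < next_point W (canonical_index W x)"
      using canonical_index_le[OF W(2), of x] canonical_index_next[OF W(1), of x] by linarith
  qed
qed

lemma cover_interval_refines:
  assumes W: "circle_points W" "circle_points W'" and ref: "refines W' W"
    and x: "x \<in> cover_interval W' p"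
  shows "x \<in> cover_interval W (canonical_index W p)"
  using x canonical_index_le[OF W(1), of p] next_point_canonical_index[OF W(1), of p]
    next_point_refines[OF W ref, of p] ref
  by (auto simp: mem_cover_interval refines_def)

section \<open>Shifted covers\<close>

text \<open>The reduction of the points modulo 1 disappears after periodic extension: on the real
  line a rotated cover is a plain translate.\<close>

lemma base_points_shift_cover:
  "b \<in> base_points (shift_cover z W) \<longleftrightarrow> b - z \<in> base_points W"
proof
  assume "b \<in> base_points (shift_cover z W)"
  then obtain q k where q: "b = q + of_int k" "q - z \<in> base_points W"
    unfolding base_points_def[of "shift_cover z W"] by (auto simp: shift_cover_def)
  then have "b - z = q - z + of_int k" by simp
  with q show "b - z \<in> base_points W" by (simp only: base_points_add_int)
next
  assume b: "b - z \<in> base_points W"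
  obtain k where k: "0 < b - of_int k" "b - of_int k \<le> 1" using ex_int_translate_unit by blast
  have "b - of_int k - z = b - z - of_int k" by simp
  then have "b - of_int k - z \<in> base_points W" using b by (simp only: base_points_diff_int)
  then have "b - of_int k \<in> base_points (shift_cover z W)"
    using k by (intro fst_subset_base_points) (auto simp: shift_cover_def)
  then show "b \<in> base_points (shift_cover z W)" by simp
qed

lemma snd_shift_cover [simp]: "snd (shift_cover z W) = snd W"
  by (simp add: shift_cover_def)

lemma circle_points_shift_cover:
  assumes W: "circle_points W"
  shows "circle_points (shift_cover z W)"
  unfolding circle_points_def
proof (intro conjI)
  show "fst (shift_cover z W) \<subseteq> {0<..1}" by (auto simp: shift_cover_def)
  have "fst (shift_cover z W) \<subseteq> (\<lambda>x. x + z) ` (base_points W \<inter> {- z..1 - z})"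
    by (force simp: shift_cover_def image_iff)
  then show "finite (fst (shift_cover z W))"
    using finite_base_points_Int[OF W] finite_surj by blast
  obtain c where "c \<in> base_points W" "- z < c" "c \<le> - z + 1" using ex_base_point_between[OF W] by blast
  then have "c + z \<in> fst (shift_cover z W)" by (auto simp: shift_cover_def)
  then show "fst (shift_cover z W) \<noteq> {}" by blast
qed

lemma
  assumes "circle_points W"
  shows next_point_shift_cover: "next_point (shift_cover z W) x = next_point W (x - z) + z"
    and canonical_index_shift_cover: "canonical_index (shift_cover z W) x = canonical_index W (x - z) + z"
  using next_point_translate[OF assms circle_points_shift_cover[OF assms] base_points_shift_cover]
    canonical_index_translate[OF assms circle_points_shift_cover[OF assms] base_points_shift_cover]
  by simp_all

lemma cover_interval_shift_cover:
  "circle_points W \<Longrightarrow> x \<in> cover_interval (shift_cover z W) b \<longleftrightarrow> x - z \<in> cover_interval W (b - z)"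
  by (auto simp: mem_cover_interval next_point_shift_cover)

lemma shift_cover_admissible:
  assumes "W \<in> admissible_covers"
  shows "shift_cover z W \<in> admissible_covers"
proof -
  note W = admissible_circle_points[OF assms]
  show ?thesis
    unfolding admissible_covers_iff
  proof (intro conjI ballI impI equals0I)
    fix b c d x assume *: "b \<in> base_points (shift_cover z W)" "c \<in> base_points (shift_cover z W)"
      "d \<in> base_points (shift_cover z W)" "b - c \<notin> \<int>" "c - d \<notin> \<int>" "b - d \<notin> \<int>"
      "x \<in> cover_interval (shift_cover z W) b \<inter> cover_interval (shift_cover z W) c \<inter> cover_interval (shift_cover z W) d"
    then have "x - z \<in> cover_interval W (b - z) \<inter> cover_interval W (c - z) \<inter> cover_interval W (d - z)"
      by (simp add: cover_interval_shift_cover[OF W])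
    moreover have "(b - z) - (c - z) \<notin> \<int>" "(c - z) - (d - z) \<notin> \<int>" "(b - z) - (d - z) \<notin> \<int>"
      using * by simp_all
    ultimately show False
      using assms *(1-3) unfolding admissible_covers_iff base_points_shift_cover by blast
  qed (use W admissible_pos[OF assms] circle_points_shift_cover in auto)
qed

text \<open>The covers are equal and not merely equivalent, because representatives in the half-open
  unit interval are unique and \<open>fst W\<close> is recovered from \<open>base_points W\<close>.
  Hence rotation by \<open>- z\<close> strictly undoes rotation by \<open>z\<close> on the stages of
  the colimit.\<close>

lemma shift_cover_shift_cover:
  assumes "circle_points W"
  shows "shift_cover (- z) (shift_cover z W) = W"
proof -
  have "x \<in> fst W \<longleftrightarrow> 0 < x \<and> x \<le> 1 \<and> x \<in> base_points W" for x
    using assms base_points_in_unit[of W x] fst_subset_base_points[of x W]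
    by (auto simp: circle_points_def)
  then have "{x \<in> {0<..1}. x \<in> base_points W} = fst W" by auto
  then show ?thesis
    by (simp add: shift_cover_def[of "- z"] base_points_shift_cover)
qed

lemma refines_shift_cover:
  assumes "refines W' W"
  shows "refines (shift_cover z W') (shift_cover z W)"
proof -
  have "base_points W \<subseteq> base_points W'" using assms by (intro base_points_mono) (simp add: refines_def)
  then show ?thesis using assms by (auto simp: refines_def shift_cover_def)
qed

section \<open>Rotation invariance forces constancy\<close>

text \<open>A shift is bad only if it is a difference of two base points, and there are countably
  many of these.\<close>

lemma ex_disjoint_shift:
  assumes W: "circle_points W"
  obtains z where "base_points W \<inter> base_points (shift_cover z W) = {}"
proof -
  let ?D = "(\<lambda>(b, c). b - c) ` (base_points W \<times> base_points W)"
  have "countable ?D" using countable_base_points[OF W] by simp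
  then have "?D \<noteq> UNIV" using uncountable_UNIV_real by metis
  then obtain z where z: "z \<notin> ?D" by blast
  have False if "b \<in> base_points W" "b - z \<in> base_points W" for b
  proof -
    have "b - (b - z) \<in> ?D" using that by (intro image_eqI[of _ _ "(b, b - z)"]) auto
    with z show False by simp
  qed
  then have "base_points W \<inter> base_points (shift_cover z W) = {}"
    by (auto simp: base_points_shift_cover)
  then show thesis by (rule that)
qed

text \<open>\<open>F b c x\<close> stands for the value of an equivariant family on the overlap of the intervals at
  \<open>b\<close> and \<open>c\<close>.  Away from the break points, invariance says that \<open>x \<mapsto> F b b x\<close> for \<open>b \<le> x < b'\<close> does
  not change under translation.  Near a break point \<open>q\<close>, shift by a \<open>z\<close> for which \<open>q\<close> is not a break
  point of the shifted cover: there both intervals are canonically contained in a single one.\<close>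

lemma rotation_invariant_imp_constant:
  assumes W: "circle_points W"
    and inv: "\<And>z. \<exists>W''. circle_points W'' \<and> 0 < snd W'' \<and> refines W'' W \<and> refines W'' (shift_cover z W) \<and>
      (\<forall>p\<in>base_points W''. \<forall>p'\<in>base_points W''. \<forall>x\<in>cover_interval W'' p \<inter> cover_interval W'' p'.
        F (canonical_index W p) (canonical_index W p') x =
        F (canonical_index (shift_cover z W) p - z) (canonical_index (shift_cover z W) p' - z) (x - z))"
  obtains u \<delta> where "0 < \<delta>"
    "\<And>b c x. b \<in> base_points W \<Longrightarrow> c \<in> base_points W \<Longrightarrow> b - \<delta> < x \<Longrightarrow> x < next_point W b + \<delta> \<Longrightarrow>
       c - \<delta> < x \<Longrightarrow> x < next_point W c + \<delta> \<Longrightarrow> F b c x = u"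
proof -
  \<comment> \<open>Each \<open>x\<close> lies in exactly one half-open interval between
    neighbouring break points; using that interval gives one function on the line, blind to
    overlaps.\<close>
  define f where "f x = F (canonical_index W x) (canonical_index W x) x" for x
  have f_shift: "f x = f (x - z)" for x z
  proof -
    obtain W'' where W'': "circle_points W''" "0 < snd W''" "refines W'' W" "refines W'' (shift_cover z W)"
      and eq: "\<forall>p\<in>base_points W''. \<forall>p'\<in>base_points W''. \<forall>x\<in>cover_interval W'' p \<inter> cover_interval W'' p'.
        F (canonical_index W p) (canonical_index W p') x =
        F (canonical_index (shift_cover z W) p - z) (canonical_index (shift_cover z W) p' - z) (x - z)"
      using inv[of z] by blast
    let ?p = "canonical_index W'' x"
    have p: "?p \<in> base_points W''" "x \<in> cover_interval W'' ?p"
      using canonical_index_in[OF W''(1)] canonical_index_le[OF W''(1), of x]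
        canonical_index_next[OF W''(1), of x] W''(2) by (auto simp: mem_cover_interval)
    have "canonical_index W ?p = canonical_index W x"
      by (rule canonical_index_canonical_index[OF W W''(1,3)])
    moreover have "canonical_index (shift_cover z W) ?p = canonical_index (shift_cover z W) x"
      by (rule canonical_index_canonical_index[OF circle_points_shift_cover[OF W] W''(1,4)])
    ultimately show ?thesis
      using eq p by (fastforce simp: f_def canonical_index_shift_cover[OF W])
  qed
  \<comment> \<open>The shift by \<open>x\<close> itself carries \<open>x\<close> to 0.\<close>
  have f_const: "f x = f 0" for x using f_shift[of x x] by simp
  obtain z where z: "base_points W \<inter> base_points (shift_cover z W) = {}"
    using ex_disjoint_shift[OF W] .
  note Wz = circle_points_shift_cover[OF W, of z]
  obtain W'' where W'': "circle_points W''" "0 < snd W''" "refines W'' W" "refines W'' (shift_cover z W)"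
    and eq: "\<And>p p' x. p \<in> base_points W'' \<Longrightarrow> p' \<in> base_points W'' \<Longrightarrow>
      x \<in> cover_interval W'' p \<Longrightarrow> x \<in> cover_interval W'' p' \<Longrightarrow>
      F (canonical_index W p) (canonical_index W p') x =
      F (canonical_index (shift_cover z W) p - z) (canonical_index (shift_cover z W) p' - z) (x - z)"
    using inv[of z] by blast
  have sub: "base_points W \<subseteq> base_points W''" "base_points (shift_cover z W) \<subseteq> base_points W''"
    using W''(3,4) by (auto simp: refines_def intro!: base_points_mono)
  obtain g where g: "0 < g" "\<And>b c. b \<in> base_points W'' \<Longrightarrow> c \<in> base_points W'' \<Longrightarrow> b < c \<Longrightarrow> b + g \<le> c"
    using base_points_gap[OF W''(1)] by blast
  \<comment> \<open>At most the width of \<open>W''\<close>, so that points within \<delta> of a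
    break point lie in the adjacent intervals of \<open>W''\<close>; at most \<open>g / 2\<close>,
    so that no other break point of \<open>W''\<close>, and hence none of \<open>W\<close> or of the
    rotated cover, comes within \<delta> of such points.\<close>
  define \<delta> where "\<delta> = min (snd W'') (g / 2)"
  have \<delta>: "0 < \<delta>" "\<delta> \<le> snd W''" "2 * \<delta> \<le> g" using g W''(2) by (auto simp: \<delta>_def)
  have "F b c x = f 0"
    if b: "b \<in> base_points W" "b - \<delta> < x" "x < next_point W b + \<delta>"
    and c: "c \<in> base_points W" "c - \<delta> < x" "x < next_point W c + \<delta>" for b c x
  proof (cases "\<exists>q\<in>base_points W. q - \<delta> < x \<and> x < q + \<delta>")
    \<comment> \<open>Away from the break points, an interval that reaches \<open>x\<close> up to
      \<delta> already has \<open>x\<close> between its own end points, so \<open>b\<close> and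
      \<open>c\<close> both equal the index of \<open>x\<close>.\<close>
    case False
    have "canonical_index W x = b" if "b \<in> base_points W" "b - \<delta> < x" "x < next_point W b + \<delta>" for b
    proof (rule canonical_index_eqI[OF W])
      have "\<not> x < b + \<delta>" "\<not> next_point W b - \<delta> < x"
        using False that next_point_in[OF W, of b] by blast+
      then show "b \<le> x" "x < next_point W b" using \<delta> by linarith+
    qed fact
    from this[OF b] this[OF c] show ?thesis using f_const[of x] by (simp add: f_def)
  next
    case True
    then obtain q where q: "q \<in> base_points W" "q - \<delta> < x" "x < q + \<delta>" by blast
    \<comment> \<open>The gap bound puts \<open>q - \<delta>\<close> between the predecessor of
      \<open>q\<close> in \<open>W''\<close> and \<open>q\<close>. So \<open>p\<close> is that
      predecessor, and the intervals of \<open>W''\<close> at \<open>p\<close> and \<open>q\<close>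
      both contain \<open>x\<close>.\<close>
    define p where "p = canonical_index W'' (q - \<delta>)"
    define d where "d = canonical_index (shift_cover z W) q"
    have qW: "q \<in> base_points W''" using q sub by blast
    have qnz: "q \<notin> base_points (shift_cover z W)" using q z by blast
    have "d \<in> base_points (shift_cover z W)" "d \<le> q" "q < next_point (shift_cover z W) d"
      unfolding d_def by (rule canonical_index_in[OF Wz] canonical_index_le[OF Wz] canonical_index_next[OF Wz])+
    moreover from this qnz have "d \<noteq> q" by blast
    ultimately have d: "d \<in> base_points (shift_cover z W)" "d < q" "q < next_point (shift_cover z W) d"
      by simp_all
    \<comment> \<open>As \<open>q\<close> is no break point of the rotated cover, it lies strictly
      between two of them. All these points belong to \<open>W''\<close>, so strictness improves to
      distance \<open>g\<close>, which leaves room for everything within \<delta> of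
      \<open>q\<close>.\<close>
    have dgap: "d + g \<le> q" using g(2) d qW sub by blast
    have dgap': "q + g \<le> next_point (shift_cover z W) d"
      using g(2) d(3) qW sub next_point_in[OF Wz] by blast
    have p: "p \<in> base_points W''" "p \<le> q - \<delta>" "q - \<delta> < next_point W'' p"
      using canonical_index_in[OF W''(1)] canonical_index_le[OF W''(1)] canonical_index_next[OF W''(1)]
      by (auto simp: p_def)
    have pn: "next_point W'' p = q"
    proof -
      have "next_point W'' p \<le> q" using next_point_le[OF W''(1) qW] p \<delta> by auto
      moreover have "\<not> next_point W'' p < q"
        using g(2)[OF next_point_in[OF W''(1)] qW] p(3) \<delta> by fastforce
      ultimately show ?thesis by linarith
    qed
    have below: "r \<le> p" if "r \<in> base_points W''" "r < q" for r
      using next_point_le[OF W''(1) that(1), of p] pn that(2) by linarith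
    have "d \<le> p" using below d sub by blast
    then have dp: "canonical_index (shift_cover z W) p = d"
      using canonical_index_eqI[OF Wz d(1)] p(2) d(3) \<delta> by fastforce
    have x_p: "x \<in> cover_interval W'' p" "x \<in> cover_interval W'' q"
      using q p \<delta> pn next_point_gt[OF W''(1), of q] by (auto simp: mem_cover_interval)
    \<comment> \<open>An interval of \<open>W\<close> that reaches \<open>x\<close> has
      \<open>q\<close> as its left or its right break point; it is the canonical home of the
      interval of \<open>W''\<close> at \<open>q\<close> or at \<open>p\<close>,
      respectively.\<close>
    have index: "\<exists>r\<in>{p, q}. canonical_index W r = b"
      if b: "b \<in> base_points W" "b - \<delta> < x" "x < next_point W b + \<delta>" for b
    proof -
      have bW: "b \<in> base_points W''" "next_point W b \<in> base_points W''"
        using b sub next_point_in[OF W] by blast+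
      have "\<not> q < b" using g(2)[OF qW bW(1)] b q \<delta> by fastforce
      moreover have "\<not> next_point W b < q" using g(2)[OF bW(2) qW] b q \<delta> by fastforce
      ultimately consider "b = q" | "b < q" "q \<le> next_point W b" by linarith
      then show ?thesis
      proof cases
        case 1
        then show ?thesis using canonical_index_base_point[OF W q(1)] by auto
      next
        case 2
        then have "canonical_index W p = b"
          using canonical_index_eqI[OF W b(1)] below[OF bW(1)] p(2) \<delta> by fastforce
        then show ?thesis by blast
      qed
    qed
    obtain r s where rs: "r \<in> {p, q}" "canonical_index W r = b" "s \<in> {p, q}" "canonical_index W s = c"
      using index[OF b] index[OF c] by blast
    \<comment> \<open>In the rotated cover \<open>p\<close> and \<open>q\<close> share the index
      \<open>d\<close>, so invariance turns a value on an overlap into a diagonal one.\<close>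
    have "F b c x = F (d - z) (d - z) (x - z)"
      using eq[of r s x] rs x_p qW p(1) dp by (auto simp: d_def)
    moreover have "canonical_index W (x - z) = d - z"
    proof (rule canonical_index_eqI[OF W])
      show "d - z \<in> base_points W" using d by (simp add: base_points_shift_cover)
      show "d - z \<le> x - z" using dgap q \<delta> by linarith
      show "x - z < next_point W (d - z)"
        using dgap' q \<delta> by (simp add: next_point_shift_cover[OF W])
    qed
    ultimately show ?thesis using f_const[of "x - z"] by (simp add: f_def)
  qed
  then show thesis using that[of \<delta> "f 0"] \<delta> by blast
qed

section \<open>Powers of loops in a groupoid\<close>

primrec npow :: "('o, 'a) groupoid \<Rightarrow> 'a \<Rightarrow> nat \<Rightarrow> 'a" where
  "npow G v 0 = ident G (src G v)"
| "npow G v (Suc n) = mult G v (npow G v n)"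

definition gpow :: "('o, 'a) groupoid \<Rightarrow> 'a \<Rightarrow> int \<Rightarrow> 'a" where
  "gpow G v l = (if 0 \<le> l then npow G v (nat l) else ginv G (npow G v (nat (- l))))"

context topological_groupoid
begin

lemma npow_props:
  assumes v: "v \<in> topspace (Arr G)" "tgt G v = src G v"
  shows "npow G v n \<in> topspace (Arr G)" "src G (npow G v n) = src G v" "tgt G (npow G v n) = src G v"
  using v by (induction n) (auto simp: groupoid_simps)

lemma npow_commute:
  assumes v: "v \<in> topspace (Arr G)" "tgt G v = src G v"
  shows "mult G (npow G v n) v = mult G v (npow G v n)"
proof (induction n)
  case 0
  then show ?case using v mult_ident_left[of v] mult_ident_right[of v] by simp
next
  case (Suc n)
  have "mult G (npow G v (Suc n)) v = mult G v (mult G (npow G v n) v)"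
    using v by (simp add: mult_assoc npow_props)
  with Suc show ?case by simp
qed

lemma
  assumes v: "v \<in> topspace (Arr G)" "tgt G v = src G v"
  shows gpow_in [simp]: "gpow G v l \<in> topspace (Arr G)"
    and src_gpow [simp]: "src G (gpow G v l) = src G v"
    and tgt_gpow [simp]: "tgt G (gpow G v l) = src G v"
  using npow_props[OF v] by (auto simp: gpow_def groupoid_simps)

lemma gpow_0 [simp]: "gpow G v 0 = ident G (src G v)"
  by (simp add: gpow_def)

lemma gpow_1 [simp]: "v \<in> topspace (Arr G) \<Longrightarrow> tgt G v = src G v \<Longrightarrow> gpow G v 1 = v"
  using mult_ident_right[of v] by (simp add: gpow_def)

text \<open>Deals once with the sign of the exponent. With \<open>gpow_unique\<close>, the laws for
  integer powers then follow from this recurrence instead of from cases.\<close>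

lemma gpow_add_1:
  assumes v: "v \<in> topspace (Arr G)" "tgt G v = src G v"
  shows "gpow G v (l + 1) = mult G (gpow G v l) v"
proof (cases "0 \<le> l")
  case True
  then have "nat (l + 1) = Suc (nat l)" by simp
  with True show ?thesis by (simp add: gpow_def npow_commute[OF v])
next
  case False
  then obtain n where l: "l = - int (Suc n)"
    by (metis int_cases not_less of_nat_0_le_iff)
  note n = npow_props[OF v, of n]
  have "mult G (ginv G (mult G (npow G v n) v)) v = mult G (mult G (ginv G v) (ginv G (npow G v n))) v"
    using v n by (simp add: ginv_mult)
  moreover have "ginv G (npow G v (Suc n)) = ginv G (mult G v (npow G v n))" by simp
  moreover have "mult G (ginv G (mult G v (npow G v n))) v = ginv G (npow G v n)"
    using v n ginv_mult[of v "npow G v n"] mult_ident_right[of "ginv G (npow G v n)"]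
    by (simp add: mult_assoc groupoid_simps)
  moreover have "gpow G v (l + 1) = ginv G (npow G v n)"
  \<comment> \<open>For \<open>n = 0\<close> the exponent \<open>l + 1\<close> is 0 and falls in the
    nonnegative branch of \<open>gpow\<close>.\<close>
  proof (cases "n = 0")
    case False
    then have "\<not> 0 \<le> l + 1" "nat (- (l + 1)) = n" by (simp_all add: l)
    then show ?thesis by (simp add: gpow_def)
  qed (use v in \<open>simp add: l gpow_def ginv_ident\<close>)
  moreover have "gpow G v l = ginv G (npow G v (Suc n))"
    by (simp only: l gpow_def) (simp del: npow.simps add: nat_add_distrib)
  ultimately show ?thesis by simp
qed

text \<open>Right multiplication by \<open>v\<close> can be undone, so the recurrence propagates
  from 0 in both directions. This recognises powers from the behaviour of a loop under
  composition.\<close>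

lemma gpow_unique:
  assumes v: "v \<in> topspace (Arr G)" "tgt G v = src G v"
    and h: "\<And>l. h l \<in> topspace (Arr G)" "\<And>l. tgt G (h l) = src G v"
    and h_0: "h 0 = ident G (src G v)" and h_add_1: "\<And>l. h (l + 1) = mult G (h l) v"
  shows "h l = gpow G v l"
proof (induction l rule: int_induct[of _ 0])
  case base
  then show ?case by (simp add: h_0)
next
  case (step1 i)
  then show ?case by (simp add: h_add_1 gpow_add_1[OF v])
next
  case (step2 i)
  have undo: "a = mult G (mult G a v) (ginv G v)"
    if "a \<in> topspace (Arr G)" "tgt G a = src G v" for a
    using that v mult_ident_right[of a] by (simp add: mult_assoc groupoid_simps)
  have "mult G (h (i - 1)) v = mult G (gpow G v (i - 1)) v"
    using step2 h_add_1[of "i - 1"] gpow_add_1[OF v, of "i - 1"] by simp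
  then show ?case using undo[of "h (i - 1)"] undo[of "gpow G v (i - 1)"] h v by simp
qed

text \<open>For fixed \<open>l\<close>, the quotient of \<open>gpow G v (l + k)\<close> by
  \<open>gpow G v l\<close> satisfies the recurrence in \<open>k\<close>.\<close>

lemma gpow_add:
  assumes v: "v \<in> topspace (Arr G)" "tgt G v = src G v"
  shows "gpow G v (l + k) = mult G (gpow G v l) (gpow G v k)"
proof -
  have "mult G (ginv G (gpow G v l)) (gpow G v (l + k)) = gpow G v k"
    using v by (intro gpow_unique[where h = "\<lambda>k. mult G (ginv G (gpow G v l)) (gpow G v (l + k))"])
      (simp_all add: groupoid_simps mult_assoc gpow_add_1 flip: add.assoc)
  then have "mult G (gpow G v l) (gpow G v k) =
      mult G (gpow G v l) (mult G (ginv G (gpow G v l)) (gpow G v (l + k)))" by simp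
  also have "\<dots> = gpow G v (l + k)" using v by (simp add: mult_ginv_cancel_left)
  finally show ?thesis ..
qed

lemma gpow_minus:
  assumes v: "v \<in> topspace (Arr G)" "tgt G v = src G v"
  shows "gpow G v (- l) = ginv G (gpow G v l)"
  using v gpow_add[OF v, of l "- l"] by (intro ginv_unique) simp_all

text \<open>The conjugates of the powers of \<open>v\<close> satisfy the recurrence for the
  conjugate of \<open>v\<close>. The equation is the naturality square of a constant arrow between
  constant loops.\<close>

lemma gpow_conj:
  assumes v: "v \<in> topspace (Arr G)" "tgt G v = src G v"
    and \<alpha>: "\<alpha> \<in> topspace (Arr G)" "src G \<alpha> = src G v"
  shows "mult G (gpow G v l) \<alpha> = mult G \<alpha> (gpow G (mult G (ginv G \<alpha>) (mult G v \<alpha>)) l)"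
proof -
  let ?w = "mult G (ginv G \<alpha>) (mult G v \<alpha>)"
  have w: "?w \<in> topspace (Arr G)" "src G ?w = tgt G \<alpha>" "tgt G ?w = tgt G \<alpha>"
    using v \<alpha> by (simp_all add: groupoid_simps)
  have "mult G (ginv G \<alpha>) (mult G (gpow G v l) \<alpha>) = gpow G ?w l"
  proof (rule gpow_unique[where h = "\<lambda>l. mult G (ginv G \<alpha>) (mult G (gpow G v l) \<alpha>)"])
    fix l
    have "mult G \<alpha> (mult G (ginv G \<alpha>) (mult G v \<alpha>)) = mult G v \<alpha>"
      using v \<alpha> by (intro mult_ginv_cancel_left) (simp_all add: groupoid_simps)
    then show "mult G (ginv G \<alpha>) (mult G (gpow G v (l + 1)) \<alpha>) =
        mult G (mult G (ginv G \<alpha>) (mult G (gpow G v l) \<alpha>)) ?w"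
      using v \<alpha> w by (simp add: gpow_add_1 mult_assoc groupoid_simps)
  qed (use v \<alpha> w mult_ident_left[of \<alpha>] in \<open>simp_all add: groupoid_simps\<close>)
  then have "mult G \<alpha> (gpow G ?w l) = mult G \<alpha> (mult G (ginv G \<alpha>) (mult G (gpow G v l) \<alpha>))" by simp
  also have "\<dots> = mult G (gpow G v l) \<alpha>"
    using v \<alpha> by (intro mult_ginv_cancel_left) (simp_all add: groupoid_simps)
  finally show ?thesis ..
qed

lemma continuous_map_gpow:
  assumes f: "continuous_map X (Arr G) f" and loop: "\<And>x. x \<in> topspace X \<Longrightarrow> tgt G (f x) = src G (f x)"
  shows "continuous_map X (Arr G) (\<lambda>x. gpow G (f x) l)"
proof -
  have fx: "f x \<in> topspace (Arr G)" if "x \<in> topspace X" for x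
    using f that by (auto simp: continuous_map)
  have "continuous_map X (Arr G) (\<lambda>x. npow G (f x) n)" for n
  proof (induction n)
    case 0
    then show ?case using continuous_map_ident[OF continuous_map_src[OF f]] by simp
  next
    case (Suc n)
    then show ?case using f loop fx by (auto simp: npow_props intro!: continuous_map_mult)
  qed
  note pow = this continuous_map_ginv[OF this]
  show ?thesis using pow(1)[of "nat l"] pow(2)[of "nat (- l)"] by (cases "0 \<le> l") (simp_all add: gpow_def)
qed

end

section \<open>The circle groupoids\<close>

abbreviation circle_objects :: "circle_cover \<Rightarrow> s1_obj set" where
  "circle_objects W \<equiv> topspace (Obj (circle_groupoid W))"

abbreviation circle_arrows :: "circle_cover \<Rightarrow> s1_arr set" where
  "circle_arrows W \<equiv> topspace (Arr (circle_groupoid W))"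

lemma mem_circle_obj [simp]:
  "(b, x) \<in> circle_objects W \<longleftrightarrow> b \<in> base_points W \<and> x \<in> cover_interval W b"
  by (simp add: circle_groupoid_def)

lemma mem_circle_arr [simp]:
  "(((b, c), x), l) \<in> circle_arrows W \<longleftrightarrow>
     b \<in> base_points W \<and> c \<in> base_points W \<and> x \<in> cover_interval W b \<and> x \<in> cover_interval W c"
  by (auto simp: circle_groupoid_def)

lemma circle_groupoid_simps [simp]:
  "src (circle_groupoid W) (((b, c), x), l) = (b, x)"
  "tgt (circle_groupoid W) (((b, c), x), l) = (c + of_int l, x + of_int l)"
  "mult (circle_groupoid W) (((b, c), x), l) (((c', d), y), k) = (((b, d - of_int l), x), l + k)"
  "ginv (circle_groupoid W) (((b, c), x), l) = (((c + of_int l, b + of_int l), x + of_int l), - l)"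
  "ident (circle_groupoid W) (b, x) = (((b, b), x), 0)"
  by (simp_all add: circle_groupoid_def)

lemma circle_arr_cases:
  fixes r :: s1_arr
  obtains b c x l where "r = (((b, c), x), l)"
  by (metis surj_pair)

lemma cover_interval_diff_int [simp]:
  "circle_points W \<Longrightarrow> x \<in> cover_interval W (b - of_int k) \<longleftrightarrow> x + of_int k \<in> cover_interval W b"
  using cover_interval_add_int[of W x k "b - of_int k"] by simp

lemma
  assumes W: "circle_points W" and r: "r \<in> circle_arrows W"
  shows circle_src_in: "src (circle_groupoid W) r \<in> circle_objects W"
    and circle_tgt_in: "tgt (circle_groupoid W) r \<in> circle_objects W"
    and circle_ginv_in: "ginv (circle_groupoid W) r \<in> circle_arrows W"
    and circle_mult_in: "r' \<in> circle_arrows W \<Longrightarrow>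
      tgt (circle_groupoid W) r = src (circle_groupoid W) r' \<Longrightarrow>
      mult (circle_groupoid W) r r' \<in> circle_arrows W"
  using W r by (cases r rule: circle_arr_cases; cases r' rule: circle_arr_cases; auto)+

lemma circle_ident_in:
  "p \<in> circle_objects W \<Longrightarrow> ident (circle_groupoid W) p \<in> circle_arrows W"
  by (cases p) simp

lemma continuous_map_from_circle_obj:
  assumes "\<And>b. b \<in> base_points W \<Longrightarrow> continuous_map (top_of_set (cover_interval W b)) Y (\<lambda>x. f (b, x))"
  shows "continuous_map (Obj (circle_groupoid W)) Y f"
  using assms by (simp add: circle_groupoid_def continuous_map_from_sum)

lemma continuous_map_from_circle_arr:
  assumes "\<And>b c l. b \<in> base_points W \<Longrightarrow> c \<in> base_points W \<Longrightarrow>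
    continuous_map (top_of_set (cover_interval W b \<inter> cover_interval W c)) Y (\<lambda>x. f (((b, c), x), l))"
  shows "continuous_map (Arr (circle_groupoid W)) Y f"
  using assms by (auto simp: circle_groupoid_def intro!: continuous_map_from_prod_discrete continuous_map_from_sum)

lemma continuous_map_into_circle_obj:
  assumes "b \<in> base_points W" "continuous_on T g" "g ` T \<subseteq> cover_interval W b"
  shows "continuous_map (top_of_set T) (Obj (circle_groupoid W)) (\<lambda>x. (b, g x))"
proof -
  have "continuous_map (top_of_set T) (top_of_set (cover_interval W b)) g"
    using assms by (auto simp: continuous_map_in_subtopology)
  from continuous_map_compose[OF this
      continuous_map_component_injection[OF assms(1), of "\<lambda>b. top_of_set (cover_interval W b)"]]
  show ?thesis by (simp add: o_def circle_groupoid_def)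
qed

lemma continuous_map_into_circle_arr:
  assumes "b \<in> base_points W" "c \<in> base_points W" "continuous_on T g"
    "g ` T \<subseteq> cover_interval W b \<inter> cover_interval W c"
  shows "continuous_map (top_of_set T) (Arr (circle_groupoid W)) (\<lambda>x. (((b, c), g x), l))"
proof -
  have bc: "(b, c) \<in> base_points W \<times> base_points W" using assms by simp
  have "continuous_map (top_of_set T) (top_of_set (cover_interval W b \<inter> cover_interval W c)) g"
    using assms by (auto simp: continuous_map_in_subtopology)
  from continuous_map_compose[OF this, of _ "\<lambda>x. ((b, c), x)"]
    continuous_map_component_injection[OF bc, of "\<lambda>(b, c). top_of_set (cover_interval W b \<inter> cover_interval W c)"]
  show ?thesis by (simp add: o_def circle_groupoid_def continuous_map_paired)
qed

lemma continuous_circle_src: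
  "continuous_map (Arr (circle_groupoid W)) (Obj (circle_groupoid W)) (src (circle_groupoid W))"
  by (rule continuous_map_from_circle_arr) (auto intro!: continuous_map_into_circle_obj)

lemma continuous_circle_ident:
  "continuous_map (Obj (circle_groupoid W)) (Arr (circle_groupoid W)) (ident (circle_groupoid W))"
  by (rule continuous_map_from_circle_obj) (auto intro!: continuous_map_into_circle_arr)

text \<open>The image of a compact set in the discrete factor is compact, hence finite. This is the
  finiteness behind the continuity of constant loops in the compact-open topology.\<close>

lemma finite_snd_compactin_circle_arr:
  assumes "compactin (Arr (circle_groupoid W)) K"
  shows "finite (snd ` K)"
proof -
  have "continuous_map (Arr (circle_groupoid W)) (discrete_topology UNIV) snd"
    by (simp add: circle_groupoid_def continuous_map_snd)
  from image_compactin[OF assms this] show ?thesis by (simp add: compactin_discrete_topology)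
qed

section \<open>Loops and their arrows\<close>

lemma mem_loop_space:
  "\<Psi> \<in> topspace (loop_space G W) \<longleftrightarrow> groupoid_morphism (circle_groupoid W) G \<Psi> \<and>
     fst \<Psi> \<in> extensional (circle_objects W) \<and>
     snd \<Psi> \<in> extensional (circle_arrows W)"
  by (auto simp: loop_space_def Let_def topspace_compact_open_topology continuous_maps_def
      groupoid_morphism_def mem_Times_iff split_beta)

lemma loop_spaceD:
  assumes \<Psi>: "\<Psi> \<in> topspace (loop_space G W)"
  defines "S \<equiv> circle_groupoid W"
  shows "continuous_map (Obj S) (Obj G) (fst \<Psi>)" "continuous_map (Arr S) (Arr G) (snd \<Psi>)"
    and "r \<in> topspace (Arr S) \<Longrightarrow> snd \<Psi> r \<in> topspace (Arr G)"
    and "p \<in> topspace (Obj S) \<Longrightarrow> fst \<Psi> p \<in> topspace (Obj G)"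
    and "r \<in> topspace (Arr S) \<Longrightarrow> src G (snd \<Psi> r) = fst \<Psi> (src S r)"
    and "r \<in> topspace (Arr S) \<Longrightarrow> tgt G (snd \<Psi> r) = fst \<Psi> (tgt S r)"
    and "p \<in> topspace (Obj S) \<Longrightarrow> snd \<Psi> (ident S p) = ident G (fst \<Psi> p)"
    and "r \<in> topspace (Arr S) \<Longrightarrow> r' \<in> topspace (Arr S) \<Longrightarrow> tgt S r = src S r' \<Longrightarrow>
      snd \<Psi> (mult S r r') = mult G (snd \<Psi> r) (snd \<Psi> r')"
proof -
  have m: "groupoid_morphism S G \<Psi>" using \<Psi> by (simp add: mem_loop_space S_def)
  then show c: "continuous_map (Obj S) (Obj G) (fst \<Psi>)" "continuous_map (Arr S) (Arr G) (snd \<Psi>)"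
    by (auto simp: groupoid_morphism_def)
  show "r \<in> topspace (Arr S) \<Longrightarrow> snd \<Psi> r \<in> topspace (Arr G)" "p \<in> topspace (Obj S) \<Longrightarrow> fst \<Psi> p \<in> topspace (Obj G)"
    using c[THEN continuous_map_image_subset_topspace] by blast+
qed (use \<Psi> in \<open>auto simp: mem_loop_space groupoid_morphism_def S_def split_beta\<close>)

text \<open>A pullback topology keeps only points that map into the target space. Every arrow of
  loops does, since its values on identities form a continuous map.\<close>

lemma topspace_loop_arrow_space: "topspace (loop_arrow_space G W) = loop_arrows G W"
proof -
  have "restrict (\<lambda>x. \<Lambda> (ident (circle_groupoid W) x)) (circle_objects W)
      \<in> continuous_maps (Obj (circle_groupoid W)) (Arr G)"
    if "\<Lambda> \<in> continuous_maps (Arr (circle_groupoid W)) (Arr G)" for \<Lambda>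
    using that continuous_map_compose[OF continuous_circle_ident, of W "Arr G" \<Lambda>]
    by (auto simp: continuous_maps_def o_def intro: continuous_map_eq)
  then show ?thesis
    by (auto simp: loop_arrow_space_def Let_def topspace_pullback_topology topspace_compact_open_topology
        loop_arrows_def loop_space_def)
qed

lemma loop_arrowsD:
  assumes W: "circle_points W" and a: "(\<Psi>, \<Phi>, \<Lambda>) \<in> loop_arrows G W"
  defines "S \<equiv> circle_groupoid W"
  shows "\<Psi> \<in> topspace (loop_space G W)" "\<Phi> \<in> topspace (loop_space G W)"
    and "continuous_map (Arr S) (Arr G) \<Lambda>"
    and "p \<in> topspace (Obj S) \<Longrightarrow> \<Lambda> (ident S p) \<in> topspace (Arr G)"
    and "p \<in> topspace (Obj S) \<Longrightarrow> src G (\<Lambda> (ident S p)) = fst \<Psi> p"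
    and "p \<in> topspace (Obj S) \<Longrightarrow> tgt G (\<Lambda> (ident S p)) = fst \<Phi> p"
    and "r \<in> topspace (Arr S) \<Longrightarrow> \<Lambda> r = mult G (snd \<Psi> r) (\<Lambda> (ident S (tgt S r)))"
    and "r \<in> topspace (Arr S) \<Longrightarrow> \<Lambda> r = mult G (\<Lambda> (ident S (src S r))) (snd \<Phi> r)"
proof -
  show "\<Psi> \<in> topspace (loop_space G W)" "\<Phi> \<in> topspace (loop_space G W)" and c: "continuous_map (Arr S) (Arr G) \<Lambda>"
    using a by (auto simp: loop_arrows_def continuous_maps_def Let_def S_def)
  have eq: "src G (\<Lambda> r) = fst \<Psi> (src S r) \<and> tgt G (\<Lambda> r) = fst \<Phi> (tgt S r) \<and>
      \<Lambda> r = mult G (snd \<Psi> r) (\<Lambda> (ident S (tgt S r))) \<and> \<Lambda> r = mult G (\<Lambda> (ident S (src S r))) (snd \<Phi> r)"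
    if "r \<in> topspace (Arr S)" for r
    using a that unfolding loop_arrows_def Let_def S_def by blast
  show "r \<in> topspace (Arr S) \<Longrightarrow> \<Lambda> r = mult G (snd \<Psi> r) (\<Lambda> (ident S (tgt S r)))"
    "r \<in> topspace (Arr S) \<Longrightarrow> \<Lambda> r = mult G (\<Lambda> (ident S (src S r))) (snd \<Phi> r)"
    using eq by blast+
  assume p: "p \<in> topspace (Obj S)"
  then have i: "ident S p \<in> topspace (Arr S)" unfolding S_def by (rule circle_ident_in)
  then show "\<Lambda> (ident S p) \<in> topspace (Arr G)" using continuous_map_image_subset_topspace[OF c] by blast
  have "src S (ident S p) = p" "tgt S (ident S p) = p" by (cases p; simp add: S_def)+
  with eq[OF i] show "src G (\<Lambda> (ident S p)) = fst \<Psi> p" "tgt G (\<Lambda> (ident S p)) = fst \<Phi> p" by simp_all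
qed

text \<open>An arrow of loops is determined by its values on identities, which form a natural transformation.\<close>

lemma (in topological_groupoid) loop_arrowsI:
  assumes W: "circle_points W" and \<Psi>: "\<Psi> \<in> topspace (loop_space G W)" and \<Phi>: "\<Phi> \<in> topspace (loop_space G W)"
  defines "S \<equiv> circle_groupoid W"
  assumes \<kappa>: "continuous_map (Obj S) (Arr G) \<kappa>" "\<And>p. p \<in> topspace (Obj S) \<Longrightarrow> src G (\<kappa> p) = fst \<Psi> p"
      "\<And>p. p \<in> topspace (Obj S) \<Longrightarrow> tgt G (\<kappa> p) = fst \<Phi> p"
    and nat: "\<And>r. r \<in> topspace (Arr S) \<Longrightarrow> mult G (snd \<Psi> r) (\<kappa> (tgt S r)) = mult G (\<kappa> (src S r)) (snd \<Phi> r)"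
  shows "(\<Psi>, \<Phi>, restrict (\<lambda>r. mult G (\<kappa> (src S r)) (snd \<Phi> r)) (topspace (Arr S))) \<in> loop_arrows G W"
proof -
  let ?\<Lambda> = "restrict (\<lambda>r. mult G (\<kappa> (src S r)) (snd \<Phi> r)) (topspace (Arr S))"
  note \<Psi>D = loop_spaceD[OF \<Psi>, folded S_def] and \<Phi>D = loop_spaceD[OF \<Phi>, folded S_def]
  note S = circle_src_in[OF W, folded S_def] circle_tgt_in[OF W, folded S_def]
  have \<kappa>_in: "\<kappa> p \<in> topspace (Arr G)" if "p \<in> topspace (Obj S)" for p
    using continuous_map_image_subset_topspace[OF \<kappa>(1)] that by blast
  have "continuous_map (Arr S) (Arr G) (\<lambda>r. mult G (\<kappa> (src S r)) (snd \<Phi> r))"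
    using continuous_map_compose[OF continuous_circle_src[of W, folded S_def] \<kappa>(1)] \<Phi>D(2,5) \<kappa>(3) S
    by (intro continuous_map_mult) (simp_all add: o_def)
  then have "?\<Lambda> \<in> continuous_maps (Arr S) (Arr G)"
    by (auto simp: continuous_maps_def intro: continuous_map_eq)
  moreover have "src G (?\<Lambda> r) = fst \<Psi> (src S r) \<and> tgt G (?\<Lambda> r) = fst \<Phi> (tgt S r) \<and>
      ?\<Lambda> r = mult G (snd \<Psi> r) (?\<Lambda> (ident S (tgt S r))) \<and> ?\<Lambda> r = mult G (?\<Lambda> (ident S (src S r))) (snd \<Phi> r)"
    if r: "r \<in> topspace (Arr S)" for r
  proof -
    \<comment> \<open>\<Phi> sends identities to identities, so on identities the product collapses
      to \<kappa>.\<close>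
    have ident: "?\<Lambda> (ident S p) = \<kappa> p" if p: "p \<in> topspace (Obj S)" for p
    proof -
      have "src S (ident S p) = p" "ident S p \<in> topspace (Arr S)"
        using p circle_ident_in[of p W] by (cases p, simp add: S_def)+
      then show ?thesis using mult_ident_right[OF \<kappa>_in[OF p]] \<Phi>D(7)[OF p] \<kappa>(3)[OF p] by simp
    qed
    have e: "?\<Lambda> r = mult G (\<kappa> (src S r)) (snd \<Phi> r)" using r by simp
    show ?thesis
      unfolding e ident[OF S(1)[OF r]] ident[OF S(2)[OF r]]
      using nat[OF r] \<Phi>D(3,5,6)[OF r] \<kappa>_in[OF S(1)[OF r]] \<kappa>(2,3)[OF S(1)[OF r]] by (simp add: src_mult tgt_mult)
  qed
  ultimately show ?thesis
    unfolding loop_arrows_def Let_def S_def mem_Collect_eq case_prod_conv using \<Psi> \<Phi> by blast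
qed

section \<open>Pullback of loops along morphisms of circle groupoids\<close>

lemma groupoid_morphism_restrict:
  assumes W: "circle_points W" and m: "groupoid_morphism (circle_groupoid W) G \<Psi>"
  shows "groupoid_morphism (circle_groupoid W) G
    (restrict (fst \<Psi>) (circle_objects W), restrict (snd \<Psi>) (circle_arrows W))"
  using m circle_src_in[OF W] circle_tgt_in[OF W] circle_ginv_in[OF W] circle_mult_in[OF W] circle_ident_in
  by (auto simp: groupoid_morphism_def split_beta intro: continuous_map_eq simp del: mem_circle_arr mem_circle_obj)

text \<open>Refinement and rotation are both precomposition with a morphism of circle groupoids, so
  well-definedness and composition are proved once for this common form.\<close>

definition pullback_loop ::
  "circle_cover \<Rightarrow> (s1_obj \<Rightarrow> s1_obj) \<times> (s1_arr \<Rightarrow> s1_arr) \<Rightarrow> ('o, 'a) loop \<Rightarrow> ('o, 'a) loop" where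
  "pullback_loop W \<phi> \<Psi> = (restrict (fst \<Psi> \<circ> fst \<phi>) (circle_objects W),
     restrict (snd \<Psi> \<circ> snd \<phi>) (circle_arrows W))"

lemma pullback_loop_in:
  assumes W: "circle_points W'" and \<phi>: "groupoid_morphism (circle_groupoid W') (circle_groupoid W) \<phi>"
    and \<Psi>: "\<Psi> \<in> topspace (loop_space G W)"
  shows "pullback_loop W' \<phi> \<Psi> \<in> topspace (loop_space G W')"
  using groupoid_morphism_restrict[OF W groupoid_morphism_compose[OF \<phi>, of G \<Psi>]] \<Psi>
  by (simp add: mem_loop_space pullback_loop_def)

lemma pullback_loop_arrow_in:
  assumes W: "circle_points W'" and \<phi>: "groupoid_morphism (circle_groupoid W') (circle_groupoid W) \<phi>"
    and L: "(\<Psi>, \<Phi>, \<Lambda>) \<in> loop_arrows G W"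
  shows "(pullback_loop W' \<phi> \<Psi>, pullback_loop W' \<phi> \<Phi>,
      restrict (\<Lambda> \<circ> snd \<phi>) (circle_arrows W')) \<in> loop_arrows G W'"
proof -
  let ?S = "circle_groupoid W" and ?S' = "circle_groupoid W'"
  note m = \<phi>[unfolded groupoid_morphism_def split_beta]
  have in1: "snd \<phi> r \<in> topspace (Arr ?S)" if "r \<in> topspace (Arr ?S')" for r
    using m that by (auto simp: continuous_map)
  have L': "\<Psi> \<in> topspace (loop_space G W)" "\<Phi> \<in> topspace (loop_space G W)"
      "\<Lambda> \<in> continuous_maps (Arr ?S) (Arr G)"
    and eq: "\<And>r. r \<in> topspace (Arr ?S) \<Longrightarrow>
      src G (\<Lambda> r) = fst \<Psi> (src ?S r) \<and> tgt G (\<Lambda> r) = fst \<Phi> (tgt ?S r) \<and>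
      \<Lambda> r = mult G (snd \<Psi> r) (\<Lambda> (ident ?S (tgt ?S r))) \<and>
      \<Lambda> r = mult G (\<Lambda> (ident ?S (src ?S r))) (snd \<Phi> r)"
    using L by (auto simp: loop_arrows_def Let_def)
  have "restrict (\<Lambda> \<circ> snd \<phi>) (topspace (Arr ?S')) \<in> continuous_maps (Arr ?S') (Arr G)"
    using m L'(3) continuous_map_compose[of "Arr ?S'" "Arr ?S" "snd \<phi>" "Arr G" \<Lambda>]
    by (auto simp: continuous_maps_def intro: continuous_map_eq)
  note \<Lambda>' = this
  have *: "src G (\<Lambda> (snd \<phi> r)) = fst \<Psi> (fst \<phi> (src ?S' r)) \<and>
      tgt G (\<Lambda> (snd \<phi> r)) = fst \<Phi> (fst \<phi> (tgt ?S' r)) \<and>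
      \<Lambda> (snd \<phi> r) = mult G (snd \<Psi> (snd \<phi> r)) (\<Lambda> (snd \<phi> (ident ?S' (tgt ?S' r)))) \<and>
      \<Lambda> (snd \<phi> r) = mult G (\<Lambda> (snd \<phi> (ident ?S' (src ?S' r)))) (snd \<Phi> (snd \<phi> r))"
    if r: "r \<in> topspace (Arr ?S')" for r
  proof -
    have "snd \<phi> (ident ?S' (tgt ?S' r)) = ident ?S (tgt ?S (snd \<phi> r))"
      "snd \<phi> (ident ?S' (src ?S' r)) = ident ?S (src ?S (snd \<phi> r))"
      "fst \<phi> (src ?S' r) = src ?S (snd \<phi> r)" "fst \<phi> (tgt ?S' r) = tgt ?S (snd \<phi> r)"
      using m r circle_src_in[OF W r] circle_tgt_in[OF W r] by simp_all
    note * = this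
    show ?thesis unfolding * by (rule eq[OF in1[OF r]])
  qed
  let ?\<Lambda>' = "restrict (\<Lambda> \<circ> snd \<phi>) (topspace (Arr ?S'))"
  have "src G (?\<Lambda>' r) = fst (pullback_loop W' \<phi> \<Psi>) (src ?S' r) \<and>
      tgt G (?\<Lambda>' r) = fst (pullback_loop W' \<phi> \<Phi>) (tgt ?S' r) \<and>
      ?\<Lambda>' r = mult G (snd (pullback_loop W' \<phi> \<Psi>) r) (?\<Lambda>' (ident ?S' (tgt ?S' r))) \<and>
      ?\<Lambda>' r = mult G (?\<Lambda>' (ident ?S' (src ?S' r))) (snd (pullback_loop W' \<phi> \<Phi>) r)"
    if r: "r \<in> topspace (Arr ?S')" for r
  proof -
    note st = circle_src_in[OF W r] circle_tgt_in[OF W r]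
    have e: "?\<Lambda>' r = \<Lambda> (snd \<phi> r)"
      "?\<Lambda>' (ident ?S' (tgt ?S' r)) = \<Lambda> (snd \<phi> (ident ?S' (tgt ?S' r)))"
      "?\<Lambda>' (ident ?S' (src ?S' r)) = \<Lambda> (snd \<phi> (ident ?S' (src ?S' r)))"
      "fst (pullback_loop W' \<phi> \<Psi>) (src ?S' r) = fst \<Psi> (fst \<phi> (src ?S' r))"
      "fst (pullback_loop W' \<phi> \<Phi>) (tgt ?S' r) = fst \<Phi> (fst \<phi> (tgt ?S' r))"
      "snd (pullback_loop W' \<phi> \<Psi>) r = snd \<Psi> (snd \<phi> r)"
      "snd (pullback_loop W' \<phi> \<Phi>) r = snd \<Phi> (snd \<phi> r)"
      using r st st[THEN circle_ident_in] by (simp_all add: pullback_loop_def del: mem_circle_arr mem_circle_obj)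
    show ?thesis unfolding e by (rule *[OF r])
  qed
  then show ?thesis
    unfolding loop_arrows_def Let_def mem_Collect_eq case_prod_conv
    using \<Lambda>' pullback_loop_in[OF W \<phi> L'(1)] pullback_loop_in[OF W \<phi> L'(2)] by blast
qed

definition pullback_loop_arrow ::
  "circle_cover \<Rightarrow> (s1_obj \<Rightarrow> s1_obj) \<times> (s1_arr \<Rightarrow> s1_arr) \<Rightarrow> ('o, 'a) loop_arrow \<Rightarrow> ('o, 'a) loop_arrow" where
  "pullback_loop_arrow W \<phi> = (\<lambda>(\<Psi>, \<Phi>, \<Lambda>). (pullback_loop W \<phi> \<Psi>, pullback_loop W \<phi> \<Phi>,
     restrict (\<Lambda> \<circ> snd \<phi>) (circle_arrows W)))"

text \<open>Ensures that the inner \<open>restrict\<close> of a nested pullback is evaluated only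
  inside its domain, so that pullbacks compose strictly.\<close>

definition maps_circle :: "circle_cover \<Rightarrow> circle_cover \<Rightarrow> (s1_obj \<Rightarrow> s1_obj) \<times> (s1_arr \<Rightarrow> s1_arr) \<Rightarrow> bool" where
  "maps_circle W' W \<phi> \<longleftrightarrow>
     (\<forall>p\<in>circle_objects W'. fst \<phi> p \<in> circle_objects W) \<and>
     (\<forall>r\<in>circle_arrows W'. snd \<phi> r \<in> circle_arrows W)"

lemma
  assumes "maps_circle W' W \<phi>"
  shows pullback_pullback_loop: "pullback_loop W' \<phi> (pullback_loop W \<psi> \<Psi>) =
      pullback_loop W' (fst \<psi> \<circ> fst \<phi>, snd \<psi> \<circ> snd \<phi>) \<Psi>"
    and pullback_pullback_loop_arrow: "pullback_loop_arrow W' \<phi> (pullback_loop_arrow W \<psi> a) =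
      pullback_loop_arrow W' (fst \<psi> \<circ> fst \<phi>, snd \<psi> \<circ> snd \<phi>) a"
proof -
  show *: "pullback_loop W' \<phi> (pullback_loop W \<psi> \<Psi>) = pullback_loop W' (fst \<psi> \<circ> fst \<phi>, snd \<psi> \<circ> snd \<phi>) \<Psi>" for \<Psi>
    unfolding pullback_loop_def prod.inject using assms
    by (intro conjI restrict_ext) (simp_all add: maps_circle_def del: mem_circle_arr mem_circle_obj)
  show "pullback_loop_arrow W' \<phi> (pullback_loop_arrow W \<psi> a) =
      pullback_loop_arrow W' (fst \<psi> \<circ> fst \<phi>, snd \<psi> \<circ> snd \<phi>) a"
    unfolding pullback_loop_arrow_def split_beta prod.inject fst_conv snd_conv * using assms
    by (intro conjI restrict_ext refl) (simp_all add: maps_circle_def del: mem_circle_arr mem_circle_obj)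
qed

lemma
  assumes "fst \<phi> = id" "snd \<phi> = id"
  shows pullback_loop_id: "\<Psi> \<in> topspace (loop_space G W) \<Longrightarrow> pullback_loop W \<phi> \<Psi> = \<Psi>"
    and pullback_loop_arrow_id: "a \<in> loop_arrows G W \<Longrightarrow> pullback_loop_arrow W \<phi> a = a"
proof -
  show *: "pullback_loop W \<phi> \<Psi> = \<Psi>" if "\<Psi> \<in> topspace (loop_space G W)" for \<Psi>
    using that assms by (simp add: mem_loop_space pullback_loop_def extensional_restrict)
  show "pullback_loop_arrow W \<phi> a = a" if "a \<in> loop_arrows G W"
    using that assms by (auto simp: loop_arrows_def Let_def continuous_maps_def pullback_loop_arrow_def * extensional_restrict)
qed

section \<open>Refinement and rotation as pullbacks\<close>

lemma loop_restrict_eq_pullback: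
  "loop_restrict W W' = pullback_loop W' (refinement_obj W, refinement_arr W)"
  "loop_arrow_restrict W W' = pullback_loop_arrow W' (refinement_obj W, refinement_arr W)"
  by (auto simp: loop_restrict_def loop_arrow_restrict_def pullback_loop_def pullback_loop_arrow_def fun_eq_iff)

definition rotation_morphism :: "real \<Rightarrow> (s1_obj \<Rightarrow> s1_obj) \<times> (s1_arr \<Rightarrow> s1_arr)" where
  "rotation_morphism z = ((\<lambda>(b, x). (b - z, x - z)), (\<lambda>(((b, c), x), l). (((b - z, c - z), x - z), l)))"

lemma groupoid_morphism_rotation:
  assumes W: "circle_points W"
  shows "groupoid_morphism (circle_groupoid (shift_cover z W)) (circle_groupoid W) (rotation_morphism z)"
proof -
  let ?S = "circle_groupoid W" and ?S' = "circle_groupoid (shift_cover z W)"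
  have "continuous_map (Obj ?S') (Obj ?S) (\<lambda>(b, x). (b - z, x - z))"
    by (rule continuous_map_from_circle_obj)
      (auto intro!: continuous_map_into_circle_obj continuous_intros
        simp: base_points_shift_cover cover_interval_shift_cover[OF W])
  moreover have "continuous_map (Arr ?S') (Arr ?S) (\<lambda>(((b, c), x), l). (((b - z, c - z), x - z), l))"
    by (rule continuous_map_from_circle_arr)
      (auto intro!: continuous_map_into_circle_arr continuous_intros
        simp: base_points_shift_cover cover_interval_shift_cover[OF W])
  ultimately show ?thesis
    by (auto simp: groupoid_morphism_def rotation_morphism_def split: prod.splits)
qed

lemma rotate_loop_eq_pullback:
  "rotate_loop z W = pullback_loop (shift_cover z W) (rotation_morphism z)"
  "rotate_loop_arrow z W = pullback_loop_arrow (shift_cover z W) (rotation_morphism z)"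
  by (auto simp: rotate_loop_def rotate_loop_arrow_def pullback_loop_def pullback_loop_arrow_def
      rotation_morphism_def fun_eq_iff restrict_def)

lemma rotate_loop_in:
  assumes "circle_points W" "\<Psi> \<in> topspace (loop_space G W)"
  shows "rotate_loop z W \<Psi> \<in> topspace (loop_space G (shift_cover z W))"
  unfolding rotate_loop_eq_pullback
  by (rule pullback_loop_in[OF circle_points_shift_cover groupoid_morphism_rotation]) (use assms in auto)

lemma rotate_loop_arrow_in:
  assumes "circle_points W" "a \<in> loop_arrows G W"
  shows "rotate_loop_arrow z W a \<in> loop_arrows G (shift_cover z W)"
  unfolding rotate_loop_eq_pullback pullback_loop_arrow_def split_beta
  by (rule pullback_loop_arrow_in[OF circle_points_shift_cover groupoid_morphism_rotation]) (use assms in auto)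

lemma maps_circle_refinement:
  assumes "circle_points W" "circle_points W'" "refines W' W"
  shows "maps_circle W' W (refinement_obj W, refinement_arr W)"
  using assms by (auto simp: maps_circle_def refinement_obj_def refinement_arr_def canonical_index_in
      intro: cover_interval_refines)

lemma refinement_obj_in:
  assumes "circle_points W" "circle_points W'" "refines W' W" "p \<in> circle_objects W'"
  shows "refinement_obj W p \<in> circle_objects W"
  using maps_circle_refinement[OF assms(1-3)] assms(4) by (simp add: maps_circle_def del: mem_circle_obj)

lemma refinement_arr_in:
  assumes "circle_points W" "circle_points W'" "refines W' W" "r \<in> circle_arrows W'"
  shows "refinement_arr W r \<in> circle_arrows W"
  using maps_circle_refinement[OF assms(1-3)] assms(4) by (simp add: maps_circle_def del: mem_circle_arr)

lemma maps_circle_rotation: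
  assumes "circle_points W"
  shows "maps_circle (shift_cover z W) W (rotation_morphism z)"
  by (auto simp: maps_circle_def rotation_morphism_def base_points_shift_cover cover_interval_shift_cover[OF assms])

lemma
  assumes W: "circle_points W" "circle_points W'" "circle_points W''" "refines W' W" "refines W'' W'"
  shows loop_restrict_loop_restrict: "loop_restrict W' W'' (loop_restrict W W' \<Psi>) = loop_restrict W W'' \<Psi>"
    and loop_arrow_restrict_loop_arrow_restrict:
      "loop_arrow_restrict W' W'' (loop_arrow_restrict W W' a) = loop_arrow_restrict W W'' a"
proof -
  have "refinement_obj W \<circ> refinement_obj W' = refinement_obj W" "refinement_arr W \<circ> refinement_arr W' = refinement_arr W"
    using canonical_index_canonical_index[OF W(1,2,4)]
    by (auto simp: refinement_obj_def refinement_arr_def fun_eq_iff)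
  then show "loop_restrict W' W'' (loop_restrict W W' \<Psi>) = loop_restrict W W'' \<Psi>"
    "loop_arrow_restrict W' W'' (loop_arrow_restrict W W' a) = loop_arrow_restrict W W'' a"
    using maps_circle_refinement[OF W(2,3,5)]
    by (simp_all add: loop_restrict_eq_pullback pullback_pullback_loop pullback_pullback_loop_arrow)
qed

text \<open>Translation commutes with the floor function of the base points
  (\<open>canonical_index_shift_cover\<close>). Rotation is therefore compatible with the transition
  maps of the colimit.\<close>

lemma
  assumes W: "circle_points W" "circle_points W'" "refines W' W"
  shows rotate_loop_restrict: "rotate_loop z W' (loop_restrict W W' \<Psi>) =
      loop_restrict (shift_cover z W) (shift_cover z W') (rotate_loop z W \<Psi>)"
    and rotate_loop_arrow_restrict: "rotate_loop_arrow z W' (loop_arrow_restrict W W' a) =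
      loop_arrow_restrict (shift_cover z W) (shift_cover z W') (rotate_loop_arrow z W a)"
proof -
  have "refinement_obj W \<circ> fst (rotation_morphism z) = fst (rotation_morphism z) \<circ> refinement_obj (shift_cover z W)"
    "refinement_arr W \<circ> snd (rotation_morphism z) = snd (rotation_morphism z) \<circ> refinement_arr (shift_cover z W)"
    using canonical_index_shift_cover[OF W(1), of z]
    by (auto simp: refinement_obj_def refinement_arr_def rotation_morphism_def fun_eq_iff)
  then show "rotate_loop z W' (loop_restrict W W' \<Psi>) =
      loop_restrict (shift_cover z W) (shift_cover z W') (rotate_loop z W \<Psi>)"
    "rotate_loop_arrow z W' (loop_arrow_restrict W W' a) =
      loop_arrow_restrict (shift_cover z W) (shift_cover z W') (rotate_loop_arrow z W a)"
    using maps_circle_rotation[OF W(2), of z] maps_circle_refinement[of "shift_cover z W" "shift_cover z W'"]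
      circle_points_shift_cover[OF W(1)] circle_points_shift_cover[OF W(2)] refines_shift_cover[OF W(3)]
    by (simp_all add: loop_restrict_eq_pullback rotate_loop_eq_pullback pullback_pullback_loop pullback_pullback_loop_arrow)
qed

lemma
  assumes W: "circle_points W"
  shows rotate_loop_inverse: "\<Psi> \<in> topspace (loop_space G W) \<Longrightarrow>
      rotate_loop (- z) (shift_cover z W) (rotate_loop z W \<Psi>) = \<Psi>"
    and rotate_loop_arrow_inverse: "a \<in> loop_arrows G W \<Longrightarrow>
      rotate_loop_arrow (- z) (shift_cover z W) (rotate_loop_arrow z W a) = a"
proof -
  have maps: "maps_circle W (shift_cover z W) (rotation_morphism (- z))"
    using maps_circle_rotation[OF circle_points_shift_cover[OF W], of "- z" z]
    by (simp add: shift_cover_shift_cover[OF W])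
  have "fst (rotation_morphism z) \<circ> fst (rotation_morphism (- z)) = id"
    "snd (rotation_morphism z) \<circ> snd (rotation_morphism (- z)) = id"
    by (auto simp: rotation_morphism_def)
  then show "\<Psi> \<in> topspace (loop_space G W) \<Longrightarrow> rotate_loop (- z) (shift_cover z W) (rotate_loop z W \<Psi>) = \<Psi>"
    "a \<in> loop_arrows G W \<Longrightarrow> rotate_loop_arrow (- z) (shift_cover z W) (rotate_loop_arrow z W a) = a"
    by (simp_all add: rotate_loop_eq_pullback shift_cover_shift_cover[OF W] pullback_pullback_loop[OF maps]
        pullback_pullback_loop_arrow[OF maps] pullback_loop_id pullback_loop_arrow_id)
qed

section \<open>Stable classes in a directed colimit\<close>

locale directed_system =
  fixes I :: "'i set" and le :: "'i \<Rightarrow> 'i \<Rightarrow> bool"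
    and X :: "'i \<Rightarrow> 'x topology" and \<tau> :: "'i \<Rightarrow> 'i \<Rightarrow> 'x \<Rightarrow> 'x"
  assumes le_trans: "\<lbrakk>i \<in> I; j \<in> I; k \<in> I; le i j; le j k\<rbrakk> \<Longrightarrow> le i k"
    and directed: "\<lbrakk>i \<in> I; j \<in> I\<rbrakk> \<Longrightarrow> \<exists>k\<in>I. le i k \<and> le j k"
    and transition: "\<lbrakk>i \<in> I; j \<in> I; k \<in> I; le i j; le j k; x \<in> topspace (X i)\<rbrakk>
      \<Longrightarrow> \<tau> j k (\<tau> i j x) = \<tau> i k x"
begin

text \<open>A point given at every stage at once. Constant loops are of this kind, because they make
  sense on every cover.\<close>

definition compatible_family :: "('i \<Rightarrow> 'x) \<Rightarrow> bool" where
  "compatible_family s \<longleftrightarrow>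
     (\<forall>i\<in>I. s i \<in> topspace (X i)) \<and> (\<forall>i\<in>I. \<forall>k\<in>I. le i k \<longrightarrow> \<tau> i k (s i) = s k)"

text \<open>The common colimit class of all \<open>s i\<close>, described without a preferred stage;
  this suits rotations, which move the stages around.\<close>

definition stable_class :: "('i \<Rightarrow> 'x) \<Rightarrow> ('i \<times> 'x) set" where
  "stable_class s = {(i, x). i \<in> I \<and> x \<in> topspace (X i) \<and> (\<exists>k\<in>I. le i k \<and> \<tau> i k x = s k)}"

lemma stable_class_mem:
  assumes "compatible_family s" "i \<in> I"
  shows "(i, s i) \<in> stable_class s"
  using assms directed[of i i] by (auto simp: stable_class_def compatible_family_def)

lemma stable_later:
  assumes "compatible_family s" "i \<in> I" "x \<in> topspace (X i)" "k \<in> I" "le i k" "\<tau> i k x = s k"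
    "n \<in> I" "le k n"
  shows "\<tau> i n x = s n"
  using transition[of i k n x] assms by (auto simp: compatible_family_def)

lemma colim_class_self:
  "i \<in> I \<Longrightarrow> x \<in> topspace (X i) \<Longrightarrow> (i, x) \<in> colim_class I le X \<tau> (i, x)"
  using directed[of i i] by (auto simp: colim_class_def colim_rel_def)

lemma colim_class_eq_stable_class:
  assumes s: "compatible_family s" and ix: "(i, x) \<in> stable_class s"
  shows "colim_class I le X \<tau> (i, x) = stable_class s"
proof (intro subset_antisym subrelI)
  have i: "i \<in> I" "x \<in> topspace (X i)" using ix by (auto simp: stable_class_def)
  obtain m where m: "m \<in> I" "le i m" "\<tau> i m x = s m" using ix by (auto simp: stable_class_def)
  fix j y
  {
    assume "(j, y) \<in> colim_class I le X \<tau> (i, x)"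
    then obtain k where k: "j \<in> I" "y \<in> topspace (X j)" "k \<in> I" "le i k" "le j k" "\<tau> i k x = \<tau> j k y"
      by (auto simp: colim_class_def colim_rel_def)
    obtain n where n: "n \<in> I" "le k n" "le m n" using directed[OF k(3) m(1)] by blast
    have "\<tau> j n y = \<tau> k n (\<tau> j k y)" using transition[of j k n y] k n by simp
    also have "\<dots> = \<tau> i n x" using transition[of i k n x] i k n by simp
    also have "\<dots> = s n" using stable_later[OF s i m(1,2,3) n(1,3)] .
    finally show "(j, y) \<in> stable_class s"
      using k n le_trans[of j k n] by (auto simp: stable_class_def)
  next
    assume "(j, y) \<in> stable_class s"
    then obtain k where k: "j \<in> I" "y \<in> topspace (X j)" "k \<in> I" "le j k" "\<tau> j k y = s k"
      by (auto simp: stable_class_def)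
    obtain n where n: "n \<in> I" "le k n" "le m n" using directed[OF k(3) m(1)] by blast
    have "\<tau> i n x = \<tau> j n y"
      using stable_later[OF s i m(1,2,3) n(1,3)] stable_later[OF s k n(1,2)] by simp
    then show "(j, y) \<in> colim_class I le X \<tau> (i, x)"
      using i k m n le_trans[of j k n] le_trans[of i m n] by (auto simp: colim_class_def colim_rel_def)
  }
qed

text \<open>Rotation carries the class into itself because it respects both the transitions and the
  family \<open>s\<close>. Since this holds for \<open>- z\<close> too, which undoes
  \<open>z\<close>, the inclusion is an equality.\<close>

lemma rotation_stable_class:
  fixes \<sigma> :: "real \<Rightarrow> 'i \<Rightarrow> 'i" and \<rho> :: "real \<Rightarrow> 'i \<Rightarrow> 'x \<Rightarrow> 'x"
  assumes \<sigma>: "\<And>z i. i \<in> I \<Longrightarrow> \<sigma> z i \<in> I" "\<And>z i. i \<in> I \<Longrightarrow> \<sigma> (- z) (\<sigma> z i) = i"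
    "\<And>z i k. le i k \<Longrightarrow> le (\<sigma> z i) (\<sigma> z k)"
    and \<rho>: "\<And>z i x. i \<in> I \<Longrightarrow> x \<in> topspace (X i) \<Longrightarrow> \<rho> z i x \<in> topspace (X (\<sigma> z i))"
    "\<And>z i x. i \<in> I \<Longrightarrow> x \<in> topspace (X i) \<Longrightarrow> \<rho> (- z) (\<sigma> z i) (\<rho> z i x) = x"
    "\<And>z i k x. i \<in> I \<Longrightarrow> k \<in> I \<Longrightarrow> le i k \<Longrightarrow> \<rho> z k (\<tau> i k x) = \<tau> (\<sigma> z i) (\<sigma> z k) (\<rho> z i x)"
    "\<And>z k. k \<in> I \<Longrightarrow> \<rho> z k (s k) = s (\<sigma> z k)"
  shows "(\<lambda>(i, x). (\<sigma> z i, \<rho> z i x)) ` stable_class s = stable_class s"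
proof -
  have sub: "(\<sigma> z i, \<rho> z i x) \<in> stable_class s" if "(i, x) \<in> stable_class s" for z i x
  proof -
    obtain k where k: "i \<in> I" "x \<in> topspace (X i)" "k \<in> I" "le i k" "\<tau> i k x = s k"
      using \<open>(i, x) \<in> stable_class s\<close> by (auto simp: stable_class_def)
    then have "\<tau> (\<sigma> z i) (\<sigma> z k) (\<rho> z i x) = s (\<sigma> z k)" using \<rho>(3)[of i k z x] \<rho>(4)[of k z] by simp
    moreover have "\<sigma> z k \<in> I" "le (\<sigma> z i) (\<sigma> z k)" using k \<sigma>(1,3) by simp_all
    moreover have "\<sigma> z i \<in> I" "\<rho> z i x \<in> topspace (X (\<sigma> z i))" using k(1,2) \<sigma>(1) \<rho>(1) by simp_all
    ultimately show ?thesis unfolding stable_class_def by blast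
  qed
  have "(i, x) \<in> (\<lambda>(i, x). (\<sigma> z i, \<rho> z i x)) ` stable_class s" if ix: "(i, x) \<in> stable_class s" for i x
  proof (rule image_eqI)
    show "(\<sigma> (- z) i, \<rho> (- z) i x) \<in> stable_class s" by (rule sub[OF ix])
    show "(i, x) = (\<lambda>(i, x). (\<sigma> z i, \<rho> z i x)) (\<sigma> (- z) i, \<rho> (- z) i x)"
      using ix \<sigma>(2)[of i "- z"] \<rho>(2)[of i x "- z"] by (auto simp: stable_class_def)
  qed
  with sub show ?thesis by auto
qed

text \<open>A fixed class contains the rotate of each of its representatives, and two
  representatives agree at some common later stage, which depends on the rotation.\<close>

lemma rotation_fixed_colim_class:
  assumes "i \<in> I" "x \<in> topspace (X i)"
    and "(\<lambda>(i, x). (\<sigma> i, \<rho> i x)) ` colim_class I le X \<tau> (i, x) = colim_class I le X \<tau> (i, x)"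
  shows "\<exists>k\<in>I. le i k \<and> le (\<sigma> i) k \<and> \<tau> i k x = \<tau> (\<sigma> i) k (\<rho> i x)"
proof -
  have "(\<sigma> i, \<rho> i x) \<in> (\<lambda>(i, x). (\<sigma> i, \<rho> i x)) ` colim_class I le X \<tau> (i, x)"
    using colim_class_self[OF assms(1,2)] by force
  then have "(\<sigma> i, \<rho> i x) \<in> colim_class I le X \<tau> (i, x)" by (simp only: assms(3))
  then show ?thesis by (auto simp: colim_class_def colim_rel_def)
qed

lemma topspace_colim_Collect:
  assumes s: "\<And>t. t \<in> T \<Longrightarrow> compatible_family (s t)" "\<And>t. t \<in> T \<Longrightarrow> R (stable_class (s t))"
    and R: "\<And>i x. i \<in> I \<Longrightarrow> x \<in> topspace (X i) \<Longrightarrow> R (colim_class I le X \<tau> (i, x)) \<Longrightarrow>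
      \<exists>t\<in>T. (i, x) \<in> stable_class (s t)"
    and m: "m \<in> I"
  shows "topspace (colim_topology I le X \<tau>) \<inter> {c. R c} = (\<lambda>t. stable_class (s t)) ` T"
proof (intro subset_antisym subsetI)
  fix c assume "c \<in> topspace (colim_topology I le X \<tau>) \<inter> {c. R c}"
  then obtain i x where "i \<in> I" "x \<in> topspace (X i)" "c = colim_class I le X \<tau> (i, x)" "R c"
    by (auto simp: colim_topology_def topspace_quotient_topology)
  with R[of i x] colim_class_eq_stable_class s(1) show "c \<in> (\<lambda>t. stable_class (s t)) ` T" by blast
next
  fix c assume "c \<in> (\<lambda>t. stable_class (s t)) ` T"
  then obtain t where t: "t \<in> T" "c = stable_class (s t)" by blast
  have "c = colim_class I le X \<tau> (m, s t m)"
    using colim_class_eq_stable_class[OF s(1) stable_class_mem[OF s(1) m]] t by simp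
  moreover have "(m, s t m) \<in> topspace (sum_topology X I)"
    using s(1)[OF t(1)] m by (simp add: compatible_family_def)
  ultimately show "c \<in> topspace (colim_topology I le X \<tau>) \<inter> {c. R c}"
    using s(2)[OF t(1)] t(2) by (simp add: colim_topology_def topspace_quotient_topology)
qed

text \<open>The maps \<open>e i\<close> are compatible with the transitions and so descend to a
  continuous map on the whole colimit, whose restriction to \<open>F\<close> is the inverse; open
  sets of \<open>F\<close> are never analysed. Off \<open>F\<close> the values lie only in
  \<open>Y\<close>, and assumption \<open>T\<close> says that maps into \<open>T\<close> may be
  tested there.\<close>

lemma homeomorphic_map_stable_class:
  assumes s: "\<And>t. t \<in> topspace T \<Longrightarrow> compatible_family (s t)"
    and m: "m \<in> I" "continuous_map T (X m) (\<lambda>t. s t m)"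
    and T: "\<And>Z f. continuous_map Z Y f \<Longrightarrow> f ` topspace Z \<subseteq> topspace T \<Longrightarrow> continuous_map (Z :: ('i \<times> 'x) set topology) T f"
    and e: "\<And>i. i \<in> I \<Longrightarrow> continuous_map (X i) Y (e i)"
    and e_\<tau>: "\<And>i k x. i \<in> I \<Longrightarrow> k \<in> I \<Longrightarrow> le i k \<Longrightarrow> x \<in> topspace (X i) \<Longrightarrow> e k (\<tau> i k x) = e i x"
    and e_s: "\<And>t i. t \<in> topspace T \<Longrightarrow> i \<in> I \<Longrightarrow> e i (s t i) = t"
    and fixed: "topspace (colim_topology I le X \<tau>) \<inter> F = (\<lambda>t. stable_class (s t)) ` topspace T"
  shows "homeomorphic_map T (subtopology (colim_topology I le X \<tau>) F) (\<lambda>t. stable_class (s t))"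
proof -
  let ?C = "colim_topology I le X \<tau>" and ?S = "sum_topology X I"
  \<comment> \<open>An arbitrary representative is chosen; by \<open>e_\<tau>\<close> the value does
    not depend on it.\<close>
  define ev where "ev c = (case (SOME p. p \<in> c) of (i, x) \<Rightarrow> e i x)" for c
  have q: "quotient_map ?S ?C (colim_class I le X \<tau>)"
    unfolding colim_topology_def by (rule quotient_map_quotient_topology)
  have ev: "ev (colim_class I le X \<tau> (i, x)) = e i x" if ix: "i \<in> I" "x \<in> topspace (X i)" for i x
  proof -
    obtain j y where jy: "(SOME p. p \<in> colim_class I le X \<tau> (i, x)) = (j, y)" by fastforce
    then have "(j, y) \<in> colim_class I le X \<tau> (i, x)"
      using someI[of "\<lambda>p. p \<in> colim_class I le X \<tau> (i, x)", OF colim_class_self[OF ix]] by simp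
    then obtain k where "j \<in> I" "y \<in> topspace (X j)" "k \<in> I" "le i k" "le j k" "\<tau> i k x = \<tau> j k y"
      by (auto simp: colim_class_def colim_rel_def)
    then show ?thesis using e_\<tau>[of i k x] e_\<tau>[of j k y] ix by (simp add: ev_def jy)
  qed
  have "continuous_map ?S Y (ev \<circ> colim_class I le X \<tau>)"
  proof (rule continuous_map_from_sum)
    fix i assume "i \<in> I"
    then show "continuous_map (X i) Y (\<lambda>x. (ev \<circ> colim_class I le X \<tau>) (i, x))"
      by (intro continuous_map_eq[OF e]) (simp_all add: ev)
  qed
  then have evC: "continuous_map ?C Y ev"
    by (rule continuous_compose_quotient_map[OF q])
  have stable: "stable_class (s t) = colim_class I le X \<tau> (i, s t i)" if "t \<in> topspace T" "i \<in> I" for t i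
    using colim_class_eq_stable_class[OF s[OF that(1)] stable_class_mem[OF s[OF that(1)] that(2)]] by simp
  have ev_stable: "ev (stable_class (s t)) = t" if "t \<in> topspace T" for t
    using stable[OF that m(1)] ev[OF m(1), of "s t m"] s[OF that] m(1) e_s[OF that m(1)]
    by (simp add: compatible_family_def)
  have "continuous_map (X m) ?S (Pair m)"
    by (rule continuous_map_component_injection[OF m(1)])
  from continuous_map_compose[OF continuous_map_compose[OF m(2) this] quotient_imp_continuous_map[OF q]]
  \<comment> \<open>Every class meets stage \<open>m\<close>, so the map factors through that stage
    and the quotient map.\<close>
  have cont: "continuous_map T ?C (\<lambda>t. stable_class (s t))"
    by (rule continuous_map_eq) (simp add: stable[OF _ m(1)])
  have top: "topspace (subtopology ?C F) = (\<lambda>t. stable_class (s t)) ` topspace T"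
    using fixed by simp
  have "homeomorphic_maps T (subtopology ?C F) (\<lambda>t. stable_class (s t)) ev"
    unfolding homeomorphic_maps_def
  proof (intro conjI ballI)
    show "continuous_map T (subtopology ?C F) (\<lambda>t. stable_class (s t))"
      using cont fixed by (auto simp: continuous_map_in_subtopology)
    show "continuous_map (subtopology ?C F) T ev"
      by (rule T) (use top ev_stable in \<open>auto intro: continuous_map_from_subtopology[OF evC]\<close>)
  next
    fix y assume "y \<in> topspace (subtopology ?C F)"
    then obtain t where "t \<in> topspace T" "y = stable_class (s t)" unfolding top by blast
    then show "stable_class (s (ev y)) = y" by (simp add: ev_stable)
  qed (rule ev_stable)
  then show ?thesis by (auto simp: homeomorphic_map_maps)
qed

end

section \<open>Constant loops\<close>

definition const_loop :: "('o, 'a) groupoid \<Rightarrow> circle_cover \<Rightarrow> 'a \<Rightarrow> ('o, 'a) loop" where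
  "const_loop G W v = (restrict (\<lambda>_. src G v) (circle_objects W),
     restrict (\<lambda>r. gpow G v (snd r)) (circle_arrows W))"

definition const_loop_arrow :: "('o, 'a) groupoid \<Rightarrow> circle_cover \<Rightarrow> 'a \<times> 'a \<Rightarrow> ('o, 'a) loop_arrow" where
  "const_loop_arrow G W p = (const_loop G W (fst p), const_loop G W (tgt (inertia_groupoid G) p),
     restrict (\<lambda>r. mult G (gpow G (fst p) (snd r)) (snd p)) (circle_arrows W))"

lemma snd_refinement_arr [simp]: "snd (refinement_arr W r) = snd r"
  by (simp add: refinement_arr_def split: prod.splits)

text \<open>Constant loops and arrows read only the integer \<open>l\<close>, which refinement
  leaves unchanged; the same holds for rotation in the next lemma.\<close>

lemma
  assumes "circle_points W" "circle_points W'" "refines W' W"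
  shows loop_restrict_const: "loop_restrict W W' (const_loop G W v) = const_loop G W' v"
    and loop_arrow_restrict_const: "loop_arrow_restrict W W' (const_loop_arrow G W p) = const_loop_arrow G W' p"
  using refinement_obj_in[OF assms] refinement_arr_in[OF assms]
  by (auto simp: loop_restrict_def loop_arrow_restrict_def const_loop_def const_loop_arrow_def fun_eq_iff
      restrict_def simp del: mem_circle_arr mem_circle_obj)

lemma
  assumes W: "circle_points W"
  shows rotate_loop_const: "rotate_loop z W (const_loop G W v) = const_loop G (shift_cover z W) v"
    and rotate_loop_arrow_const: "rotate_loop_arrow z W (const_loop_arrow G W p) = const_loop_arrow G (shift_cover z W) p"
proof -
  show *: "rotate_loop z W (const_loop G W v) = const_loop G (shift_cover z W) v" for v
    by (auto simp: rotate_loop_def const_loop_def fun_eq_iff restrict_def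
        base_points_shift_cover cover_interval_shift_cover[OF W])
  show "rotate_loop_arrow z W (const_loop_arrow G W p) = const_loop_arrow G (shift_cover z W) p"
    by (auto simp: rotate_loop_arrow_def const_loop_arrow_def * fun_eq_iff restrict_def
        base_points_shift_cover cover_interval_shift_cover[OF W])
qed

context topological_groupoid
begin

abbreviation inertia_objects :: "'a set" where
  "inertia_objects \<equiv> topspace (Obj (inertia_groupoid G))"

abbreviation inertia_arrows :: "('a \<times> 'a) set" where
  "inertia_arrows \<equiv> topspace (Arr (inertia_groupoid G))"

lemma inertia_arrD:
  assumes "p \<in> inertia_arrows"
  shows "fst p \<in> topspace (Arr G)" "tgt G (fst p) = src G (fst p)" "snd p \<in> topspace (Arr G)"
    "src G (snd p) = src G (fst p)" "tgt (inertia_groupoid G) p \<in> topspace (Arr G)"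
    "src G (tgt (inertia_groupoid G) p) = tgt G (snd p)" "tgt G (tgt (inertia_groupoid G) p) = tgt G (snd p)"
  using assms by (auto simp: topspace_inertia_groupoid groupoid_simps)

lemma inertia_objD:
  assumes "v \<in> inertia_objects"
  shows "v \<in> topspace (Arr G)" "tgt G v = src G v"
  using assms by (auto simp: topspace_inertia_groupoid)

lemma const_loop_in:
  assumes W: "circle_points W" and v: "v \<in> inertia_objects"
  shows "const_loop G W v \<in> topspace (loop_space G W)"
proof -
  note v' = inertia_objD[OF v]
  have "groupoid_morphism (circle_groupoid W) G (\<lambda>_. src G v, \<lambda>r. gpow G v (snd r))"
    unfolding groupoid_morphism_def
    using v' by (auto simp: gpow_add gpow_minus intro!: continuous_map_from_circle_arr)
  from groupoid_morphism_restrict[OF W this] show ?thesis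
    by (simp add: mem_loop_space const_loop_def)
qed

text \<open>Naturality is \<open>gpow_conj\<close>. The same identity turns the form delivered by
  \<open>loop_arrowsI\<close>, with the power of the target loop on the right, into the form used in
  \<open>const_loop_arrow\<close>.\<close>

lemma const_loop_arrow_in:
  assumes W: "circle_points W" and p: "p \<in> inertia_arrows"
  shows "const_loop_arrow G W p \<in> loop_arrows G W"
proof -
  let ?S = "circle_groupoid W" and ?w = "tgt (inertia_groupoid G) p"
  note p' = inertia_arrD[OF p]
  interpret H: topological_groupoid "inertia_groupoid G" by (rule topological_groupoid_inertia)
  have conj: "mult G (gpow G (fst p) l) (snd p) = mult G (snd p) (gpow G ?w l)" for l
    using gpow_conj[OF p'(1,2,3,4)] by simp
  note S = circle_src_in[OF W] circle_tgt_in[OF W]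
  have "(const_loop G W (fst p), const_loop G W ?w,
      restrict (\<lambda>r. mult G (snd p) (snd (const_loop G W ?w) r)) (topspace (Arr ?S))) \<in> loop_arrows G W"
    using const_loop_in[OF W H.src_in[OF p]] const_loop_in[OF W H.tgt_in[OF p]] p' S conj
    by (intro loop_arrowsI[OF W, where \<kappa> = "\<lambda>_. snd p"])
      (simp_all add: const_loop_def del: mem_circle_obj mem_circle_arr inertia_groupoid_projections(2))
  moreover have "restrict (\<lambda>r. mult G (snd p) (snd (const_loop G W ?w) r)) (topspace (Arr ?S)) =
      restrict (\<lambda>r. mult G (gpow G (fst p) (snd r)) (snd p)) (topspace (Arr ?S))"
    by (rule restrict_ext) (simp add: const_loop_def conj del: mem_circle_arr inertia_groupoid_projections)
  ultimately show ?thesis by (simp only: const_loop_arrow_def)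
qed

lemma continuous_const_loop:
  assumes W: "circle_points W"
  shows "continuous_map (Obj (inertia_groupoid G)) (loop_space G W) (const_loop G W)"
proof -
  let ?H = "inertia_groupoid G" and ?S = "circle_groupoid W"
  have id0: "continuous_map (Obj ?H) (Arr G) (\<lambda>v. v)"
    by (simp add: inertia_groupoid_def continuous_map_from_subtopology)
  have mem: "fst (const_loop G W v) \<in> continuous_maps (Obj ?S) (Obj G)"
    "snd (const_loop G W v) \<in> continuous_maps (Arr ?S) (Arr G)" "groupoid_morphism ?S G (const_loop G W v)"
    if "v \<in> topspace (Obj ?H)" for v
    using const_loop_in[OF W that]
    by (auto simp: loop_space_def Let_def topspace_compact_open_topology mem_Times_iff)
  have "continuous_map (Obj ?H) (compact_open_topology (Obj ?S) (Obj G)) (\<lambda>v. fst (const_loop G W v))"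
    by (rule continuous_map_into_compact_open[where d = "\<lambda>_. ()" and h = "\<lambda>_. src G"])
      (use mem continuous_map_src[OF id0] in \<open>auto simp: const_loop_def simp del: mem_circle_obj\<close>)
  moreover have "continuous_map (Obj ?H) (compact_open_topology (Arr ?S) (Arr G)) (\<lambda>v. snd (const_loop G W v))"
  proof (rule continuous_map_into_compact_open[where d = snd and h = "\<lambda>l v. gpow G v l"])
    show "continuous_map (Obj ?H) (Arr G) (\<lambda>v. gpow G v (snd r))" for r :: s1_arr
      using continuous_map_gpow[OF id0] inertia_objD by blast
  qed (use mem finite_snd_compactin_circle_arr in \<open>auto simp: const_loop_def simp del: mem_circle_arr\<close>)
  ultimately show ?thesis
    using mem by (auto simp: loop_space_def Let_def continuous_map_in_subtopology continuous_map_pairwise o_def)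
qed

lemma continuous_const_loop_arrow:
  assumes W: "circle_points W"
  shows "continuous_map (Arr (inertia_groupoid G)) (loop_arrow_space G W) (const_loop_arrow G W)"
proof -
  let ?H = "inertia_groupoid G" and ?S = "circle_groupoid W"
  let ?f = "\<lambda>(\<Psi> :: ('o, 'a) loop, \<Phi> :: ('o, 'a) loop, \<Lambda> :: s1_arr \<Rightarrow> 'a).
    (snd \<Psi>, restrict (\<lambda>x. \<Lambda> (ident ?S x)) (topspace (Obj ?S)))"
  have mem: "?f (const_loop_arrow G W p) \<in> continuous_maps (Arr ?S) (Arr G) \<times> continuous_maps (Obj ?S) (Arr G)"
    if "p \<in> topspace (Arr ?H)" for p
  proof -
    have "const_loop_arrow G W p \<in> topspace (loop_arrow_space G W)"
      using const_loop_arrow_in[OF W that] by (simp add: topspace_loop_arrow_space)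
    then show ?thesis
      by (auto simp: loop_arrow_space_def Let_def topspace_pullback_topology topspace_compact_open_topology)
  qed
  have "continuous_map (Arr ?H) (compact_open_topology (Arr ?S) (Arr G)) (\<lambda>p. fst (?f (const_loop_arrow G W p)))"
  proof (rule continuous_map_into_compact_open[where d = snd and h = "\<lambda>l p. gpow G (fst p) l"])
    show "continuous_map (Arr ?H) (Arr G) (\<lambda>p. gpow G (fst p) (snd r))" for r :: s1_arr
      using continuous_map_inertia_arr_fst inertia_arrD by (intro continuous_map_gpow) auto
    show "fst (?f (const_loop_arrow G W p)) \<in> continuous_maps (Arr ?S) (Arr G)" if "p \<in> topspace (Arr ?H)" for p
      using mem[OF that] by auto
  qed (use finite_snd_compactin_circle_arr in
      \<open>auto simp: const_loop_arrow_def const_loop_def simp del: mem_circle_arr\<close>)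
  moreover have "continuous_map (Arr ?H) (compact_open_topology (Obj ?S) (Arr G)) (\<lambda>p. snd (?f (const_loop_arrow G W p)))"
  \<comment> \<open>On identities the integer is 0, so the value is the zeroth power of the loop
    times \<alpha>, the same for all objects; one label suffices.\<close>
  proof (rule continuous_map_into_compact_open[where d = "\<lambda>_. ()" and h = "\<lambda>_ p. mult G (ident G (src G (fst p))) (snd p)"])
    have "continuous_map (Arr ?H) (Arr G) (\<lambda>p. fst p)" "continuous_map (Arr ?H) (Arr G) (\<lambda>p. snd p)"
      using continuous_map_inertia_arr_fst continuous_map_inertia_arr_snd by auto
    then show "continuous_map (Arr ?H) (Arr G) (\<lambda>p. mult G (ident G (src G (fst p))) (snd p))"
      by (intro continuous_map_mult continuous_map_ident continuous_map_src)
        (auto simp: inertia_arrD groupoid_simps)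
    show "snd (?f (const_loop_arrow G W p)) \<in> continuous_maps (Obj ?S) (Arr G)" if "p \<in> topspace (Arr ?H)" for p
      using mem[OF that] by auto
    show "snd (?f (const_loop_arrow G W p)) x = mult G (ident G (src G (fst p))) (snd p)"
      if "x \<in> topspace (Obj ?S)" for p x
      using that circle_ident_in[OF that]
      by (cases x) (simp add: const_loop_arrow_def)
  qed auto
  ultimately have "continuous_map (Arr ?H)
      (prod_topology (compact_open_topology (Arr ?S) (Arr G)) (compact_open_topology (Obj ?S) (Arr G)))
      (?f \<circ> const_loop_arrow G W)"
    by (simp add: continuous_map_pairwise o_def)
  then show ?thesis
    unfolding loop_arrow_space_def Let_def
    by (rule continuous_map_pullback') (use const_loop_arrow_in[OF W] in auto)
qed

section \<open>Loops fixed under rotation\<close>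

text \<open>Curried in \<open>l\<close>, the values on overlaps form a family to which
  \<open>rotation_invariant_imp_constant\<close> applies for all \<open>l\<close> at once.
  Afterwards only \<epsilon> shrinks, to fit below the resulting \<delta>. The value type is
  arbitrary so that several maps can be made constant on the same refinement.\<close>

lemma rotation_invariant_values_constant:
  fixes f :: "s1_arr \<Rightarrow> 'v"
  assumes W: "W \<in> admissible_covers"
    and inv: "\<And>z. \<exists>W''\<in>admissible_covers. refines W'' W \<and> refines W'' (shift_cover z W) \<and>
      (\<forall>r\<in>circle_arrows W''.
         f (refinement_arr W r) = f (snd (rotation_morphism z) (refinement_arr (shift_cover z W) r)))"
  obtains W' u where "W' \<in> admissible_covers" "refines W' W" "fst W' = fst W"
    "\<And>b c x l. (((b, c), x), l) \<in> circle_arrows W' \<Longrightarrow> f (((b, c), x), l) = u l"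
proof -
  note W' = admissible_circle_points[OF W]
  let ?F = "\<lambda>b c x l. f (((b, c), x), l)"
  have inv': "\<exists>W''. circle_points W'' \<and> 0 < snd W'' \<and> refines W'' W \<and> refines W'' (shift_cover z W) \<and>
      (\<forall>p\<in>base_points W''. \<forall>p'\<in>base_points W''. \<forall>x\<in>cover_interval W'' p \<inter> cover_interval W'' p'.
        ?F (canonical_index W p) (canonical_index W p') x =
        ?F (canonical_index (shift_cover z W) p - z) (canonical_index (shift_cover z W) p' - z) (x - z))" for z
  proof -
    obtain W'' where W'': "W'' \<in> admissible_covers" "refines W'' W" "refines W'' (shift_cover z W)"
      and eq: "\<And>r. r \<in> circle_arrows W'' \<Longrightarrow>
         f (refinement_arr W r) = f (snd (rotation_morphism z) (refinement_arr (shift_cover z W) r))"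
      using inv[of z] by blast
    have "?F (canonical_index W p) (canonical_index W p') x =
        ?F (canonical_index (shift_cover z W) p - z) (canonical_index (shift_cover z W) p' - z) (x - z)"
      if "p \<in> base_points W''" "p' \<in> base_points W''" "x \<in> cover_interval W'' p \<inter> cover_interval W'' p'" for p p' x
    proof
      fix l
      show "?F (canonical_index W p) (canonical_index W p') x l =
        ?F (canonical_index (shift_cover z W) p - z) (canonical_index (shift_cover z W) p' - z) (x - z) l"
        using eq[of "(((p, p'), x), l)"] that by (simp add: refinement_arr_def rotation_morphism_def)
    qed
    with W'' admissible_circle_points admissible_pos show ?thesis by blast
  qed
  obtain u \<delta> where \<delta>: "0 < \<delta>"
    and u: "\<And>b c x. b \<in> base_points W \<Longrightarrow> c \<in> base_points W \<Longrightarrow> b - \<delta> < x \<Longrightarrow> x < next_point W b + \<delta> \<Longrightarrow>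
       c - \<delta> < x \<Longrightarrow> x < next_point W c + \<delta> \<Longrightarrow> ?F b c x = u"
    by (rule rotation_invariant_imp_constant[of W ?F, OF W' inv']) (rule that; assumption)
  have "0 < min \<delta> (snd W)" using \<delta> admissible_pos[OF W] by simp
  from admissible_refinement[OF W' this]
  obtain \<epsilon> where \<epsilon>: "0 < \<epsilon>" "\<epsilon> \<le> min \<delta> (snd W)" "(fst W, \<epsilon>) \<in> admissible_covers" .
  have base: "base_points (fst W, \<epsilon>) = base_points W" by (simp add: base_points_def)
  have next_eq: "next_point (fst W, \<epsilon>) x = next_point W x" for x by (simp add: next_point_def base)
  have "f (((b, c), x), l) = u l" if "(((b, c), x), l) \<in> circle_arrows (fst W, \<epsilon>)" for b c x l
  proof -
    have "?F b c x = u"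
      using that \<epsilon>(2) by (intro u) (auto simp: base mem_cover_interval next_eq)
    then show ?thesis by (rule fun_cong)
  qed
  with \<epsilon> show thesis by (intro that[of "(fst W, \<epsilon>)" u]) (auto simp: refines_def)
qed

text \<open>A base point is its own canonical index, so refining by \<epsilon> alone is an inclusion
  of circle groupoids.\<close>

lemma refinement_same_points:
  assumes "circle_points W'" "refines W' W" "fst W' = fst W"
  shows "p \<in> circle_objects W' \<Longrightarrow> refinement_obj W p = p \<and> p \<in> circle_objects W"
    and "r \<in> circle_arrows W' \<Longrightarrow> refinement_arr W r = r \<and> r \<in> circle_arrows W"
proof -
  have W: "circle_points W" using assms by (simp add: circle_points_def)
  have base: "base_points W' = base_points W" using assms by (simp add: base_points_def)
  show "refinement_obj W p = p \<and> p \<in> circle_objects W"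
    if p: "p \<in> circle_objects W'"
  proof -
    have "refinement_obj W p = p"
      using p by (cases p) (simp add: refinement_obj_def base canonical_index_base_point[OF W])
    then show ?thesis using refinement_obj_in[OF W assms(1,2) p] by simp
  qed
  show "refinement_arr W r = r \<and> r \<in> circle_arrows W"
    if r: "r \<in> circle_arrows W'"
  proof -
    have "refinement_arr W r = r"
      using r by (cases r rule: circle_arr_cases) (simp add: refinement_arr_def base canonical_index_base_point[OF W])
    then show ?thesis using refinement_arr_in[OF W assms(1,2) r] by simp
  qed
qed

text \<open>Composing arrows over a single base point and its integer translates shows that
  \<open>u\<close> satisfies the recurrence of powers, so \<open>u 1\<close> is the arrow
  sought.\<close>

lemma constant_values_imp_const_loop:
  assumes W: "W \<in> admissible_covers" and \<Psi>: "\<Psi> \<in> topspace (loop_space G W)"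
    and W': "W' \<in> admissible_covers" "refines W' W" "fst W' = fst W"
    and u: "\<And>b c x l. (((b, c), x), l) \<in> circle_arrows W' \<Longrightarrow> snd \<Psi> (((b, c), x), l) = u l"
  shows "u 1 \<in> inertia_objects" "\<And>l. u l = gpow G (u 1) l"
    "\<And>p. p \<in> circle_objects W' \<Longrightarrow> fst \<Psi> p = src G (u 1)"
    "loop_restrict W W' \<Psi> = const_loop G W' (u 1)"
proof -
  note Wp = admissible_circle_points[OF W] and Wp' = admissible_circle_points[OF W'(1)]
  have base: "base_points W' = base_points W" using W' by (simp add: base_points_def)
  obtain b where b: "b \<in> base_points W"
    using canonical_index_in[OF Wp] by blast
  have b': "b \<in> cover_interval W' b"
    using admissible_pos[OF W'(1)] next_point_gt[OF Wp', of b] by (simp add: mem_cover_interval)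
  have bW: "b \<in> cover_interval W b"
    using cover_interval_refines[OF Wp Wp' W'(2) b'] canonical_index_base_point[OF Wp b] by simp
  note \<Psi>D = loop_spaceD[OF \<Psi>]
  \<comment> \<open>An arrow with integer \<open>l\<close> over \<open>b\<close> ends over
    \<open>b + l\<close>; translates of \<open>b\<close> are included so that such arrows can be
    composed.\<close>
  have arr: "(((b + of_int k, b + of_int k), b + of_int k), l) \<in> circle_arrows W" for k l
    using b bW Wp by simp
  note eqs = \<Psi>D(3,5,6)[OF arr[of 0], simplified]
  have val: "snd \<Psi> (((b + of_int k, b + of_int k), b + of_int k), l) = u l" for k l
    using b b' by (intro u) (simp add: base Wp')
  have val0: "snd \<Psi> (((b, b), b), l) = u l" for l using val[of 0 l] by simp
  \<comment> \<open>The value at an object is the source of the value at its identity arrow, whose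
    integer is 0.\<close>
  have obj: "fst \<Psi> p = src G (u 0)" if p: "p \<in> circle_objects W'" for p
  proof -
    obtain c x where cx: "p = (c, x)" by fastforce
    have "(c, x) \<in> circle_objects W"
      using refinement_same_points(1)[OF Wp' W'(2,3) p] by (simp add: cx)
    then have "snd \<Psi> (((c, c), x), 0) = ident G (fst \<Psi> (c, x))" "fst \<Psi> (c, x) \<in> topspace (Obj G)"
      using \<Psi>D(4,7)[of "(c, x)"] by (simp_all del: mem_circle_obj)
    moreover have "snd \<Psi> (((c, c), x), 0) = u 0" using p by (intro u) (simp add: cx)
    ultimately show ?thesis using cx by (simp add: src_ident)
  qed
  have pt: "fst \<Psi> (b + of_int l, b + of_int l) = src G (u 0)" for l
    using b b' by (intro obj) (simp add: base Wp')
  have ul: "u l \<in> topspace (Arr G)" "src G (u l) = src G (u 0)" "tgt G (u l) = src G (u 0)" for l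
    using eqs(1,2,3)[of l] pt[of 0] pt[of l] by (simp_all add: val0)
  have u0: "u 0 = ident G (src G (u 0))"
    using \<Psi>D(7)[of "(b, b)"] b bW pt[of 0] by (simp add: val0)
  have u1: "u 1 \<in> topspace (Arr G)" "tgt G (u 1) = src G (u 1)" using ul[of 1] by simp_all
  then show "u 1 \<in> inertia_objects" by (simp add: topspace_inertia_groupoid)
  show pow: "u l = gpow G (u 1) l" for l
  proof (rule gpow_unique[OF u1])
    show "u 0 = ident G (src G (u 1))" using u0 ul(2)[of 1] by simp
    show "u (l + 1) = mult G (u l) (u 1)" for l
      using \<Psi>D(8)[OF arr[of 0 l] arr[of l 1]] val[of l 1] by (simp add: val0)
  qed (use ul ul(2)[of 1, symmetric] in simp_all)
  show obj1: "fst \<Psi> p = src G (u 1)" if "p \<in> circle_objects W'" for p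
    using obj[OF that] ul(2)[of 1] by simp
  have arr: "snd \<Psi> r = gpow G (u 1) (snd r)" if "r \<in> circle_arrows W'" for r
  proof -
    obtain b c x l where r: "r = (((b, c), x), l)" by (rule circle_arr_cases)
    have "snd \<Psi> r = u l" using u that unfolding r by blast
    also have "u l = gpow G (u 1) l" by (rule pow)
    finally show ?thesis by (simp add: r)
  qed
  show "loop_restrict W W' \<Psi> = const_loop G W' (u 1)"
    unfolding loop_restrict_def const_loop_def prod.inject
    using refinement_same_points[OF Wp' W'(2,3)] obj1 arr
    by (intro conjI restrict_ext) (simp_all del: mem_circle_arr mem_circle_obj)
qed

lemma loop_restrict_eq_rotate:
  assumes "loop_restrict W W'' \<Psi> = loop_restrict (shift_cover z W) W'' (rotate_loop z W \<Psi>)"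
    and W: "circle_points W" "circle_points W''" "refines W'' (shift_cover z W)"
    and r: "r \<in> circle_arrows W''"
  shows "snd \<Psi> (refinement_arr W r) = snd \<Psi> (snd (rotation_morphism z) (refinement_arr (shift_cover z W) r))"
proof -
  have "snd (loop_restrict W W'' \<Psi>) r = snd (loop_restrict (shift_cover z W) W'' (rotate_loop z W \<Psi>)) r"
    using assms by simp
  then show ?thesis
    using r refinement_arr_in[OF circle_points_shift_cover[OF W(1)] W(2,3) r]
    by (simp add: loop_restrict_def rotate_loop_eq_pullback pullback_loop_def del: mem_circle_arr)
qed

lemma rotation_fixed_loop:
  assumes W: "W \<in> admissible_covers" and \<Psi>: "\<Psi> \<in> topspace (loop_space G W)"
    and inv: "\<And>z. \<exists>W''\<in>admissible_covers. refines W'' W \<and> refines W'' (shift_cover z W) \<and>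
      loop_restrict W W'' \<Psi> = loop_restrict (shift_cover z W) W'' (rotate_loop z W \<Psi>)"
  shows "\<exists>v\<in>inertia_objects. \<exists>W'\<in>admissible_covers.
    refines W' W \<and> loop_restrict W W' \<Psi> = const_loop G W' v"
proof -
  have "\<exists>W''\<in>admissible_covers. refines W'' W \<and> refines W'' (shift_cover z W) \<and>
      (\<forall>r\<in>circle_arrows W''. snd \<Psi> (refinement_arr W r) =
        snd \<Psi> (snd (rotation_morphism z) (refinement_arr (shift_cover z W) r)))" for z
    using inv[of z] loop_restrict_eq_rotate[OF _ admissible_circle_points[OF W]] admissible_circle_points
    by metis
  from rotation_invariant_values_constant[of W "snd \<Psi>", OF W this]
  obtain W' u where W': "W' \<in> admissible_covers" "refines W' W" "fst W' = fst W"
    and u: "\<And>b c x l. (((b, c), x), l) \<in> circle_arrows W' \<Longrightarrow> snd \<Psi> (((b, c), x), l) = u l"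
    by blast
  from constant_values_imp_const_loop[OF W \<Psi> W' u] W' show ?thesis by blast
qed

text \<open>The constancy result is applied to the triple of \<Psi>, \<Phi> and \<Lambda>, so that
  all three become constant on the same cover.\<close>

lemma rotation_fixed_loop_arrow:
  assumes W: "W \<in> admissible_covers" and a: "a \<in> loop_arrows G W"
    and inv: "\<And>z. \<exists>W''\<in>admissible_covers. refines W'' W \<and> refines W'' (shift_cover z W) \<and>
      loop_arrow_restrict W W'' a = loop_arrow_restrict (shift_cover z W) W'' (rotate_loop_arrow z W a)"
  shows "\<exists>p\<in>inertia_arrows. \<exists>W'\<in>admissible_covers.
    refines W' W \<and> loop_arrow_restrict W W' a = const_loop_arrow G W' p"
proof -
  note Wp = admissible_circle_points[OF W]
  obtain \<Psi> \<Phi> \<Lambda> where a_eq: "a = (\<Psi>, \<Phi>, \<Lambda>)" by (metis surj_pair)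
  note L = a[unfolded a_eq]
  let ?f = "\<lambda>r. (snd \<Psi> r, snd \<Phi> r, \<Lambda> r)"
  have "\<exists>W''\<in>admissible_covers. refines W'' W \<and> refines W'' (shift_cover z W) \<and>
      (\<forall>r\<in>circle_arrows W''. ?f (refinement_arr W r) =
        ?f (snd (rotation_morphism z) (refinement_arr (shift_cover z W) r)))" for z
  proof -
    obtain W'' where W'': "W'' \<in> admissible_covers" "refines W'' W" "refines W'' (shift_cover z W)"
      and eq: "loop_arrow_restrict W W'' a = loop_arrow_restrict (shift_cover z W) W'' (rotate_loop_arrow z W a)"
      using inv[of z] by blast
    have eqs: "loop_restrict W W'' \<Psi> = loop_restrict (shift_cover z W) W'' (rotate_loop z W \<Psi>)"
      "loop_restrict W W'' \<Phi> = loop_restrict (shift_cover z W) W'' (rotate_loop z W \<Phi>)"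
      "restrict (\<Lambda> \<circ> refinement_arr W) (circle_arrows W'') =
       restrict (restrict (\<lambda>(((b, c), x), l). \<Lambda> (((b - z, c - z), x - z), l))
          (circle_arrows (shift_cover z W)) \<circ> refinement_arr (shift_cover z W))
         (circle_arrows W'')"
      using eq by (simp_all add: a_eq loop_arrow_restrict_def rotate_loop_arrow_def)
    have "\<Lambda> (refinement_arr W r) = \<Lambda> (snd (rotation_morphism z) (refinement_arr (shift_cover z W) r))"
      if r: "r \<in> circle_arrows W''" for r
      using fun_cong[OF eqs(3), of r] r
        refinement_arr_in[OF circle_points_shift_cover[OF Wp] admissible_circle_points[OF W''(1)] W''(3) r]
      by (simp add: rotation_morphism_def split_beta del: mem_circle_arr)
    moreover note loop_restrict_eq_rotate[OF eqs(1) Wp admissible_circle_points[OF W''(1)] W''(3)]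
      loop_restrict_eq_rotate[OF eqs(2) Wp admissible_circle_points[OF W''(1)] W''(3)]
    ultimately show ?thesis using W'' by blast
  qed
  from rotation_invariant_values_constant[of W ?f, OF W this]
  obtain W' t where W': "W' \<in> admissible_covers" "refines W' W" "fst W' = fst W"
    and t: "\<And>b c x l. (((b, c), x), l) \<in> circle_arrows W' \<Longrightarrow> ?f (((b, c), x), l) = t l"
    by blast
  note Wp' = admissible_circle_points[OF W'(1)]
  define u w h where "u l = fst (t l)" and "w l = fst (snd (t l))" and "h l = snd (snd (t l))" for l
  have u: "snd \<Psi> (((b, c), x), l) = u l" and w: "snd \<Phi> (((b, c), x), l) = w l" and h: "\<Lambda> (((b, c), x), l) = h l"
    if "(((b, c), x), l) \<in> circle_arrows W'" for b c x l
    unfolding u_def w_def h_def t[OF that, symmetric] by simp_all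
  have in_spaces: "\<Psi> \<in> topspace (loop_space G W)" "\<Phi> \<in> topspace (loop_space G W)"
    using L by (auto simp: loop_arrows_def Let_def)
  note cu = constant_values_imp_const_loop[OF W in_spaces(1) W' u]
  note cw = constant_values_imp_const_loop[OF W in_spaces(2) W' w]
  have base: "base_points W' = base_points W" using W' by (simp add: base_points_def)
  obtain b where b: "b \<in> base_points W'"
    using canonical_index_in[OF Wp'] by blast
  have bb: "b \<in> cover_interval W' b"
    using admissible_pos[OF W'(1)] next_point_gt[OF Wp', of b] by (simp add: mem_cover_interval)
  have r: "(((b + of_int k, b + of_int k), b + of_int k), l) \<in> circle_arrows W'" for k l
    using b bb Wp' by simp
  note r0 = r[of 0, simplified of_int_0 add_0_right]
  have arrW: "(((b, b), b), l) \<in> circle_arrows W" for l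
    using refinement_same_points(2)[OF Wp' W'(2,3) r0] by blast
  then have objW: "(b, b) \<in> circle_objects W" by simp
  note D = loop_arrowsD[OF Wp L]
  \<comment> \<open>The two defining equations of an arrow of loops, at the arrow with integer
    \<open>l\<close> over \<open>b\<close>.\<close>
  have arr_eq: "h l = mult G (u l) (h 0)" "h l = mult G (h 0) (w l)" for l
    using D(7,8)[OF arrW[of l]] h[OF r0, of l] h[OF r0, of 0] h[OF r, of l 0] u[OF r0, of l] w[OF r0, of l] by simp_all
  have h0: "h 0 \<in> topspace (Arr G)" "src G (h 0) = src G (u 1)" "tgt G (h 0) = src G (w 1)"
    using D(4-6)[OF objW] cu(3)[of "(b, b)"] cw(3)[of "(b, b)"] b bb h[OF r0, of 0] by simp_all
  have u1: "u 1 \<in> topspace (Arr G)" "tgt G (u 1) = src G (u 1)" and w1: "w 1 \<in> topspace (Arr G)"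
    using inertia_objD[OF cu(1)] inertia_objD[OF cw(1)] by simp_all
  let ?p = "(u 1, h 0)"
  have p: "?p \<in> inertia_arrows"
    using u1 h0 by (simp add: topspace_inertia_groupoid)
  \<comment> \<open>At \<open>l = 1\<close> the two equations say that \<open>u 1\<close> and
    \<open>w 1\<close> are conjugate by \<open>h 0\<close>.\<close>
  have "w 1 = mult G (ginv G (h 0)) (mult G (u 1) (h 0))"
    using mult_eq_imp_eq_ginv_mult[of "h 0" "w 1"] arr_eq(1,2)[of 1] h0 w1 by simp
  then have w_tgt: "w 1 = tgt (inertia_groupoid G) ?p" by simp
  have "restrict (\<Lambda> \<circ> refinement_arr W) (circle_arrows W') =
      restrict (\<lambda>r. mult G (gpow G (u 1) (snd r)) (h 0)) (circle_arrows W')"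
  proof (rule restrict_ext)
    fix r assume r: "r \<in> circle_arrows W'"
    have "\<Lambda> r = h (snd r)" using r h by (cases r rule: circle_arr_cases) auto
    then show "(\<Lambda> \<circ> refinement_arr W) r = mult G (gpow G (u 1) (snd r)) (h 0)"
      using refinement_same_points(2)[OF Wp' W'(2,3) r] arr_eq(1)[of "snd r"] cu(2)[of "snd r"] by simp
  qed
  then have "loop_arrow_restrict W W' a = const_loop_arrow G W' ?p"
    using cu(4) cw(4) by (simp add: a_eq loop_arrow_restrict_def const_loop_arrow_def w_tgt del: inertia_groupoid_projections)
  with p W' show ?thesis by blast
qed

end

section \<open>The structure maps of the loop groupoid\<close>

lemma loop_groupoid_at_simps [simp]:
  "Obj (loop_groupoid_at G W) = loop_space G W"
  "Arr (loop_groupoid_at G W) = loop_arrow_space G W"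
  "src (loop_groupoid_at G W) a = fst a"
  "tgt (loop_groupoid_at G W) a = fst (snd a)"
  "ident (loop_groupoid_at G W) \<Psi> = (\<Psi>, \<Psi>, snd \<Psi>)"
  by (simp_all add: loop_groupoid_at_def Let_def split_beta)

context topological_groupoid
begin

lemma ident_loop_arrow_in:
  assumes W: "circle_points W" and \<Psi>: "\<Psi> \<in> topspace (loop_space G W)"
  shows "(\<Psi>, \<Psi>, snd \<Psi>) \<in> loop_arrows G W"
proof -
  let ?S = "circle_groupoid W"
  note D = loop_spaceD[OF \<Psi>] and S = circle_src_in[OF W] circle_tgt_in[OF W]
  have unit: "mult G (ident G (fst \<Psi> (src ?S r))) (snd \<Psi> r) = snd \<Psi> r"
    "mult G (snd \<Psi> r) (ident G (fst \<Psi> (tgt ?S r))) = snd \<Psi> r" if r: "r \<in> topspace (Arr ?S)" for r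
    using mult_ident_left[OF D(3)[OF r]] mult_ident_right[OF D(3)[OF r]] by (simp_all only: D(5,6)[OF r])
  have "(\<Psi>, \<Psi>, restrict (\<lambda>r. mult G (ident G (fst \<Psi> (src ?S r))) (snd \<Psi> r)) (topspace (Arr ?S))) \<in> loop_arrows G W"
    using continuous_map_ident[OF D(1)] D(4) unit
    by (intro loop_arrowsI[OF W \<Psi> \<Psi>, where \<kappa> = "\<lambda>p. ident G (fst \<Psi> p)"]) (simp_all only: src_ident tgt_ident)
  moreover have "restrict (\<lambda>r. mult G (ident G (fst \<Psi> (src ?S r))) (snd \<Psi> r)) (topspace (Arr ?S)) =
      restrict (snd \<Psi>) (topspace (Arr ?S))"
    by (rule restrict_ext) (rule unit(1))
  ultimately show ?thesis using \<Psi> by (simp add: mem_loop_space extensional_restrict)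
qed

lemma continuous_map_loop_arrow_ident:
  assumes "circle_points W" "(\<Psi>, \<Phi>, \<Lambda>) \<in> loop_arrows G W"
  shows "continuous_map (Obj (circle_groupoid W)) (Arr G) (\<lambda>p. \<Lambda> (ident (circle_groupoid W) p))"
  using continuous_map_compose[OF continuous_circle_ident loop_arrowsD(3)[OF assms]] by (simp add: o_def)

text \<open>Naturality squares paste. This is proved for all arrows, constant or not, because the
  product in the colimit ranges over arbitrary representatives at a common stage.\<close>

lemma mult_loop_arrow_in:
  assumes W: "circle_points W" and a: "a \<in> loop_arrows G W" and b: "b \<in> loop_arrows G W"
    and comp: "fst (snd a) = fst b"
  shows "mult (loop_groupoid_at G W) a b \<in> loop_arrows G W"
proof -
  let ?S = "circle_groupoid W"
  obtain \<Psi> \<Phi> \<Lambda> where a_eq: "a = (\<Psi>, \<Phi>, \<Lambda>)" by (metis surj_pair)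
  obtain \<Gamma> \<Omega> where b_eq: "b = (\<Phi>, \<Gamma>, \<Omega>)" using comp a_eq by (metis fst_conv snd_conv surj_pair)
  note A = loop_arrowsD[OF W a[unfolded a_eq]] and B = loop_arrowsD[OF W b[unfolded b_eq]]
  note \<Psi>D = loop_spaceD[OF A(1)] and \<Phi>D = loop_spaceD[OF A(2)] and \<Gamma>D = loop_spaceD[OF B(2)]
  let ?\<alpha> = "\<lambda>p. \<Lambda> (ident ?S p)" and ?\<beta> = "\<lambda>p. \<Omega> (ident ?S p)"
  have "(\<Psi>, \<Gamma>, restrict (\<lambda>r. mult G (mult G (?\<alpha> (src ?S r)) (?\<beta> (src ?S r))) (snd \<Gamma> r)) (topspace (Arr ?S)))
      \<in> loop_arrows G W"
  proof (rule loop_arrowsI[OF W A(1) B(2), where \<kappa> = "\<lambda>p. mult G (?\<alpha> p) (?\<beta> p)"])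
    show "continuous_map (Obj ?S) (Arr G) (\<lambda>p. mult G (?\<alpha> p) (?\<beta> p))"
      using A(6) B(5) a b by (intro continuous_map_mult continuous_map_loop_arrow_ident[OF W]) (simp_all add: a_eq b_eq)
    show "src G (mult G (?\<alpha> p) (?\<beta> p)) = fst \<Psi> p" "tgt G (mult G (?\<alpha> p) (?\<beta> p)) = fst \<Gamma> p"
      if "p \<in> topspace (Obj ?S)" for p
      using A(4-6)[OF that] B(4-6)[OF that] by (simp_all add: src_mult tgt_mult)
    fix r assume r: "r \<in> topspace (Arr ?S)"
    note s = circle_src_in[OF W r] and t = circle_tgt_in[OF W r]
    note in_G = A(4-6)[OF s] A(4-6)[OF t] B(4-6)[OF s] B(4-6)[OF t] \<Psi>D(3,5,6)[OF r] \<Phi>D(3,5,6)[OF r] \<Gamma>D(3,5,6)[OF r]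
    have "mult G (snd \<Psi> r) (mult G (?\<alpha> (tgt ?S r)) (?\<beta> (tgt ?S r))) = mult G (mult G (snd \<Psi> r) (?\<alpha> (tgt ?S r))) (?\<beta> (tgt ?S r))"
      by (rule mult_assoc[symmetric]) (simp_all add: in_G)
    also have "\<dots> = mult G (mult G (?\<alpha> (src ?S r)) (snd \<Phi> r)) (?\<beta> (tgt ?S r))"
      by (simp only: A(8)[OF r] flip: A(7)[OF r])
    also have "\<dots> = mult G (?\<alpha> (src ?S r)) (mult G (snd \<Phi> r) (?\<beta> (tgt ?S r)))"
      by (rule mult_assoc) (simp_all add: in_G)
    also have "\<dots> = mult G (?\<alpha> (src ?S r)) (mult G (?\<beta> (src ?S r)) (snd \<Gamma> r))"
      by (simp only: B(8)[OF r] flip: B(7)[OF r])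
    also have "\<dots> = mult G (mult G (?\<alpha> (src ?S r)) (?\<beta> (src ?S r))) (snd \<Gamma> r)"
      by (rule mult_assoc[symmetric]) (simp_all add: in_G)
    finally show "mult G (snd \<Psi> r) (mult G (?\<alpha> (tgt ?S r)) (?\<beta> (tgt ?S r))) =
      mult G (mult G (?\<alpha> (src ?S r)) (?\<beta> (src ?S r))) (snd \<Gamma> r)" .
  qed
  then show ?thesis by (simp add: a_eq b_eq loop_groupoid_at_def Let_def)
qed

lemma ginv_loop_arrow_in:
  assumes W: "circle_points W" and a: "a \<in> loop_arrows G W"
  shows "ginv (loop_groupoid_at G W) a \<in> loop_arrows G W"
proof -
  let ?S = "circle_groupoid W"
  obtain \<Psi> \<Phi> \<Lambda> where a_eq: "a = (\<Psi>, \<Phi>, \<Lambda>)" by (metis surj_pair)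
  note A = loop_arrowsD[OF W a[unfolded a_eq]]
  note \<Psi>D = loop_spaceD[OF A(1)] and \<Phi>D = loop_spaceD[OF A(2)]
  let ?\<alpha> = "\<lambda>p. \<Lambda> (ident ?S p)"
  have "(\<Phi>, \<Psi>, restrict (\<lambda>r. mult G (ginv G (?\<alpha> (src ?S r))) (snd \<Psi> r)) (topspace (Arr ?S))) \<in> loop_arrows G W"
  proof (rule loop_arrowsI[OF W A(2,1), where \<kappa> = "\<lambda>p. ginv G (?\<alpha> p)"])
    show "continuous_map (Obj ?S) (Arr G) (\<lambda>p. ginv G (?\<alpha> p))"
      using a by (intro continuous_map_ginv continuous_map_loop_arrow_ident[OF W]) (simp add: a_eq)
    show "src G (ginv G (?\<alpha> p)) = fst \<Phi> p" "tgt G (ginv G (?\<alpha> p)) = fst \<Psi> p" if "p \<in> topspace (Obj ?S)" for p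
      using A(4-6)[OF that] by (simp_all add: groupoid_simps)
    fix r assume r: "r \<in> topspace (Arr ?S)"
    note s = circle_src_in[OF W r] and t = circle_tgt_in[OF W r]
    let ?\<alpha>s = "?\<alpha> (src ?S r)" and ?\<alpha>t = "?\<alpha> (tgt ?S r)"
    note in_G = A(4-6)[OF s] A(4-6)[OF t] \<Psi>D(3,5,6)[OF r] \<Phi>D(3,5,6)[OF r]
    have "mult G (snd \<Phi> r) (ginv G ?\<alpha>t) = mult G (ginv G ?\<alpha>s) (mult G ?\<alpha>s (mult G (snd \<Phi> r) (ginv G ?\<alpha>t)))"
      by (rule ginv_mult_cancel_left[symmetric]) (simp_all add: in_G groupoid_simps)
    also have "mult G ?\<alpha>s (mult G (snd \<Phi> r) (ginv G ?\<alpha>t)) = mult G (mult G ?\<alpha>s (snd \<Phi> r)) (ginv G ?\<alpha>t)"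
      by (rule mult_assoc[symmetric]) (simp_all add: in_G groupoid_simps)
    also have "\<dots> = mult G (mult G (snd \<Psi> r) ?\<alpha>t) (ginv G ?\<alpha>t)"
      by (simp only: A(7)[OF r] flip: A(8)[OF r])
    also have "\<dots> = mult G (snd \<Psi> r) (mult G ?\<alpha>t (ginv G ?\<alpha>t))"
      by (rule mult_assoc) (simp_all add: in_G groupoid_simps)
    also have "\<dots> = snd \<Psi> r"
      using mult_ident_right[of "snd \<Psi> r"] by (simp add: in_G mult_ginv_right)
    finally show "mult G (snd \<Phi> r) (ginv G ?\<alpha>t) = mult G (ginv G ?\<alpha>s) (snd \<Psi> r)" .
  qed
  then show ?thesis by (simp add: a_eq loop_groupoid_at_def Let_def)
qed

lemma loop_arrow_restrict_const_iff:
  "loop_arrow_restrict W W' (\<Psi>, \<Phi>, \<Lambda>) = const_loop_arrow G W' p \<longleftrightarrow>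
     loop_restrict W W' \<Psi> = const_loop G W' (fst p) \<and>
     loop_restrict W W' \<Phi> = const_loop G W' (tgt (inertia_groupoid G) p) \<and>
     (\<forall>r\<in>circle_arrows W'. \<Lambda> (refinement_arr W r) = mult G (gpow G (fst p) (snd r)) (snd p))"
proof -
  have "restrict f A = restrict g A \<longleftrightarrow> (\<forall>x\<in>A. f x = g x)" for f g :: "s1_arr \<Rightarrow> 'a" and A
    by (auto simp: restrict_def fun_eq_iff)
  then show ?thesis
    by (simp add: loop_arrow_restrict_def const_loop_arrow_def del: inertia_groupoid_projections)
qed

lemma loop_restrict_const_arr:
  assumes "loop_restrict W W' \<Psi> = const_loop G W' v" "r \<in> circle_arrows W'"
  shows "snd \<Psi> (refinement_arr W r) = gpow G v (snd r)"
proof -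
  have "snd (loop_restrict W W' \<Psi>) r = snd (const_loop G W' v) r" by (simp only: assms(1))
  with assms(2) show ?thesis by (simp add: loop_restrict_def const_loop_def del: mem_circle_arr)
qed

lemma loop_arrow_restrict_const_ident:
  assumes "loop_arrow_restrict W W' (\<Psi>, \<Phi>, \<Lambda>) = const_loop_arrow G W' p" "p \<in> inertia_arrows"
    and "r \<in> circle_arrows W'"
  shows "\<Lambda> (ident (circle_groupoid W) (src (circle_groupoid W) (refinement_arr W r))) = snd p"
proof -
  obtain b c x l where r: "r = (((b, c), x), l)" by (rule circle_arr_cases)
  have "(((b, b), x), 0) \<in> circle_arrows W'" using assms(3) by (simp add: r)
  then have "\<Lambda> (refinement_arr W (((b, b), x), 0)) = mult G (gpow G (fst p) 0) (snd p)"
    using assms(1) unfolding loop_arrow_restrict_const_iff by fastforce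
  also have "\<dots> = snd p"
    using inertia_arrD[OF assms(2)] mult_ident_left[of "snd p"] by simp
  finally show ?thesis by (simp add: r refinement_arr_def)
qed

text \<open>The factors become constant only on \<open>W'\<close>, whereas the product is formed on
  \<open>W\<close>. On refined arrows it is the product of the second components followed by a power
  of the final loop, and \<open>gpow_conj\<close> moves that power to the front.\<close>

lemma loop_arrow_restrict_mult:
  assumes W: "circle_points W" "circle_points W'" "refines W' W"
    and a: "loop_arrow_restrict W W' a = const_loop_arrow G W' p" "p \<in> inertia_arrows"
    and b: "loop_arrow_restrict W W' b = const_loop_arrow G W' q" "q \<in> inertia_arrows"
    and comp: "fst (snd a) = fst b" "tgt (inertia_groupoid G) p = src (inertia_groupoid G) q"
  shows "loop_arrow_restrict W W' (mult (loop_groupoid_at G W) a b) = const_loop_arrow G W' (mult (inertia_groupoid G) p q)"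
proof -
  let ?H = "inertia_groupoid G" and ?S = "circle_groupoid W"
  interpret H: topological_groupoid ?H by (rule topological_groupoid_inertia)
  obtain \<Psi> \<Phi> \<Lambda> where a_eq: "a = (\<Psi>, \<Phi>, \<Lambda>)" by (metis surj_pair)
  obtain \<Gamma> \<Omega> where b_eq: "b = (\<Phi>, \<Gamma>, \<Omega>)" using comp a_eq by (metis fst_conv snd_conv surj_pair)
  let ?pq = "mult ?H p q"
  have pq: "?pq \<in> topspace (Arr ?H)" "src ?H ?pq = src ?H p" "tgt ?H ?pq = tgt ?H q"
    using a b comp by (simp_all add: H.src_mult H.tgt_mult H.mult_in del: inertia_groupoid_projections)
  have fst_pq: "fst ?pq = fst p" "snd ?pq = mult G (snd p) (snd q)" by simp_all
  have \<Gamma>: "loop_restrict W W' \<Gamma> = const_loop G W' (tgt ?H q)"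
    using b(1) unfolding b_eq loop_arrow_restrict_const_iff by blast
  have \<Psi>: "loop_restrict W W' \<Psi> = const_loop G W' (fst p)"
    using a(1) unfolding a_eq loop_arrow_restrict_const_iff by blast
  let ?M = "restrict (\<lambda>r. mult G (mult G (\<Lambda> (ident ?S (src ?S r))) (\<Omega> (ident ?S (src ?S r)))) (snd \<Gamma> r)) (topspace (Arr ?S))"
  have "?M (refinement_arr W r) = mult G (gpow G (fst ?pq) (snd r)) (snd ?pq)"
    if r: "r \<in> circle_arrows W'" for r
  proof -
    have "?M (refinement_arr W r) = mult G (mult G (snd p) (snd q)) (gpow G (tgt ?H q) (snd r))"
      using refinement_arr_in[OF W r] loop_arrow_restrict_const_ident[OF a[unfolded a_eq] r]
        loop_arrow_restrict_const_ident[OF b[unfolded b_eq] r] loop_restrict_const_arr[OF \<Gamma> r]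
      by (simp del: mem_circle_arr inertia_groupoid_projections)
    also have "\<dots> = mult G (snd ?pq) (gpow G (tgt ?H ?pq) (snd r))" by (simp only: pq(3) fst_pq(2))
    also have "\<dots> = mult G (gpow G (fst ?pq) (snd r)) (snd ?pq)"
      using gpow_conj[OF inertia_arrD(1-4)[OF pq(1)], of "snd r"] by simp
    finally show ?thesis .
  qed
  then have "loop_arrow_restrict W W' (\<Psi>, \<Gamma>, ?M) = const_loop_arrow G W' ?pq"
    unfolding loop_arrow_restrict_const_iff pq(3) fst_pq(1) using \<Psi> \<Gamma> by blast
  then show ?thesis by (simp add: a_eq b_eq loop_groupoid_at_def Let_def)
qed

lemma loop_arrow_restrict_ginv:
  assumes W: "circle_points W" "circle_points W'" "refines W' W"
    and a: "loop_arrow_restrict W W' a = const_loop_arrow G W' p" "p \<in> inertia_arrows"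
  shows "loop_arrow_restrict W W' (ginv (loop_groupoid_at G W) a) = const_loop_arrow G W' (ginv (inertia_groupoid G) p)"
proof -
  let ?H = "inertia_groupoid G" and ?S = "circle_groupoid W"
  interpret H: topological_groupoid ?H by (rule topological_groupoid_inertia)
  obtain \<Psi> \<Phi> \<Lambda> where a_eq: "a = (\<Psi>, \<Phi>, \<Lambda>)" by (metis surj_pair)
  let ?q = "ginv ?H p"
  have q: "?q \<in> topspace (Arr ?H)" "fst ?q = tgt ?H p" "tgt ?H ?q = fst p" "snd ?q = ginv G (snd p)"
    using H.ginv_in[OF a(2)] H.tgt_ginv[OF a(2)] by simp_all
  have \<Psi>: "loop_restrict W W' \<Psi> = const_loop G W' (fst p)"
    and \<Phi>: "loop_restrict W W' \<Phi> = const_loop G W' (tgt ?H p)"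
    using a(1) unfolding a_eq loop_arrow_restrict_const_iff by blast+
  let ?M = "restrict (\<lambda>r. mult G (ginv G (\<Lambda> (ident ?S (src ?S r)))) (snd \<Psi> r)) (topspace (Arr ?S))"
  have "?M (refinement_arr W r) = mult G (gpow G (fst ?q) (snd r)) (snd ?q)"
    if r: "r \<in> circle_arrows W'" for r
  proof -
    have "?M (refinement_arr W r) = mult G (ginv G (snd p)) (gpow G (fst p) (snd r))"
      using refinement_arr_in[OF W r] loop_arrow_restrict_const_ident[OF a[unfolded a_eq] r]
        loop_restrict_const_arr[OF \<Psi> r]
      by (simp del: mem_circle_arr)
    also have "\<dots> = mult G (snd ?q) (gpow G (tgt ?H ?q) (snd r))" by (simp only: q)
    also have "\<dots> = mult G (gpow G (fst ?q) (snd r)) (snd ?q)"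
      using gpow_conj[OF inertia_arrD(1-4)[OF q(1)], of "snd r"] by simp
    finally show ?thesis .
  qed
  then have "loop_arrow_restrict W W' (\<Phi>, \<Psi>, ?M) = const_loop_arrow G W' ?q"
    unfolding loop_arrow_restrict_const_iff q(3) q(2) using \<Psi> \<Phi> q(2) by simp
  then show ?thesis by (simp add: a_eq loop_groupoid_at_def Let_def)
qed

lemma loop_arrow_restrict_ident:
  assumes "loop_restrict W W' \<Psi> = const_loop G W' v" "v \<in> inertia_objects"
  shows "loop_arrow_restrict W W' (\<Psi>, \<Psi>, snd \<Psi>) = const_loop_arrow G W' (ident (inertia_groupoid G) v)"
proof -
  let ?H = "inertia_groupoid G"
  interpret H: topological_groupoid ?H by (rule topological_groupoid_inertia)
  note v = inertia_objD[OF assms(2)]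
  have *: "tgt ?H (ident ?H v) = v" "fst (ident ?H v) = v" "snd (ident ?H v) = ident G (src G v)"
    using H.tgt_ident[OF assms(2)] by simp_all
  have "mult G (gpow G v l) (ident G (src G v)) = gpow G v l" for l
    using mult_ident_right[of "gpow G v l"] v by simp
  then show ?thesis
    unfolding loop_arrow_restrict_const_iff * using assms(1) loop_restrict_const_arr[OF assms(1)] by simp
qed

end

section \<open>Evaluation at the base point\<close>

text \<open>The value at the arrow over 0 with integer 1, so a constant loop of powers of
  \<open>v\<close> returns \<open>v\<close>. Taking the canonical interval containing 0 makes the
  value invariant under refinement.\<close>

definition loop_eval :: "circle_cover \<Rightarrow> ('o, 'a) loop \<Rightarrow> 'a" where
  "loop_eval W \<Psi> = snd \<Psi> (((canonical_index W 0, canonical_index W 0), 0), 1)"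

text \<open>The second component uses integer 0, an identity arrow: the zeroth power drops out,
  leaving \<alpha>, and the topology on arrows of loops sees exactly the values on
  identities.\<close>

definition loop_arrow_eval :: "circle_cover \<Rightarrow> ('o, 'a) loop_arrow \<Rightarrow> 'a \<times> 'a" where
  "loop_arrow_eval W a =
     (loop_eval W (fst a), snd (snd a) (((canonical_index W 0, canonical_index W 0), 0), 0))"

lemma base_arrow_in:
  assumes "W \<in> admissible_covers"
  shows "(((canonical_index W 0, canonical_index W 0), 0), l) \<in> circle_arrows W"
    and "(canonical_index W 0, 0) \<in> circle_objects W"
  using canonical_index_in[OF admissible_circle_points[OF assms]]
    canonical_index_le[OF admissible_circle_points[OF assms], of 0]
    canonical_index_next[OF admissible_circle_points[OF assms], of 0] admissible_pos[OF assms]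
  by (simp_all add: mem_cover_interval)

lemma
  assumes W: "W \<in> admissible_covers" "W' \<in> admissible_covers" "refines W' W"
  shows loop_eval_restrict: "loop_eval W' (loop_restrict W W' \<Psi>) = loop_eval W \<Psi>"
    and loop_arrow_eval_restrict: "loop_arrow_eval W' (loop_arrow_restrict W W' a) = loop_arrow_eval W a"
proof -
  have ref: "refinement_arr W (((canonical_index W' 0, canonical_index W' 0), 0), l) =
      (((canonical_index W 0, canonical_index W 0), 0), l)" for l
    using canonical_index_canonical_index[OF W(1,2)[THEN admissible_circle_points] W(3)]
    by (simp add: refinement_arr_def)
  show *: "loop_eval W' (loop_restrict W W' \<Psi>) = loop_eval W \<Psi>" for \<Psi>
    using base_arrow_in(1)[OF W(2)] by (simp add: loop_eval_def loop_restrict_def ref del: mem_circle_arr)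
  show "loop_arrow_eval W' (loop_arrow_restrict W W' a) = loop_arrow_eval W a"
    using base_arrow_in(1)[OF W(2)]
    by (simp add: loop_arrow_eval_def loop_arrow_restrict_def split_beta * ref del: mem_circle_arr)
qed

lemma continuous_loop_eval:
  assumes "W \<in> admissible_covers"
  shows "continuous_map (loop_space G W) (Arr G) (loop_eval W)"
proof -
  have "continuous_map (loop_space G W) (compact_open_topology (Arr (circle_groupoid W)) (Arr G)) snd"
    by (simp add: loop_space_def Let_def continuous_map_from_subtopology continuous_map_snd)
  from continuous_map_compose[OF this continuous_map_compact_open_eval[OF base_arrow_in(1)[OF assms]]]
  show ?thesis by (simp add: o_def loop_eval_def[abs_def])
qed

lemma continuous_loop_arrow_eval:
  assumes W: "W \<in> admissible_covers"
  shows "continuous_map (loop_arrow_space G W) (prod_topology (Arr G) (Arr G)) (loop_arrow_eval W)"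
proof -
  let ?S = "circle_groupoid W" and ?c = "canonical_index W 0"
  let ?g = "\<lambda>(\<psi> :: s1_arr \<Rightarrow> 'b, \<kappa> :: s1_obj \<Rightarrow> 'b). (\<psi> (((?c, ?c), 0), 1), \<kappa> (?c, 0))"
  let ?P = "prod_topology (compact_open_topology (Arr ?S) (Arr G)) (compact_open_topology (Obj ?S) (Arr G))"
  let ?f = "\<lambda>(\<Psi> :: ('a, 'b) loop, \<Phi> :: ('a, 'b) loop, \<Lambda> :: s1_arr \<Rightarrow> 'b).
    (snd \<Psi>, restrict (\<lambda>x. \<Lambda> (ident ?S x)) (topspace (Obj ?S)))"
  have "continuous_map ?P (prod_topology (Arr G) (Arr G)) ?g"
    using continuous_map_compose[OF continuous_map_fst continuous_map_compact_open_eval[OF base_arrow_in(1)[OF W, of 1]],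
        of "Arr G" "compact_open_topology (Obj ?S) (Arr G)"]
      continuous_map_compose[OF continuous_map_snd continuous_map_compact_open_eval[OF base_arrow_in(2)[OF W]],
        of "compact_open_topology (Arr ?S) (Arr G)" "Arr G"]
    by (simp add: continuous_map_pairwise o_def split_beta)
  then have "continuous_map (loop_arrow_space G W) (prod_topology (Arr G) (Arr G)) (?g \<circ> ?f)"
    unfolding loop_arrow_space_def Let_def by (rule continuous_map_pullback)
  moreover have "?g \<circ> ?f = loop_arrow_eval W"
    using base_arrow_in(2)[OF W] by (auto simp: fun_eq_iff loop_arrow_eval_def loop_eval_def)
  ultimately show ?thesis by simp
qed

section \<open>The fixed subgroupoid is isomorphic to the inertia groupoid\<close>

text \<open>The structure maps of the colimit are definite descriptions over all representatives:
  one of them gives existence, independence of the choice gives uniqueness.\<close>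

lemma the_class_eqI:
  assumes "(j, y) \<in> A" "\<And>i x. (i, x) \<in> A \<Longrightarrow> f i x = c"
  shows "(THE d. \<exists>(i, x)\<in>A. d = f i x) = c"
  using assms by (intro the_equality) fastforce+

lemma directed_system_loops:
  "directed_system admissible_covers (\<lambda>W W'. refines W' W) (loop_space G) loop_restrict"
proof
  show "\<exists>k\<in>admissible_covers. refines k i \<and> refines k j"
    if "i \<in> admissible_covers" "j \<in> admissible_covers" for i j
    using common_refinement[OF that] by metis
qed (auto intro: refines_trans loop_restrict_loop_restrict admissible_circle_points)

lemma directed_system_loop_arrows:
  "directed_system admissible_covers (\<lambda>W W'. refines W' W) (loop_arrow_space G) loop_arrow_restrict"
proof
  show "\<exists>k\<in>admissible_covers. refines k i \<and> refines k j"
    if "i \<in> admissible_covers" "j \<in> admissible_covers" for i j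
    using common_refinement[OF that] by metis
qed (auto intro: refines_trans loop_arrow_restrict_loop_arrow_restrict admissible_circle_points)

text \<open>With a single point there are no three distinct members, so the condition on triples is
  vacuous. Any stage would do; this one is explicit.\<close>

lemma unit_cover_admissible: "({1}, 1) \<in> admissible_covers"
  by (auto simp: admissible_covers_def)

context topological_groupoid
begin

interpretation L0: directed_system admissible_covers "\<lambda>W W'. refines W' W" "loop_space G" loop_restrict
  by (rule directed_system_loops)

interpretation L1: directed_system admissible_covers "\<lambda>W W'. refines W' W" "loop_arrow_space G" loop_arrow_restrict
  by (rule directed_system_loop_arrows)

abbreviation cls0 :: "circle_cover \<times> ('o, 'a) loop \<Rightarrow> ('o, 'a) colim_loop" where
  "cls0 \<equiv> colim_class admissible_covers (\<lambda>W W'. refines W' W) (loop_space G) loop_restrict"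

abbreviation cls1 :: "circle_cover \<times> ('o, 'a) loop_arrow \<Rightarrow> ('o, 'a) colim_loop_arrow" where
  "cls1 \<equiv> colim_class admissible_covers (\<lambda>W W'. refines W' W) (loop_arrow_space G) loop_arrow_restrict"

definition loop_class :: "'a \<Rightarrow> ('o, 'a) colim_loop" where
  "loop_class v = L0.stable_class (\<lambda>W. const_loop G W v)"

definition loop_arrow_class :: "'a \<times> 'a \<Rightarrow> ('o, 'a) colim_loop_arrow" where
  "loop_arrow_class p = L1.stable_class (\<lambda>W. const_loop_arrow G W p)"

lemma compatible_const_loop:
  "v \<in> inertia_objects \<Longrightarrow> L0.compatible_family (\<lambda>W. const_loop G W v)"
  by (auto simp: L0.compatible_family_def admissible_circle_points const_loop_in loop_restrict_const)

lemma compatible_const_loop_arrow: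
  "p \<in> inertia_arrows \<Longrightarrow> L1.compatible_family (\<lambda>W. const_loop_arrow G W p)"
  by (auto simp: L1.compatible_family_def admissible_circle_points topspace_loop_arrow_space
      const_loop_arrow_in loop_arrow_restrict_const)

lemma mem_loop_class:
  "(W, \<Psi>) \<in> loop_class v \<longleftrightarrow> W \<in> admissible_covers \<and> \<Psi> \<in> topspace (loop_space G W) \<and>
     (\<exists>W'\<in>admissible_covers. refines W' W \<and> loop_restrict W W' \<Psi> = const_loop G W' v)"
  by (simp add: loop_class_def L0.stable_class_def)

lemma mem_loop_arrow_class:
  "(W, a) \<in> loop_arrow_class p \<longleftrightarrow> W \<in> admissible_covers \<and> a \<in> loop_arrows G W \<and>
     (\<exists>W'\<in>admissible_covers. refines W' W \<and> loop_arrow_restrict W W' a = const_loop_arrow G W' p)"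
  by (simp add: loop_arrow_class_def L1.stable_class_def topspace_loop_arrow_space)

lemma colim_class_eq_loop_class:
  assumes "v \<in> inertia_objects" "(W, \<Psi>) \<in> loop_class v"
  shows "cls0 (W, \<Psi>) = loop_class v"
  using L0.colim_class_eq_stable_class[OF compatible_const_loop[OF assms(1)]] assms(2)
  by (simp add: loop_class_def)

lemma colim_class_eq_loop_arrow_class:
  assumes "p \<in> inertia_arrows" "(W, a) \<in> loop_arrow_class p"
  shows "cls1 (W, a) =
    loop_arrow_class p"
  using L1.colim_class_eq_stable_class[OF compatible_const_loop_arrow[OF assms(1)]] assms(2)
  by (simp add: loop_arrow_class_def)

lemma const_loop_mem_class:
  "v \<in> inertia_objects \<Longrightarrow> W \<in> admissible_covers \<Longrightarrow> (W, const_loop G W v) \<in> loop_class v"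
  using L0.stable_class_mem[OF compatible_const_loop] by (simp add: loop_class_def)

lemma const_loop_arrow_mem_class:
  "p \<in> inertia_arrows \<Longrightarrow> W \<in> admissible_covers \<Longrightarrow>
    (W, const_loop_arrow G W p) \<in> loop_arrow_class p"
  using L1.stable_class_mem[OF compatible_const_loop_arrow] by (simp add: loop_arrow_class_def)

lemma rotation_loop_class:
  "rotation_obj z (loop_class v) = loop_class v"
  unfolding rotation_obj_def loop_class_def
  by (rule L0.rotation_stable_class)
    (simp_all add: shift_cover_admissible shift_cover_shift_cover refines_shift_cover rotate_loop_in
      rotate_loop_inverse rotate_loop_restrict rotate_loop_const admissible_circle_points)

lemma rotation_loop_arrow_class:
  "rotation_arr z (loop_arrow_class p) = loop_arrow_class p"
  unfolding rotation_arr_def loop_arrow_class_def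
  by (rule L1.rotation_stable_class)
    (simp_all add: shift_cover_admissible shift_cover_shift_cover refines_shift_cover rotate_loop_arrow_in
      rotate_loop_arrow_inverse rotate_loop_arrow_restrict rotate_loop_arrow_const admissible_circle_points
      topspace_loop_arrow_space)

abbreviation colim_loops :: "('o, 'a) colim_loop topology" where
  "colim_loops \<equiv> colim_topology admissible_covers (\<lambda>W W'. refines W' W) (loop_space G) loop_restrict"

abbreviation colim_loop_arrows :: "('o, 'a) colim_loop_arrow topology" where
  "colim_loop_arrows \<equiv> colim_topology admissible_covers (\<lambda>W W'. refines W' W) (loop_arrow_space G) loop_arrow_restrict"

lemma fixed_loops_eq:
  "topspace colim_loops \<inter> {c. \<forall>z. rotation_obj z c = c} = loop_class ` inertia_objects"
  unfolding loop_class_def[abs_def]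
proof (rule L0.topspace_colim_Collect[where m = "({1}, 1)"])
  fix W \<Psi> assume W: "W \<in> admissible_covers" "\<Psi> \<in> topspace (loop_space G W)"
    and fixed: "\<forall>z. rotation_obj z (cls0 (W, \<Psi>)) = cls0 (W, \<Psi>)"
  have "\<exists>W''\<in>admissible_covers. refines W'' W \<and> refines W'' (shift_cover z W) \<and>
      loop_restrict W W'' \<Psi> = loop_restrict (shift_cover z W) W'' (rotate_loop z W \<Psi>)" for z
    by (rule L0.rotation_fixed_colim_class[OF W]) (rule fixed[rule_format, of z, unfolded rotation_obj_def])
  from rotation_fixed_loop[OF W this] W
  show "\<exists>t\<in>inertia_objects. (W, \<Psi>) \<in> L0.stable_class (\<lambda>W. const_loop G W t)"
    by (auto simp: L0.stable_class_def)
qed (simp_all add: compatible_const_loop unit_cover_admissible rotation_loop_class flip: loop_class_def)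

lemma fixed_loop_arrows_eq:
  "topspace colim_loop_arrows \<inter> {c. \<forall>z. rotation_arr z c = c} = loop_arrow_class ` inertia_arrows"
  unfolding loop_arrow_class_def[abs_def]
proof (rule L1.topspace_colim_Collect[where m = "({1}, 1)"])
  fix W a assume W: "W \<in> admissible_covers" "a \<in> topspace (loop_arrow_space G W)"
    and fixed: "\<forall>z. rotation_arr z (cls1 (W, a)) = cls1 (W, a)"
  have "\<exists>W''\<in>admissible_covers. refines W'' W \<and> refines W'' (shift_cover z W) \<and>
      loop_arrow_restrict W W'' a = loop_arrow_restrict (shift_cover z W) W'' (rotate_loop_arrow z W a)" for z
    by (rule L1.rotation_fixed_colim_class[OF W]) (rule fixed[rule_format, of z, unfolded rotation_arr_def])
  from rotation_fixed_loop_arrow[OF W[unfolded topspace_loop_arrow_space] this] W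
  show "\<exists>t\<in>inertia_arrows. (W, a) \<in> L1.stable_class (\<lambda>W. const_loop_arrow G W t)"
    by (auto simp: L1.stable_class_def)
qed (simp_all add: compatible_const_loop_arrow unit_cover_admissible rotation_loop_arrow_class flip: loop_arrow_class_def)

lemma homeomorphic_map_loop_class:
  "homeomorphic_map (Obj (inertia_groupoid G)) (Obj (rotation_fixed_loop_groupoid G)) loop_class"
proof -
  have Obj: "Obj (rotation_fixed_loop_groupoid G) = subtopology colim_loops {c. \<forall>z. rotation_obj z c = c}"
    by (simp add: rotation_fixed_loop_groupoid_def loop_groupoid_def colim_groupoid_def Let_def)
  show ?thesis
    unfolding Obj loop_class_def[abs_def]
  proof (rule L0.homeomorphic_map_stable_class[where e = loop_eval and Y = "Arr G" and m = "({1}, 1)"])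
    show "continuous_map (Obj (inertia_groupoid G)) (loop_space G ({1}, 1)) (const_loop G ({1}, 1))"
      by (intro continuous_const_loop admissible_circle_points unit_cover_admissible)
    show "continuous_map Z (Obj (inertia_groupoid G)) f"
      if "continuous_map Z (Arr G) f" "f ` topspace Z \<subseteq> inertia_objects"
      for Z :: "('o, 'a) colim_loop topology" and f
      using that unfolding continuous_map_into_inertia_obj by (auto simp: topspace_inertia_groupoid)
    show "loop_eval W (const_loop G W v) = v"
      if "v \<in> inertia_objects" "W \<in> admissible_covers" for v W
      using base_arrow_in(1)[OF that(2)] inertia_objD[OF that(1)]
      by (simp add: loop_eval_def const_loop_def del: mem_circle_arr)
    show "topspace colim_loops \<inter> {c. \<forall>z. rotation_obj z c = c} =
        (\<lambda>v. L0.stable_class (\<lambda>W. const_loop G W v)) ` inertia_objects"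
      using fixed_loops_eq unfolding loop_class_def[abs_def] .
  qed (rule compatible_const_loop unit_cover_admissible continuous_loop_eval loop_eval_restrict; assumption)+
qed

lemma homeomorphic_map_loop_arrow_class:
  "homeomorphic_map (Arr (inertia_groupoid G)) (Arr (rotation_fixed_loop_groupoid G)) loop_arrow_class"
proof -
  have Arr: "Arr (rotation_fixed_loop_groupoid G) = subtopology colim_loop_arrows {c. \<forall>z. rotation_arr z c = c}"
    by (simp add: rotation_fixed_loop_groupoid_def loop_groupoid_def colim_groupoid_def Let_def)
  show ?thesis
    unfolding Arr loop_arrow_class_def[abs_def]
  proof (rule L1.homeomorphic_map_stable_class[where e = loop_arrow_eval
        and Y = "prod_topology (Arr G) (Arr G)" and m = "({1}, 1)"])
    show "continuous_map (Arr (inertia_groupoid G)) (loop_arrow_space G ({1}, 1)) (const_loop_arrow G ({1}, 1))"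
      by (intro continuous_const_loop_arrow admissible_circle_points unit_cover_admissible)
    show "continuous_map Z (Arr (inertia_groupoid G)) f"
      if "continuous_map Z (prod_topology (Arr G) (Arr G)) f" "f ` topspace Z \<subseteq> inertia_arrows"
      for Z :: "('o, 'a) colim_loop_arrow topology" and f
      using that unfolding continuous_map_into_inertia_arr
      by (fastforce simp: topspace_inertia_groupoid continuous_map_pairwise o_def)
    show "loop_arrow_eval W (const_loop_arrow G W p) = p"
      if "p \<in> inertia_arrows" "W \<in> admissible_covers" for p W
      using base_arrow_in(1)[OF that(2)] inertia_arrD[OF that(1)] mult_ident_left[of "snd p"]
      by (simp add: loop_arrow_eval_def loop_eval_def const_loop_arrow_def const_loop_def
          del: mem_circle_arr inertia_groupoid_projections)
    show "topspace colim_loop_arrows \<inter> {c. \<forall>z. rotation_arr z c = c} =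
        (\<lambda>p. L1.stable_class (\<lambda>W. const_loop_arrow G W p)) ` inertia_arrows"
      using fixed_loop_arrows_eq unfolding loop_arrow_class_def[abs_def] .
  qed (rule compatible_const_loop_arrow unit_cover_admissible continuous_loop_arrow_eval
      loop_arrow_eval_restrict; assumption)+
qed

lemma rotation_fixed_structure:
  "src (rotation_fixed_loop_groupoid G) A =
     (THE c. \<exists>(W, a)\<in>A. c = cls0 (W, fst a))"
  "tgt (rotation_fixed_loop_groupoid G) A =
     (THE c. \<exists>(W, a)\<in>A. c = cls0 (W, fst (snd a)))"
  "mult (rotation_fixed_loop_groupoid G) A B =
     (THE c. \<exists>W a b. (W, a) \<in> A \<and> (W, b) \<in> B \<and> fst (snd a) = fst b \<and>
        c = cls1 (W, mult (loop_groupoid_at G W) a b))"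
  "ginv (rotation_fixed_loop_groupoid G) A =
     (THE c. \<exists>(W, a)\<in>A. c = cls1 (W, ginv (loop_groupoid_at G W) a))"
  "ident (rotation_fixed_loop_groupoid G) X =
     (THE c. \<exists>(W, \<Psi>)\<in>X. c = cls1 (W, (\<Psi>, \<Psi>, snd \<Psi>)))"
  by (simp_all add: rotation_fixed_loop_groupoid_def loop_groupoid_def colim_groupoid_def Let_def)

text \<open>The homeomorphisms are already available. For the structure maps, every representative
  of a fixed class, constant or not, is shown to yield a representative of the class predicted by
  the inertia groupoid.\<close>

lemma groupoid_isomorphism_inertia_fixed_loops:
  "groupoid_isomorphism (inertia_groupoid G) (rotation_fixed_loop_groupoid G) (loop_class, loop_arrow_class)"
proof -
  let ?H = "inertia_groupoid G" and ?L = "rotation_fixed_loop_groupoid G"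
  let ?W = "({1}, 1) :: circle_cover"
  interpret H: topological_groupoid ?H by (rule topological_groupoid_inertia)
  have src_class: "(W, fst a) \<in> loop_class (src ?H p)" and tgt_class: "(W, fst (snd a)) \<in> loop_class (tgt ?H p)"
    and ginv_class: "(W, ginv (loop_groupoid_at G W) a) \<in> loop_arrow_class (ginv ?H p)"
    if p: "p \<in> topspace (Arr ?H)" and a: "(W, a) \<in> loop_arrow_class p" for p W a
  proof -
    obtain W' where W: "W \<in> admissible_covers" "a \<in> loop_arrows G W" "W' \<in> admissible_covers" "refines W' W"
      and eq: "loop_arrow_restrict W W' a = const_loop_arrow G W' p"
      using a by (auto simp: mem_loop_arrow_class)
    obtain \<Psi> \<Phi> \<Lambda> where a_eq: "a = (\<Psi>, \<Phi>, \<Lambda>)" by (metis surj_pair)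
    have "\<Psi> \<in> topspace (loop_space G W)" "\<Phi> \<in> topspace (loop_space G W)"
      using W(2) by (auto simp: a_eq loop_arrows_def Let_def)
    moreover have "loop_restrict W W' \<Psi> = const_loop G W' (fst p)"
      "loop_restrict W W' \<Phi> = const_loop G W' (tgt ?H p)"
      using eq unfolding a_eq loop_arrow_restrict_const_iff by blast+
    ultimately show "(W, fst a) \<in> loop_class (src ?H p)" "(W, fst (snd a)) \<in> loop_class (tgt ?H p)"
      using W by (auto simp: mem_loop_class a_eq simp del: inertia_groupoid_projections(2))
    show "(W, ginv (loop_groupoid_at G W) a) \<in> loop_arrow_class (ginv ?H p)"
      using W ginv_loop_arrow_in[OF admissible_circle_points[OF W(1)] W(2)]
        loop_arrow_restrict_ginv[OF admissible_circle_points[OF W(1)] admissible_circle_points[OF W(3)] W(4) eq p]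
      by (auto simp: mem_loop_arrow_class simp del: inertia_groupoid_projections)
  qed
  \<comment> \<open>The two factors may become constant on different refinements \<open>A\<close>
    and \<open>B\<close>; a common refinement \<open>C\<close> makes both constant.\<close>
  have mult_class: "(W, mult (loop_groupoid_at G W) a b) \<in> loop_arrow_class (mult ?H p q)"
    if p: "p \<in> topspace (Arr ?H)" and q: "q \<in> topspace (Arr ?H)" and pq: "tgt ?H p = src ?H q"
      and a: "(W, a) \<in> loop_arrow_class p" and b: "(W, b) \<in> loop_arrow_class q" and ab: "fst (snd a) = fst b"
    for p q W a b
  proof -
    have W: "W \<in> admissible_covers" "a \<in> topspace (loop_arrow_space G W)" "b \<in> topspace (loop_arrow_space G W)"
      using a b by (auto simp: mem_loop_arrow_class topspace_loop_arrow_space)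
    obtain A where A: "A \<in> admissible_covers" "refines A W" "loop_arrow_restrict W A a = const_loop_arrow G A p"
      using a by (auto simp: mem_loop_arrow_class)
    obtain B where B: "B \<in> admissible_covers" "refines B W" "loop_arrow_restrict W B b = const_loop_arrow G B q"
      using b by (auto simp: mem_loop_arrow_class)
    obtain C where C: "C \<in> admissible_covers" "refines C A" "refines C B"
      using common_refinement[OF A(1) B(1)] by blast
    have "loop_arrow_restrict W C a = const_loop_arrow G C p"
      by (rule L1.stable_later[OF compatible_const_loop_arrow[OF p] W(1,2) A C(1,2)])
    moreover have "loop_arrow_restrict W C b = const_loop_arrow G C q"
      by (rule L1.stable_later[OF compatible_const_loop_arrow[OF q] W(1,3) B C(1,3)])
    ultimately have "loop_arrow_restrict W C (mult (loop_groupoid_at G W) a b) = const_loop_arrow G C (mult ?H p q)"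
      using loop_arrow_restrict_mult admissible_circle_points W(1) C(1) refines_trans[OF C(2) A(2)] p q ab pq by blast
    moreover have "mult (loop_groupoid_at G W) a b \<in> loop_arrows G W"
      using mult_loop_arrow_in[OF admissible_circle_points[OF W(1)]] W(2,3) ab
      by (simp add: topspace_loop_arrow_space)
    ultimately show ?thesis
      using W(1) C(1) refines_trans[OF C(2) A(2)] unfolding mem_loop_arrow_class by blast
  qed
  have ident_class: "(W, (\<Psi>, \<Psi>, snd \<Psi>)) \<in> loop_arrow_class (ident ?H v)"
    if v: "v \<in> topspace (Obj ?H)" and \<Psi>: "(W, \<Psi>) \<in> loop_class v" for v W \<Psi>
    using \<Psi> loop_arrow_restrict_ident[OF _ v] ident_loop_arrow_in admissible_circle_points
    unfolding mem_loop_class mem_loop_arrow_class by blast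
  have src_eq: "src ?L (loop_arrow_class p) = loop_class (src ?H p)"
    and tgt_eq: "tgt ?L (loop_arrow_class p) = loop_class (tgt ?H p)"
    and ginv_eq: "ginv ?L (loop_arrow_class p) = loop_arrow_class (ginv ?H p)"
    if p: "p \<in> topspace (Arr ?H)" for p
    unfolding rotation_fixed_structure
    by (rule the_class_eqI[OF const_loop_arrow_mem_class[OF p unit_cover_admissible]],
        rule colim_class_eq_loop_class[OF H.src_in[OF p] src_class[OF p]]
          colim_class_eq_loop_class[OF H.tgt_in[OF p] tgt_class[OF p]]
          colim_class_eq_loop_arrow_class[OF H.ginv_in[OF p] ginv_class[OF p]], assumption)+
  have ident_eq: "ident ?L (loop_class v) = loop_arrow_class (ident ?H v)" if v: "v \<in> topspace (Obj ?H)" for v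
    unfolding rotation_fixed_structure
    by (rule the_class_eqI[OF const_loop_mem_class[OF v unit_cover_admissible]],
        rule colim_class_eq_loop_arrow_class[OF H.ident_in[OF v] ident_class[OF v]], assumption)
  have mult_eq: "mult ?L (loop_arrow_class p) (loop_arrow_class q) = loop_arrow_class (mult ?H p q)"
    if p: "p \<in> topspace (Arr ?H)" and q: "q \<in> topspace (Arr ?H)" and pq: "tgt ?H p = src ?H q" for p q
    unfolding rotation_fixed_structure
  proof (rule the_equality)
    note in_H = H.mult_in[OF p q pq]
    \<comment> \<open>Constant representatives on one cover are composable on the nose; they witness
      that the description of the product is not empty.\<close>
    have comp: "fst (snd (const_loop_arrow G ?W p)) = fst (const_loop_arrow G ?W q)"
      using pq by (simp add: const_loop_arrow_def)
    note in_p = const_loop_arrow_mem_class[OF p unit_cover_admissible]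
      and in_q = const_loop_arrow_mem_class[OF q unit_cover_admissible]
    show "\<exists>W a b. (W, a) \<in> loop_arrow_class p \<and> (W, b) \<in> loop_arrow_class q \<and> fst (snd a) = fst b \<and>
        loop_arrow_class (mult ?H p q) =
        cls1 (W, mult (loop_groupoid_at G W) a b)"
      by (rule exI[of _ ?W], rule exI[of _ "const_loop_arrow G ?W p"], rule exI[of _ "const_loop_arrow G ?W q"])
        (intro conjI in_p in_q comp
          colim_class_eq_loop_arrow_class[OF in_H mult_class[OF p q pq in_p in_q comp], symmetric])
    fix c assume "\<exists>W a b. (W, a) \<in> loop_arrow_class p \<and> (W, b) \<in> loop_arrow_class q \<and> fst (snd a) = fst b \<and>
        c = cls1 (W, mult (loop_groupoid_at G W) a b)"
    then show "c = loop_arrow_class (mult ?H p q)"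
      using colim_class_eq_loop_arrow_class[OF in_H mult_class[OF p q pq]] by blast
  qed
  show ?thesis
    unfolding groupoid_isomorphism_def groupoid_morphism_def
    using homeomorphic_map_loop_class homeomorphic_map_loop_arrow_class
    by (simp add: homeomorphic_imp_continuous_map src_eq tgt_eq ginv_eq ident_eq mult_eq
        del: inertia_groupoid_projections)
qed

end

theorem proposition3p6p6:
  fixes G :: "('o, 'a) groupoid"
    and A0 :: "'o chart set"
    and A1 :: "'a chart set"
  assumes "orbifold_groupoid G A0 A1"
  shows "morita_equivalent (rotation_fixed_loop_groupoid G) (inertia_groupoid G)"
proof -
  interpret topological_groupoid G
    using assms by (simp add: orbifold_groupoid_def smooth_groupoid_def)
  interpret H: topological_groupoid "inertia_groupoid G" by (rule topological_groupoid_inertia)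
  have "open_map (Arr G) (Obj G) (src G)"
    using assms by (auto simp: orbifold_groupoid_def etale_groupoid_def intro: open_map_local_diffeomorphism)
  from open_map_src_inertia_groupoid[OF topological_groupoid_axioms this] show ?thesis
    by (rule H.morita_equivalent_isomorphic[OF groupoid_isomorphism_inertia_fixed_loops])
qed

end
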